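(* Let $S=\{s_{m,n}\}_{m,n\in\mathbb{Z}_+}$ be a family of complex numbers satisfying the positivity condition $$\sum_{m,n,m',n'\in\mathbb{Z}_+}\alpha_{m,n}\overline{\alpha_{m',n'}}\,s_{m+m',n+n'}\ge 0$$ for all complex coefficients $\alpha_{m,n}$, all but finitely many of which are zero. Consider the two-dimensional moment problem: find a non-negative Borel measure $\mu$ on $\mathbb{R}^2$ with $\int_{\mathbb{R}^2}x_1^mx_2^n\,d\mu=s_{m,n}$ for all $m,n\in\mathbb{Z}_+$. Fix an arbitrary model space $\mathcal{H}$ with a family $\{h_{m,n}\}_{m,n\in\mathbb{Z}_+}$ satisfying $(h_{m,n},h_{m',n'})_{\mathcal{H}_0}=s_{m+m',n+n'}$, together with the auxiliary choices ($e_j$, $w$, $\{g_n\}$, $M_j$) described in the context. The moment problem has a solution if and only if (a) those of the equations (E1)–(E10) of the context all of whose vectors belong to $\{h_{m,0,0;n,0,0}:\ m,n\in\mathbb{Z}_+\}$ are satisfied with $h_{m,0,0;n,0,0}:=h_{m,n}$, $m,n\in\mathbb{Z}_+$; and (b) $\mathbf{G}\ne\emptyset$, where $\mathbf{G}$ is the set produced by the algorithm described in the context. If (a) and (b) are satisfied, then to each $(v_1,v_2,\dots)\in\mathbf{G}$ associate the family $\mathfrak{H}=\{h_{m,k,l;n,r,t}\}_{(m,k,l;n,r,t)\in\Omega}$ defined by $h_{m,0,0;n,0,0}=h_{m,n}$ ($m,n\in\mathbb{Z}_+$) and $h_{w(q)}:=v_q$ ($q\in\mathbb{N}$). This family belongs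 to $X(\mathcal{H})$, and, with $\varphi$ the function from condition 4) in the definition of $X(\mathcal{H})$, the (unique) solution $\mu$ of the extended two-dimensional moment problem $$\int_{\mathbb{R}^2}x_1^m(x_1+i)^k(x_1-i)^l\,x_2^n(x_2+i)^r(x_2-i)^t\,d\mu=\varphi(m,k,l;n,r,t),\qquad (m,k,l;n,r,t)\in\Omega,$$ is a solution of the two-dimensional moment problem. Moreover, all solutions of the two-dimensional moment problem can be obtained in this way.
   Context: **Conventions.** $\mathbb{N}$ is the set of positive integers, $\mathbb{Z}_+$ the non-negative integers. Hilbert spaces are complex and separable, with scalar product linear in the first argument. A solution of a moment problem is a non-negative Borel measure for which all the integrals exist and have the prescribed values. **Index sets.** $\Omega=\{(m,k,l;n,r,t):\ m,n\in\mathbb{Z}_+,\ k,l,r,t\in\mathbb{Z}\}$, $\Omega_0=\{(m,k,l;n,r,t)\in\Omega:\ k=l=r=t=0\}$, $\Omega'=\Omega\setminus\Omega_0$. Fix an arbitrary bijection $w:\mathbb{N}\to\Omega'$. **Model space.** For $\{s_{m,n}\}$ satisfying the positivity condition, there are a Hilbert space $\mathcal{H}_0$ and a family $\{h_{m,n}\}_{m,n\in\mathbb{Z}_+}$ with closed linear span $\mathcal{H}_0$ such that $(h_{m,n},h_{m',n'})_{\mathcal{H}_0}=s_{m+m',n+n'}$. A model space is $\mathcal{H}=\mathcal{H}_0\oplus\big(\bigoplus_{j=1}^\infty\mathcal{H}_j\big)$ with arbitrary one-dimensional Hilbert spaces $\mathcal{H}_j$; $e_j\in\mathcal{H}_j$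 are arbitrary fixed unit vectors. $\{g_n\}_{n\ge1}$ is the orthonormal basis of $\mathcal{H}_0$ obtained by Gram–Schmidt orthogonalization from $\{h_{m,n}\}$ arranged in a single sequence (if $\dim\mathcal{H}_0<\infty$, the index $n$ of $g_n$ below runs only over $1,\dots,\dim\mathcal{H}_0$). **The set $X(\mathcal{H})$.** It consists of all families $\{h_{m,k,l;n,r,t}\}_{(m,k,l;n,r,t)\in\Omega}$ in $\mathcal{H}$ such that: 1) $h_{m,0,0;n,0,0}=h_{m,n}$ for $m,n\in\mathbb{Z}_+$; 2) for some $\Lambda\subset\mathbb{N}$, $h_{w(q)}\in\mathcal{H}_0\oplus\big(\bigoplus_{j\in\Lambda,\,j\le q}\mathcal{H}_j\big)$ and $(h_{w(q)},e_q)\ge0$ for all $q\in\mathbb{N}$; 3) for all $(m,k,l;n,r,t)\in\Omega$: $h_{m+1,k,l;n,r,t}+ih_{m,k,l;n,r,t}=h_{m,k+1,l;n,r,t}$, $h_{m+1,k,l;n,r,t}-ih_{m,k,l;n,r,t}=h_{m,k,l+1;n,r,t}$, $h_{m,k,l;n+1,r,t}+ih_{m,k,l;n,r,t}=h_{m,k,l;n,r+1,t}$, $h_{m,k,l;n+1,r,t}-ih_{m,k,l;n,r,t}=h_{m,k,l;n,r,t+1}$; 4) there is a function $\varphi:\Omega\to\mathbb{C}$ with $(h_{m,k,l;n,r,t},h_{m',k',l';n',r',t'})_{\mathcal{H}}=\varphi(m+m',k+l',l+k';n+n',r+t',t+r')$ for all pairs of indices in $\Omega$. **Equations.** For a family $\{h_{m,k,l;n,r,t}\}$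 in $\mathcal{H}$ consider, for all indices in $\Omega$: (E1) $(h_{m+1,k,l;n,r,t}+ih_{m,k,l;n,r,t},h_{a,b,c;d,e,f})=(h_{m,k+1,l;n,r,t},h_{a,b,c;d,e,f})$; (E2) $(h_{m+1,k,l;n,r,t}-ih_{m,k,l;n,r,t},h_{a,b,c;d,e,f})=(h_{m,k,l+1;n,r,t},h_{a,b,c;d,e,f})$; (E3) $(h_{m,k,l;n+1,r,t}+ih_{m,k,l;n,r,t},h_{a,b,c;d,e,f})=(h_{m,k,l;n,r+1,t},h_{a,b,c;d,e,f})$; (E4) $(h_{m,k,l;n+1,r,t}-ih_{m,k,l;n,r,t},h_{a,b,c;d,e,f})=(h_{m,k,l;n,r,t+1},h_{a,b,c;d,e,f})$; (E5) $(h_{m,k,l;n,r,t},h_{m',k',l';n',r',t'})=(h_{\widetilde m,k,l;n,r,t},h_{\widetilde m',k',l';n',r',t'})$ if $m+m'=\widetilde m+\widetilde m'$; (E6) $(h_{m,k,l;n,r,t},h_{m',k',l';n',r',t'})=(h_{m,\widetilde k,l;n,r,t},h_{m',k',\widetilde l';n',r',t'})$ if $k+l'=\widetilde k+\widetilde l'$; (E7) $(h_{m,k,l;n,r,t},h_{m',k',l';n',r',t'})=(h_{m,k,\widetilde l;n,r,t},h_{m',\widetilde k',l';n',r',t'})$ if $l+k'=\widetilde l+\widetilde k'$; (E8) $(h_{m,k,l;n,r,t},h_{m',k',l';n',r',t'})=(h_{m,k,l;\widetilde n,r,t},h_{m',k',l';\widetilde n',r',t'})$ if $n+n'=\widetilde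 n+\widetilde n'$; (E9) $(h_{m,k,l;n,r,t},h_{m',k',l';n',r',t'})=(h_{m,k,l;n,\widetilde r,t},h_{m',k',l';n',r',\widetilde t'})$ if $r+t'=\widetilde r+\widetilde t'$; (E10) $(h_{m,k,l;n,r,t},h_{m',k',l';n',r',t'})=(h_{m,k,l;n,r,\widetilde t},h_{m',k',l';n',\widetilde r',t'})$ if $t+r'=\widetilde t+\widetilde r'$. **Constants.** For each $j\in\mathbb{N}$, with $w(j)=(m,k,l;n,r,t)$, $M_j=M_j(S)>0$ is a fixed constant depending only on the prescribed moments such that $\int_{\mathbb{R}^2}x_1^{2m}(x_1^2+1)^{k+l}x_2^{2n}(x_2^2+1)^{r+t}\,d\mu\le M_j$ for every solution $\mu$ of the two-dimensional moment problem with moments $S$. **Algorithm.** Step 0: set $h_{m,0,0;n,0,0}=h_{m,n}$, and check those equations (E1)–(E10) that involve only these vectors (if they fail, stop: no solution). Step $q$ ($q\ge1$): seek $h_{w(q)}=\sum_n\alpha_{q;n}g_n+\sum_{j=1}^{q}\beta_{q;j}e_j$ with complex coefficients. Given $(h_{w(1)},\dots,h_{w(q-1)})\in G_{q-1}$ (no such parameters when $q=1$), let $L_q$ be the set of those equations (E1)–(E10) that involve $h_{w(q)}$ and otherwise only the vectors $h_{m,0,0;n,0,0}$ and $h_{w(1)},\dots,h_{w(q-1)}$. Writing $d_q$ for $(h_{w(q)},h_{w(q)})$, the equations in $L_q$ are regarded as equations in the unknowns $\alpha_{q;n}$ (all $n$), $\beta_{q;j}$ ($1\le j\le q-1$) and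 $d_q$ (the coefficient $\beta_{q;q}$ enters only through $d_q$). Let $S_q$ be the set of all $(\alpha_{q;n},\ \text{all }n;\ \beta_{q;j},\ 1\le j\le q-1;\ d_q;\ h_{w(1)},\dots,h_{w(q-1)})$ such that $(h_{w(1)},\dots,h_{w(q-1)})\in G_{q-1}$ and the equations $L_q$ with these parameters are satisfied. Let $\widehat S_q$ be the subset of $S_q$ given by $\sum_n|\alpha_{q;n}|^2+\sum_{j=1}^{q-1}|\beta_{q;j}|^2\le d_q$ and $d_q\le M_q$. Let $G_q$ be the set of all tuples $$\Big(h_{w(1)},\dots,h_{w(q-1)},\ \sum_n\alpha_{q;n}g_n+\sum_{j=1}^{q-1}\beta_{q;j}e_j+\Big(d_q-\sum_n|\alpha_{q;n}|^2-\sum_{j=1}^{q-1}|\beta_{q;j}|^2\Big)^{1/2}e_q\Big)$$ with $(\alpha_{q;n};\beta_{q;j};d_q;h_{w(1)},\dots,h_{w(q-1)})\in\widehat S_q$ (possibly $G_q=\emptyset$). Final step: let $\mathbf{H}$ be the space of sequences $\mathbf{h}=(h_1,h_2,\dots)$ in $\mathcal{H}$ with $\|\mathbf{h}\|_{\mathbf{H}}=\sup_{q}M_q^{-1/2}\|h_q\|_{\mathcal{H}}<\infty$. Let $\mathbf{G}_q\subset\mathbf{H}$ be the set of all sequences $(h_1,\dots,h_q,v_{q+1},v_{q+2},\dots)$ with $(h_1,\dots,h_q)\in G_q$ and $v_j\in\mathcal{H}$, $\|v_j\|_{\mathcal{H}}\le\sqrt{M_j}$ for $j>q$ ($\mathbf{G}_q=\emptyset$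 if $G_q=\emptyset$). Put $\mathbf{G}=\bigcap_{q=1}^\infty\mathbf{G}_q$. *)

theory Defs
  imports "HOL-Analysis.Analysis"
begin

section \<open>Complex Hilbert spaces\<close>

text \<open>
  The scalar product is linear in the first argument. Separability is not a class axiom; it
  follows for every model space below, which is the closed linear span of countably many vectors.
\<close>

class complex_hilbert = banach +
  fixes scaleC :: "complex \<Rightarrow> 'a \<Rightarrow> 'a" (infixr "*\<^sub>C" 75)
    and cinner :: "'a \<Rightarrow> 'a \<Rightarrow> complex"
  assumes scaleC_add_right: "c *\<^sub>C (x + y) = c *\<^sub>C x + c *\<^sub>C y"
    and scaleC_add_left: "(b + c) *\<^sub>C x = b *\<^sub>C x + c *\<^sub>C x"
    and scaleC_scaleC: "b *\<^sub>C (c *\<^sub>C x) = (b * c) *\<^sub>C x"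
    and scaleR_eq_scaleC: "r *\<^sub>R x = complex_of_real r *\<^sub>C x"
    and cinner_commute: "cinner x y = cnj (cinner y x)"
    and cinner_add_left: "cinner (x + y) z = cinner x z + cinner y z"
    and cinner_scaleC_left: "cinner (c *\<^sub>C x) y = c * cinner x y"
    and cinner_self: "cinner x x = complex_of_real ((norm x)\<^sup>2)"

lemma scaleC_one: "1 *\<^sub>C x = x"
  for x :: "'a::complex_hilbert"
  using scaleR_eq_scaleC[of 1 x] by simp

global_interpretation complex_vector: vector_space "scaleC :: complex \<Rightarrow> 'a \<Rightarrow> 'a::complex_hilbert"
  defines cspan = complex_vector.span
  by unfold_locales (simp_all add: scaleC_add_right scaleC_add_left scaleC_scaleC scaleC_one)

section \<open>The moment problems\<close>

type_synonym idx = "nat \<times> int \<times> int \<times> nat \<times> int \<times> int"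

text \<open>
  The index set \<open>\<Omega>\<close> is the whole type \<^typ>\<open>idx\<close>. The index set of the positive
  integers is \<^term>\<open>{1..} :: nat set\<close> throughout.
\<close>

definition Omega0 :: "idx set" where
  "Omega0 = {(m, k, l, n, r, t). k = 0 \<and> l = 0 \<and> r = 0 \<and> t = 0}"

definition Omega' :: "idx set" where
  "Omega' = UNIV - Omega0"

definition positivity_condition :: "(nat \<Rightarrow> nat \<Rightarrow> complex) \<Rightarrow> bool" where
  "positivity_condition s \<longleftrightarrow>
    (\<forall>\<alpha> :: nat \<times> nat \<Rightarrow> complex. finite {p. \<alpha> p \<noteq> 0} \<longrightarrow>
      (\<Sum>(m, n)\<in>{p. \<alpha> p \<noteq> 0}. \<Sum>(m', n')\<in>{p. \<alpha> p \<noteq> 0}.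
         \<alpha> (m, n) * cnj (\<alpha> (m', n')) * s (m + m') (n + n')) \<in> \<real>\<^sub>\<ge>\<^sub>0)"

definition moment_solution :: "(nat \<Rightarrow> nat \<Rightarrow> complex) \<Rightarrow> (real \<times> real) measure \<Rightarrow> bool" where
  "moment_solution s \<mu> \<longleftrightarrow> sets \<mu> = sets borel \<and>
    (\<forall>m n. has_bochner_integral \<mu> (\<lambda>(x1, x2). complex_of_real (x1 ^ m * x2 ^ n)) (s m n))"

definition extended_moment_solution :: "(idx \<Rightarrow> complex) \<Rightarrow> (real \<times> real) measure \<Rightarrow> bool" where
  "extended_moment_solution \<phi> \<mu> \<longleftrightarrow> sets \<mu> = sets borel \<and>
    (\<forall>m k l n r t. has_bochner_integral \<mu>
       (\<lambda>(x1, x2).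
          complex_of_real x1 ^ m * (complex_of_real x1 + \<i>) powi k * (complex_of_real x1 - \<i>) powi l *
          complex_of_real x2 ^ n * (complex_of_real x2 + \<i>) powi r * (complex_of_real x2 - \<i>) powi t)
       (\<phi> (m, k, l, n, r, t)))"

definition bounding_constants ::
  "(nat \<Rightarrow> nat \<Rightarrow> complex) \<Rightarrow> (nat \<Rightarrow> idx) \<Rightarrow> (nat \<Rightarrow> real) \<Rightarrow> bool" where
  "bounding_constants s w M \<longleftrightarrow>
    (\<forall>j\<ge>1. M j > 0 \<and>
      (\<forall>\<mu>. moment_solution s \<mu> \<longrightarrow>
        (case w j of (m, k, l, n, r, t) \<Rightarrow>
          (\<integral>(x1, x2). x1 ^ (2 * m) * (x1\<^sup>2 + 1) powi (k + l) *
                     x2 ^ (2 * n) * (x2\<^sup>2 + 1) powi (r + t) \<partial>\<mu>) \<le> M j)))"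

section \<open>The model space\<close>

definition H0 :: "(nat \<Rightarrow> nat \<Rightarrow> 'h) \<Rightarrow> 'h::complex_hilbert set" where
  "H0 h = closure (cspan (range (case_prod h)))"

text \<open>
  The whole type \<^typ>\<open>'h\<close> is the orthogonal direct sum of \<^term>\<open>H0 h\<close> and the
  one-dimensional spaces \<open>H\<^sub>j = cspan {e j}\<close>, for \<open>j \<ge> 1\<close>. A one-dimensional space is
  determined by the unit vector chosen in it, so the \<open>H\<^sub>j\<close> are not separate parameters.
\<close>

definition model_space ::
  "(nat \<Rightarrow> nat \<Rightarrow> complex) \<Rightarrow> (nat \<Rightarrow> nat \<Rightarrow> 'h) \<Rightarrow> (nat \<Rightarrow> 'h::complex_hilbert) \<Rightarrow> bool" where
  "model_space s h e \<longleftrightarrow>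
    (\<forall>m n m' n'. cinner (h m n) (h m' n') = s (m + m') (n + n')) \<and>
    (\<forall>j\<ge>1. norm (e j) = 1) \<and>
    (\<forall>i\<ge>1. \<forall>j\<ge>1. i \<noteq> j \<longrightarrow> cinner (e i) (e j) = 0) \<and>
    (\<forall>x\<in>H0 h. \<forall>j\<ge>1. cinner x (e j) = 0) \<and>
    closure (cspan (H0 h \<union> e ` {1..})) = UNIV"

text \<open>
  Gram--Schmidt orthonormalization of a sequence \<open>x 0, x 1, \<dots>\<close>. A vector that depends linearly
  on its predecessors gives the entry \<open>0\<close> (as \<^term>\<open>sgn 0 = 0\<close>); such entries are dropped,
  and the remaining ones are renumbered from \<open>1\<close>.
\<close>

fun gram_schmidt :: "(nat \<Rightarrow> 'h) \<Rightarrow> nat \<Rightarrow> 'h::complex_hilbert" where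
  "gram_schmidt x k =
    sgn (x k - (\<Sum>j<k. cinner (x k) (gram_schmidt x j) *\<^sub>C gram_schmidt x j))"

declare gram_schmidt.simps [simp del]

definition gram_schmidt_basis :: "(nat \<Rightarrow> 'h) \<Rightarrow> nat \<Rightarrow> 'h::complex_hilbert" where
  "gram_schmidt_basis x n = gram_schmidt x (enumerate {k. gram_schmidt x k \<noteq> 0} (n - 1))"

text \<open>
  \<open>{1, 2, \<dots>}\<close>, or \<open>{1, \<dots>, d}\<close> if the linear span of the sequence has finite dimension \<open>d\<close>.
\<close>

definition gram_schmidt_index :: "(nat \<Rightarrow> 'h::complex_hilbert) \<Rightarrow> nat set" where
  "gram_schmidt_index x =
    {n. 1 \<le> n \<and> (finite {k. gram_schmidt x k \<noteq> 0} \<longrightarrow> n \<le> card {k. gram_schmidt x k \<noteq> 0})}"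

section \<open>The set \<open>X(H)\<close>\<close>

text \<open>The family with \<open>h\<^bsub>m,0,0;n,0,0\<^esub> = h m n\<close> and \<open>h\<^bsub>w(q)\<^esub> = v q\<close> for \<open>q \<ge> 1\<close>.\<close>

definition family_of ::
  "(nat \<Rightarrow> nat \<Rightarrow> 'h) \<Rightarrow> (nat \<Rightarrow> idx) \<Rightarrow> (nat \<Rightarrow> 'h) \<Rightarrow> idx \<Rightarrow> 'h" where
  "family_of h w v I =
    (if I \<in> Omega0 then (case I of (m, _, _, n, _, _) \<Rightarrow> h m n) else v (inv_into {1..} w I))"

definition represents :: "(idx \<Rightarrow> 'h::complex_hilbert) \<Rightarrow> (idx \<Rightarrow> complex) \<Rightarrow> bool" where
  "represents f \<phi> \<longleftrightarrow>
    (\<forall>m k l n r t m' k' l' n' r' t'.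
      cinner (f (m, k, l, n, r, t)) (f (m', k', l', n', r', t')) =
      \<phi> (m + m', k + l', l + k', n + n', r + t', t + r'))"

definition X_set ::
  "(nat \<Rightarrow> nat \<Rightarrow> 'h) \<Rightarrow> (nat \<Rightarrow> 'h) \<Rightarrow> (nat \<Rightarrow> idx) \<Rightarrow> (idx \<Rightarrow> 'h::complex_hilbert) set" where
  "X_set h e w = {f.
    (\<forall>m n. f (m, 0, 0, n, 0, 0) = h m n) \<and>
    (\<exists>\<Lambda>\<subseteq>{1..}. \<forall>q\<ge>1.
       f (w q) \<in> {x + y | x y. x \<in> H0 h \<and> y \<in> cspan (e ` {j \<in> \<Lambda>. j \<le> q})} \<and>
       cinner (f (w q)) (e q) \<in> \<real>\<^sub>\<ge>\<^sub>0) \<and>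
    (\<forall>m k l n r t.
       f (m + 1, k, l, n, r, t) + \<i> *\<^sub>C f (m, k, l, n, r, t) = f (m, k + 1, l, n, r, t) \<and>
       f (m + 1, k, l, n, r, t) - \<i> *\<^sub>C f (m, k, l, n, r, t) = f (m, k, l + 1, n, r, t) \<and>
       f (m, k, l, n + 1, r, t) + \<i> *\<^sub>C f (m, k, l, n, r, t) = f (m, k, l, n, r + 1, t) \<and>
       f (m, k, l, n + 1, r, t) - \<i> *\<^sub>C f (m, k, l, n, r, t) = f (m, k, l, n, r, t + 1)) \<and>
    (\<exists>\<phi>. represents f \<phi>)}"

section \<open>The equations\<close>

text \<open>
  \<open>Eqn [(c\<^sub>1, I\<^sub>1), \<dots>, (c\<^sub>p, I\<^sub>p)] J I' J'\<close> stands for the equation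
  \<open>(c\<^sub>1 h\<^bsub>I\<^sub>1\<^esub> + \<dots> + c\<^sub>p h\<^bsub>I\<^sub>p\<^esub>, h\<^bsub>J\<^esub>) = (h\<^bsub>I'\<^esub>, h\<^bsub>J'\<^esub>)\<close>. Equations are kept as syntactic objects because
  the algorithm selects them according to the vectors that occur in them.
\<close>

datatype eqn = Eqn "(complex \<times> idx) list" idx idx idx

primrec involved :: "eqn \<Rightarrow> idx set" where
  "involved (Eqn cs J I' J') = snd ` set cs \<union> {J, I', J'}"

text \<open>
  Truth of an equation, with the left-hand side expanded by linearity, when \<open>K I J\<close> is the value
  of the scalar product \<open>(h\<^bsub>I\<^esub>, h\<^bsub>J\<^esub>)\<close>. The values are a parameter because the algorithm treats
  one of them, \<open>(h\<^bsub>w(q)\<^esub>, h\<^bsub>w(q)\<^esub>)\<close>, as an independent unknown.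
\<close>

primrec eqn_holds :: "(idx \<Rightarrow> idx \<Rightarrow> complex) \<Rightarrow> eqn \<Rightarrow> bool" where
  "eqn_holds K (Eqn cs J I' J') \<longleftrightarrow> (\<Sum>(c, I)\<leftarrow>cs. c * K I J) = K I' J'"

definition E1 :: "eqn set" where
  "E1 = {Eqn [(1, (m + 1, k, l, n, r, t)), (\<i>, (m, k, l, n, r, t))] J (m, k + 1, l, n, r, t) J
         | m k l n r t J. True}"

definition E2 :: "eqn set" where
  "E2 = {Eqn [(1, (m + 1, k, l, n, r, t)), (- \<i>, (m, k, l, n, r, t))] J (m, k, l + 1, n, r, t) J
         | m k l n r t J. True}"

definition E3 :: "eqn set" where
  "E3 = {Eqn [(1, (m, k, l, n + 1, r, t)), (\<i>, (m, k, l, n, r, t))] J (m, k, l, n, r + 1, t) J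
         | m k l n r t J. True}"

definition E4 :: "eqn set" where
  "E4 = {Eqn [(1, (m, k, l, n + 1, r, t)), (- \<i>, (m, k, l, n, r, t))] J (m, k, l, n, r, t + 1) J
         | m k l n r t J. True}"

definition E5 :: "eqn set" where
  "E5 = {Eqn [(1, (m, k, l, n, r, t))] (m', k', l', n', r', t')
             (mt, k, l, n, r, t) (mt', k', l', n', r', t')
         | m k l n r t m' k' l' n' r' t' mt mt'. m + m' = mt + mt'}"

definition E6 :: "eqn set" where
  "E6 = {Eqn [(1, (m, k, l, n, r, t))] (m', k', l', n', r', t')
             (m, kt, l, n, r, t) (m', k', lt', n', r', t')
         | m k l n r t m' k' l' n' r' t' kt lt'. k + l' = kt + lt'}"

definition E7 :: "eqn set" where
  "E7 = {Eqn [(1, (m, k, l, n, r, t))] (m', k', l', n', r', t')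
             (m, k, lt, n, r, t) (m', kt', l', n', r', t')
         | m k l n r t m' k' l' n' r' t' lt kt'. l + k' = lt + kt'}"

definition E8 :: "eqn set" where
  "E8 = {Eqn [(1, (m, k, l, n, r, t))] (m', k', l', n', r', t')
             (m, k, l, nt, r, t) (m', k', l', nt', r', t')
         | m k l n r t m' k' l' n' r' t' nt nt'. n + n' = nt + nt'}"

definition E9 :: "eqn set" where
  "E9 = {Eqn [(1, (m, k, l, n, r, t))] (m', k', l', n', r', t')
             (m, k, l, n, rt, t) (m', k', l', n', r', tt')
         | m k l n r t m' k' l' n' r' t' rt tt'. r + t' = rt + tt'}"

definition E10 :: "eqn set" where
  "E10 = {Eqn [(1, (m, k, l, n, r, t))] (m', k', l', n', r', t')
              (m, k, l, n, r, tt) (m', k', l', n', rt', t')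
         | m k l n r t m' k' l' n' r' t' tt rt'. t + r' = tt + rt'}"

definition equations :: "eqn set" where
  "equations = E1 \<union> E2 \<union> E3 \<union> E4 \<union> E5 \<union> E6 \<union> E7 \<union> E8 \<union> E9 \<union> E10"

section \<open>The algorithm\<close>

text \<open>All vectors involved have indices in \<^const>\<open>Omega0\<close>, so the third argument of
  \<^const>\<open>family_of\<close> plays no role.\<close>

definition step0_condition ::
  "(nat \<Rightarrow> nat \<Rightarrow> 'h::complex_hilbert) \<Rightarrow> (nat \<Rightarrow> idx) \<Rightarrow> bool" where
  "step0_condition h w \<longleftrightarrow>
    (\<forall>E\<in>equations. involved E \<subseteq> Omega0 \<longrightarrow>
       eqn_holds (\<lambda>I J. cinner (family_of h w (\<lambda>_. 0) I) (family_of h w (\<lambda>_. 0) J)) E)"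

definition L_eqs :: "(nat \<Rightarrow> idx) \<Rightarrow> nat \<Rightarrow> eqn set" where
  "L_eqs w q = {E \<in> equations. w q \<in> involved E \<and> involved E \<subseteq> Omega0 \<union> w ` {1..q}}"

text \<open>The part of \<open>h\<^bsub>w(q)\<^esub>\<close> orthogonal to \<^term>\<open>e q\<close>, i.e. without the term \<open>\<beta>\<^bsub>q;q\<^esub> e\<^sub>q\<close>.\<close>

definition partial_vec ::
  "(nat \<Rightarrow> 'h) \<Rightarrow> nat set \<Rightarrow> (nat \<Rightarrow> 'h) \<Rightarrow> nat \<Rightarrow> (nat \<Rightarrow> complex) \<Rightarrow> (nat \<Rightarrow> complex) \<Rightarrow>
   'h::complex_hilbert" where
  "partial_vec g N e q \<alpha> \<beta> =
    (\<Sum>\<^sub>\<infinity>n\<in>N. \<alpha> n *\<^sub>C g n) + (\<Sum>j\<in>{1..<q}. \<beta> j *\<^sub>C e j)"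

definition sqnorm_coeffs ::
  "nat set \<Rightarrow> nat \<Rightarrow> (nat \<Rightarrow> complex) \<Rightarrow> (nat \<Rightarrow> complex) \<Rightarrow> real" where
  "sqnorm_coeffs N q \<alpha> \<beta> = (\<Sum>\<^sub>\<infinity>n\<in>N. (cmod (\<alpha> n))\<^sup>2) + (\<Sum>j\<in>{1..<q}. (cmod (\<beta> j))\<^sup>2)"

text \<open>
  Scalar products at step \<open>q\<close> in terms of the unknowns \<open>\<alpha>\<close>, \<open>\<beta>\<close>, \<open>d\<close>. For vectors other than
  \<open>h\<^bsub>w(q)\<^esub>\<close> that occur in \<open>L\<^sub>q\<close> (all of them orthogonal to \<open>e\<^sub>q\<close>), the scalar product with
  \<open>h\<^bsub>w(q)\<^esub>\<close> does not depend on \<open>\<beta>\<^bsub>q;q\<^esub>\<close>, so \<^const>\<open>partial_vec\<close> may be used for \<open>h\<^bsub>w(q)\<^esub>\<close>.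
\<close>

definition step_gram ::
  "(nat \<Rightarrow> nat \<Rightarrow> 'h) \<Rightarrow> (nat \<Rightarrow> 'h) \<Rightarrow> (nat \<Rightarrow> idx) \<Rightarrow> (nat \<Rightarrow> 'h) \<Rightarrow> nat set \<Rightarrow> nat \<Rightarrow>
   (nat \<Rightarrow> complex) \<Rightarrow> (nat \<Rightarrow> complex) \<Rightarrow> real \<Rightarrow> (nat \<Rightarrow> 'h::complex_hilbert) \<Rightarrow>
   idx \<Rightarrow> idx \<Rightarrow> complex" where
  "step_gram h e w g N q \<alpha> \<beta> d v I J =
    (let f = family_of h w (v(q := partial_vec g N e q \<alpha> \<beta>))
     in if I = w q \<and> J = w q then complex_of_real d else cinner (f I) (f J))"

text \<open>
  Elements of \<open>S\<^sub>q\<close> are quadruples \<open>(\<alpha>, \<beta>, d, v)\<close>; only \<open>\<alpha> n\<close> with \<open>n \<in> N\<close> and \<open>\<beta> j\<close> with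
  \<open>1 \<le> j < q\<close> are relevant. The argument \<open>G\<close> is \<open>G\<^bsub>q-1\<^esub>\<close>. Tuples \<open>(h\<^bsub>w(1)\<^esub>, \<dots>, h\<^bsub>w(q)\<^esub>)\<close> are
  functions in \<^term>\<open>extensional {1..q}\<close>. Square-summability of \<open>\<alpha>\<close> expresses that the series
  \<open>\<Sum>\<^sub>n \<alpha>\<^sub>n g\<^sub>n\<close> defines a vector.
\<close>

definition S_step ::
  "(nat \<Rightarrow> nat \<Rightarrow> 'h) \<Rightarrow> (nat \<Rightarrow> 'h) \<Rightarrow> (nat \<Rightarrow> idx) \<Rightarrow> (nat \<Rightarrow> 'h) \<Rightarrow> nat set \<Rightarrow> nat \<Rightarrow>
   (nat \<Rightarrow> 'h) set \<Rightarrow>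
   ((nat \<Rightarrow> complex) \<times> (nat \<Rightarrow> complex) \<times> real \<times> (nat \<Rightarrow> 'h::complex_hilbert)) set" where
  "S_step h e w g N q G = {(\<alpha>, \<beta>, d, v).
    v \<in> G \<and> (\<lambda>n. (cmod (\<alpha> n))\<^sup>2) summable_on N \<and>
    (\<forall>E\<in>L_eqs w q. eqn_holds (step_gram h e w g N q \<alpha> \<beta> d v) E)}"

definition Shat_step ::
  "(nat \<Rightarrow> nat \<Rightarrow> 'h) \<Rightarrow> (nat \<Rightarrow> 'h) \<Rightarrow> (nat \<Rightarrow> idx) \<Rightarrow> (nat \<Rightarrow> 'h) \<Rightarrow> nat set \<Rightarrow> (nat \<Rightarrow> real) \<Rightarrow> nat \<Rightarrow>
   (nat \<Rightarrow> 'h) set \<Rightarrow>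
   ((nat \<Rightarrow> complex) \<times> (nat \<Rightarrow> complex) \<times> real \<times> (nat \<Rightarrow> 'h::complex_hilbert)) set" where
  "Shat_step h e w g N M q G =
    {(\<alpha>, \<beta>, d, v) \<in> S_step h e w g N q G. sqnorm_coeffs N q \<alpha> \<beta> \<le> d \<and> d \<le> M q}"

primrec G_step ::
  "(nat \<Rightarrow> nat \<Rightarrow> 'h) \<Rightarrow> (nat \<Rightarrow> 'h) \<Rightarrow> (nat \<Rightarrow> idx) \<Rightarrow> (nat \<Rightarrow> 'h) \<Rightarrow> nat set \<Rightarrow> (nat \<Rightarrow> real) \<Rightarrow> nat \<Rightarrow>
   (nat \<Rightarrow> 'h::complex_hilbert) set" where
  "G_step h e w g N M 0 = {\<lambda>_. undefined}"
| "G_step h e w g N M (Suc p) =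
    (\<lambda>(\<alpha>, \<beta>, d, v). v(Suc p :=
       partial_vec g N e (Suc p) \<alpha> \<beta> +
       complex_of_real (sqrt (d - sqnorm_coeffs N (Suc p) \<alpha> \<beta>)) *\<^sub>C e (Suc p)))
    ` Shat_step h e w g N M (Suc p) (G_step h e w g N M p)"

text \<open>Sequences \<open>(h\<^sub>1, h\<^sub>2, \<dots>)\<close> are functions in \<^term>\<open>extensional {1..}\<close>.\<close>

definition bold_H :: "(nat \<Rightarrow> real) \<Rightarrow> (nat \<Rightarrow> 'h::complex_hilbert) set" where
  "bold_H M = {v \<in> extensional {1..}. bdd_above ((\<lambda>q. norm (v q) / sqrt (M q)) ` {1..})}"

definition bold_G_step ::
  "(nat \<Rightarrow> nat \<Rightarrow> 'h) \<Rightarrow> (nat \<Rightarrow> 'h) \<Rightarrow> (nat \<Rightarrow> idx) \<Rightarrow> (nat \<Rightarrow> 'h) \<Rightarrow> nat set \<Rightarrow> (nat \<Rightarrow> real) \<Rightarrow> nat \<Rightarrow>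
   (nat \<Rightarrow> 'h::complex_hilbert) set" where
  "bold_G_step h e w g N M q =
    {v \<in> bold_H M. restrict v {1..q} \<in> G_step h e w g N M q \<and> (\<forall>j>q. norm (v j) \<le> sqrt (M j))}"

definition bold_G ::
  "(nat \<Rightarrow> nat \<Rightarrow> 'h) \<Rightarrow> (nat \<Rightarrow> 'h) \<Rightarrow> (nat \<Rightarrow> idx) \<Rightarrow> (nat \<Rightarrow> 'h) \<Rightarrow> nat set \<Rightarrow> (nat \<Rightarrow> real) \<Rightarrow>
   (nat \<Rightarrow> 'h::complex_hilbert) set" where
  "bold_G h e w g N M = (\<Inter>q\<in>{1..}. bold_G_step h e w g N M q)"

end

theory Submission
  imports Defs "HOL-Probability.Probability"
begin

text \<open>
  The Cayley transform \<open>x \<mapsto> (x + i) / (x - i)\<close> carries the extended moment problem to the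
  trigonometric moment problem on the torus. If a family \<open>f\<close> satisfies conditions 3) and 4), then for
  each pair \<open>(p, q)\<close> the vectors \<open>f(0, a + p, -a; 0, b + q, -b)\<close>, \<open>a, b \<in> \<int>\<close>, form a stationary field,
  and its spectral measure on the torus is the image of
  \<open>(x\<^sub>1\<^sup>2 + 1)\<^sup>p (x\<^sub>2\<^sup>2 + 1)\<^sup>q d\<mu>\<close>. The relations 3) link the spectral measures for neighbouring exponents; as
  the exponents are arbitrary integers, no mass sits at infinity, and \<open>\<mu>\<close> is recovered. Uniqueness is the
  density of trigonometric polynomials in the continuous functions on the torus.

  The algorithm selects exactly the sequences whose Gram matrix satisfies (E1)-(E10): each equation
  enters \<open>L\<^sub>q\<close> for the largest \<open>q\<close> such that \<open>h\<^bsub>w(q)\<^esub>\<close> occurs in it. Conversely, a solution \<open>\<mu>\<close> prescribes all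
  scalar products, and these are realized one vector at a time: by the Riesz representation theorem
  there is a vector \<open>y\<close> in the closed span of the earlier vectors with the prescribed products, of norm at
  most the prescribed norm \<open>d\<^bsup>1/2\<^esup>\<close>, and the missing part \<open>d - \<parallel>y\<parallel>\<^sup>2\<close> is supplied by \<open>e\<^sub>q\<close>.
\<close>

section \<open>Geometry of complex Hilbert spaces\<close>

text \<open>The spectral theorem for commuting unitary shifts would produce the spectral measures;
  here they are built by hand. The discrete Fourier transform of a finite block of the field gives
  vectors whose squared norms are non-negative weights on a grid of the torus, and a weak limit of
  these measures has the prescribed coefficients.

  The weights (x^2 + 1)^p enter because (x + i)^k (x - i)^l is a trigonometric monomial times an
  integer power of x^2 + 1 exactly when k + l is even. Neighbouring weights are linked by (x + i) -
  (x - i) = 2i: applied twice, it makes the coefficients for p a second difference of those for p +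
  1. On the circle this second difference is multiplication by |z - 1|^2 / 4, which equals 1 / (x^2
  + 1) and vanishes at the point z = 1 that represents infinity.

  In the algorithm, all vectors found before step q lie in the sum of H_0, ..., H_{q-1}. Hence the
  coefficient of e_q in \<open>h_{w(q)}\<close> influences only the norm of that vector, and its
  square norm d can serve as the unknown instead; the sign condition makes the coefficient the
  unique non-negative root.\<close>

lemma cinner_add_right: "cinner x (y + z) = cinner x y + cinner x z"
  by (metis cinner_add_left cinner_commute complex_cnj_add)

lemma cinner_scaleC_right: "cinner x (c *\<^sub>C y) = cnj c * cinner x y"
  by (metis cinner_commute cinner_scaleC_left complex_cnj_mult)

lemma norm_scaleC: "norm (c *\<^sub>C x) = cmod c * norm (x::'h::complex_hilbert)"
proof -
  have "complex_of_real ((norm (c *\<^sub>C x))\<^sup>2) = c * cnj c * complex_of_real ((norm x)\<^sup>2)"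
    unfolding cinner_self[symmetric] by (simp add: cinner_scaleC_left cinner_scaleC_right)
  also have "\<dots> = complex_of_real ((cmod c * norm x)\<^sup>2)"
    by (simp add: complex_norm_square[symmetric] power_mult_distrib)
  finally have "(norm (c *\<^sub>C x))\<^sup>2 = (cmod c * norm x)\<^sup>2"
    using of_real_eq_iff by blast
  then show ?thesis
    by (meson mult_nonneg_nonneg norm_ge_zero power2_eq_imp_eq)
qed

lemma norm_add_square:
  "(norm (x + y))\<^sup>2 = (norm x)\<^sup>2 + 2 * Re (cinner x y) + (norm (y::'h::complex_hilbert))\<^sup>2"
proof -
  have n: "(norm z)\<^sup>2 = Re (cinner z z)" for z :: 'h
    by (simp add: cinner_self)
  have "Re (cinner y x) = Re (cinner x y)"
    by (metis cinner_commute complex_cnj(1) complex.sel(1) complex_surj)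
  then show ?thesis
    unfolding n by (simp add: cinner_add_left cinner_add_right)
qed

lemma scaleC_minus_one: "(-1) *\<^sub>C x = - (x::'h::complex_hilbert)"
  by (metis complex_vector.scale_minus_left scaleC_one)

lemma cinner_minus_left: "cinner (- x) y = - cinner x y"
  by (metis scaleC_minus_one cinner_scaleC_left mult_minus1)

lemma cinner_minus_right: "cinner x (- y) = - cinner x y"
  by (metis cinner_commute cinner_minus_left complex_cnj_minus)

lemma cinner_diff_left: "cinner (x - y) z = cinner x z - cinner y z"
  using cinner_add_left[of x "- y" z] by (simp add: cinner_minus_left)

lemma cinner_diff_right: "cinner x (y - z) = cinner x y - cinner x z"
  using cinner_add_right[of x y "- z"] by (simp add: cinner_minus_right)

lemma cinner_zero_left [simp]: "cinner 0 y = 0"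
  using cinner_diff_left[of y y y] by simp

lemma cinner_zero_right [simp]: "cinner y 0 = 0"
  using cinner_diff_right[of y y y] by simp

lemma norm_diff_square:
  "(norm (x - y))\<^sup>2 = (norm x)\<^sup>2 - 2 * Re (cinner x y) + (norm (y::'h::complex_hilbert))\<^sup>2"
  using norm_add_square[of x "- y"] by (simp add: cinner_minus_right)

lemma cinner_commute_zero: "cinner x y = 0 \<longleftrightarrow> cinner y x = 0"
  by (metis cinner_commute complex_cnj_zero)

lemma Cauchy_Schwarz_cinner: "cmod (cinner x y) \<le> norm x * norm (y::'h::complex_hilbert)"
proof (cases "y = 0")
  case False
  define c where "c = cinner x y"
  define n where "n = (norm y)\<^sup>2"
  have n: "n > 0" using False by (simp add: n_def)
  have "0 \<le> (norm (x - (c / n) *\<^sub>C y))\<^sup>2" by simp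
  also have "\<dots> = (norm x)\<^sup>2 - 2 * Re (cnj (c / n) * c) + (cmod (c / n))\<^sup>2 * n"
    by (simp only: norm_diff_square cinner_scaleC_right norm_scaleC power_mult_distrib c_def n_def)
  also have "cnj (c / n) * c = of_real ((cmod c)\<^sup>2 / n)"
    using complex_norm_square[of c] by (simp add: mult.commute)
  also have "(cmod (c / n))\<^sup>2 * n = (cmod c)\<^sup>2 / n"
    using n by (simp add: norm_divide power_divide power2_eq_square field_simps)
  finally have "(cmod c)\<^sup>2 / n \<le> (norm x)\<^sup>2" by simp
  then have "(cmod c)\<^sup>2 \<le> (norm x * norm y)\<^sup>2"
    using n by (simp add: n_def field_simps)
  then show ?thesis
    unfolding c_def by (rule power2_le_imp_le) simp
qed simp

lemma bounded_bilinear_cinner: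
  "bounded_bilinear (cinner :: 'h::complex_hilbert \<Rightarrow> 'h \<Rightarrow> complex)"
proof
  show "\<exists>K. \<forall>a b :: 'h. norm (cinner a b) \<le> norm a * norm b * K"
    using Cauchy_Schwarz_cinner by (intro exI[of _ 1]) auto
qed (auto simp: cinner_add_left cinner_add_right scaleR_eq_scaleC cinner_scaleC_left cinner_scaleC_right
       scaleR_conv_of_real)

lemma bounded_bilinear_scaleC:
  "bounded_bilinear (scaleC :: complex \<Rightarrow> 'h \<Rightarrow> 'h::complex_hilbert)"
proof
  show "\<exists>K. \<forall>a (b::'h). norm (a *\<^sub>C b) \<le> norm a * norm b * K"
    using norm_scaleC by (intro exI[of _ 1]) (auto simp: norm_scaleC)
qed (auto simp: scaleC_add_left scaleC_add_right scaleR_eq_scaleC scaleC_scaleC scaleR_conv_of_real mult.commute)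

interpretation cinner: bounded_bilinear "cinner :: 'h::complex_hilbert \<Rightarrow> 'h \<Rightarrow> complex"
  by (rule bounded_bilinear_cinner)

interpretation scaleC: bounded_bilinear "scaleC :: complex \<Rightarrow> 'h \<Rightarrow> 'h::complex_hilbert"
  by (rule bounded_bilinear_scaleC)

lemma cspan_orthogonal:
  assumes "x \<in> cspan S" and "\<And>y. y \<in> S \<Longrightarrow> cinner y z = 0"
  shows "cinner x z = 0"
  using assms(1)
  by (induction rule: complex_vector.span_induct_alt)
     (auto simp: cinner_add_left cinner_scaleC_left assms(2))

lemma closure_cspan_add:
  fixes x y :: "'h::complex_hilbert"
  assumes "x \<in> closure (cspan S)" "y \<in> closure (cspan S)"
  shows "x + y \<in> closure (cspan S)"
proof -
  obtain a b where "\<forall>n. a n \<in> cspan S" "a \<longlonglongrightarrow> x" "\<forall>n. b n \<in> cspan S" "b \<longlonglongrightarrow> y"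
    using assms unfolding closure_sequential by blast
  then show ?thesis
    unfolding closure_sequential
    by (intro exI[of _ "\<lambda>n. a n + b n"]) (auto intro: tendsto_add complex_vector.span_add)
qed

lemma closure_cspan_scale:
  fixes x :: "'h::complex_hilbert"
  assumes "x \<in> closure (cspan S)"
  shows "c *\<^sub>C x \<in> closure (cspan S)"
proof -
  obtain a where "\<forall>n. a n \<in> cspan S" "a \<longlonglongrightarrow> x"
    using assms unfolding closure_sequential by blast
  then show ?thesis
    unfolding closure_sequential
    by (intro exI[of _ "\<lambda>n. c *\<^sub>C a n"]) (auto intro!: scaleC.tendsto complex_vector.span_scale)
qed

text \<open>
  \<open>Gr\<close> is the graph of a linear functional. Minimizing \<open>\<parallel>x\<parallel>\<^sup>2 - 2 Re a\<close> over the graph, as in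
  the proof of the projection theorem, gives the representing vector.
\<close>

lemma riesz_representation_graph:
  fixes Gr :: "('h::complex_hilbert \<times> complex) set"
  assumes zero: "(0, 0) \<in> Gr"
    and add: "\<And>x a y b. (x, a) \<in> Gr \<Longrightarrow> (y, b) \<in> Gr \<Longrightarrow> (x + y, a + b) \<in> Gr"
    and scale: "\<And>c x a. (x, a) \<in> Gr \<Longrightarrow> (c *\<^sub>C x, c * a) \<in> Gr"
    and bound: "\<And>x a. (x, a) \<in> Gr \<Longrightarrow> 0 \<le> (norm x)\<^sup>2 - 2 * Re a + C"
  obtains y where "y \<in> closure (fst ` Gr)" "\<And>x a. (x, a) \<in> Gr \<Longrightarrow> cinner x y = a" "(norm y)\<^sup>2 \<le> C"
proof -
  define J where "J = (\<lambda>(x::'h, a). (norm x)\<^sup>2 - 2 * Re a)"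
  define \<delta> where "\<delta> = (INF p\<in>Gr. J p)"
  have bdd: "bdd_below (J ` Gr)"
    using bound by (intro bdd_belowI2[of _ "- C"]) (force simp: J_def)
  have J_ge: "\<delta> \<le> J p" if "p \<in> Gr" for p
    unfolding \<delta>_def using bdd that by (rule cINF_lower)
  have "\<exists>p\<in>Gr. J p < \<delta> + 1 / real (Suc n)" for n
  proof -
    have "\<delta> < \<delta> + 1 / real (Suc n)" by simp
    then show ?thesis unfolding \<delta>_def using cINF_less_iff[OF _ bdd] zero by blast
  qed
  then obtain p where p: "\<And>n. p n \<in> Gr" "\<And>n. J (p n) < \<delta> + 1 / real (Suc n)"
    by metis
  define x a where "x n = fst (p n)" and "a n = snd (p n)" for n
  have xa: "(x n, a n) \<in> Gr" for n using p by (simp add: x_def a_def)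
  have Jxa: "J (x n, a n) < \<delta> + 1 / real (Suc n)" for n using p by (simp add: x_def a_def)
  \<comment> \<open>The midpoint of two points of the graph lies on the graph, so its value of
    \<open>J\<close> is at least \<delta>. The parallelogram law turns this into a bound for the
    distance.\<close>
  have dist: "(norm (x n - x m))\<^sup>2 \<le> 2 / real (Suc n) + 2 / real (Suc m)" for n m
  proof -
    have "((1/2) *\<^sub>C (x n + x m), (1/2) * (a n + a m)) \<in> Gr"
      using scale add xa by blast
    from J_ge[OF this] have "\<delta> \<le> (norm (x n + x m))\<^sup>2 / 4 - (Re (a n) + Re (a m))"
      by (simp add: J_def norm_scaleC power_divide add_divide_distrib)
    then have "4 * \<delta> \<le> (norm (x n + x m))\<^sup>2 - 4 * Re (a n + a m)"
      by simp
    moreover have "(norm (x n + x m))\<^sup>2 + (norm (x n - x m))\<^sup>2 = 2 * (norm (x n))\<^sup>2 + 2 * (norm (x m))\<^sup>2"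
      by (simp add: norm_add_square norm_diff_square)
    ultimately show ?thesis using Jxa[of n] Jxa[of m] by (simp add: J_def)
  qed
  have "Cauchy x"
  proof (rule CauchyI)
    fix \<epsilon> :: real assume \<epsilon>: "0 < \<epsilon>"
    obtain k where k: "4 / \<epsilon>\<^sup>2 < real k" using reals_Archimedean2 by blast
    have "norm (x n - x m) < \<epsilon>" if "n \<ge> k" "m \<ge> k" for n m
    proof -
      have k0: "real k > 0" using k \<epsilon> by (smt (verit) divide_pos_pos zero_less_power)
      have "(norm (x n - x m))\<^sup>2 \<le> 2 / real k + 2 / real k"
        using dist[of n m] that k0
        by (smt (verit, best) frac_le of_nat_le_iff of_nat_Suc)
      also have "\<dots> < \<epsilon>\<^sup>2" using k k0 \<epsilon> by (simp add: field_simps)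
      finally show ?thesis using \<epsilon> by (simp add: power2_less_imp_less)
    qed
    then show "\<exists>M. \<forall>m\<ge>M. \<forall>n\<ge>M. norm (x m - x n) < \<epsilon>" by blast
  qed
  then obtain y where y: "x \<longlonglongrightarrow> y" using Cauchy_convergent convergent_def by blast
  have lim: "(\<lambda>n. J (x n, a n)) \<longlonglongrightarrow> \<delta>"
  proof (rule tendsto_sandwich)
    show "(\<lambda>_. \<delta>) \<longlonglongrightarrow> \<delta>" by simp
    show "(\<lambda>n. \<delta> + 1 / real (Suc n)) \<longlonglongrightarrow> \<delta>"
      using tendsto_add[OF tendsto_const[of \<delta>] LIMSEQ_Suc[OF lim_1_over_n]] by simp
  qed (use J_ge[OF xa] Jxa in \<open>auto intro!: always_eventually less_imp_le\<close>)
  have rep: "cinner u y = b" if ub: "(u, b) \<in> Gr" for u b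
  proof (rule ccontr)
    assume ne: "cinner u y \<noteq> b"
    define d where "d = cinner u y - b"
    \<comment> \<open>Moving by \<open>c *\<^sub>C u\<close> with c = - t * cnj d changes the limit
      value of \<open>J\<close> by - 2 t |d|^2 + t^2 |d|^2 |u|^2. This is negative as soon as t
      |u|^2 < 2, which contradicts minimality; the summand 1 in the denominator covers u =
      0.\<close>
    define t where "t = 1 / (1 + (norm u)\<^sup>2)"
    define c where "c = - of_real t * cnj d"
    have t: "t > 0" "t * (norm u)\<^sup>2 < 1" by (auto simp: t_def add_pos_nonneg field_simps intro: add_pos_nonneg)
    have "\<delta> \<le> J (x n, a n) + 2 * Re (c * cinner u (x n)) + (cmod c)\<^sup>2 * (norm u)\<^sup>2 - 2 * Re (c * b)" for n
    proof -
      have "Re (cinner (x n) (c *\<^sub>C u)) = Re (c * cinner u (x n))"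
        by (metis cinner_commute cinner_scaleC_left complex_cnj(1) complex.sel(1) complex_surj)
      then show ?thesis
        using J_ge[OF add[OF xa[of n] scale[OF ub, of c]]]
        by (simp add: J_def norm_add_square norm_scaleC power_mult_distrib)
    qed
    moreover have "(\<lambda>n. J (x n, a n) + 2 * Re (c * cinner u (x n)) + (cmod c)\<^sup>2 * (norm u)\<^sup>2 - 2 * Re (c * b))
       \<longlonglongrightarrow> \<delta> + 2 * Re (c * cinner u y) + (cmod c)\<^sup>2 * (norm u)\<^sup>2 - 2 * Re (c * b)"
      by (intro tendsto_intros lim cinner.tendsto y)
    ultimately have "\<delta> \<le> \<delta> + 2 * Re (c * cinner u y) + (cmod c)\<^sup>2 * (norm u)\<^sup>2 - 2 * Re (c * b)"
      by (intro Lim_bounded2[where N = 0]) auto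
    then have "0 \<le> 2 * Re (c * d) + (cmod c)\<^sup>2 * (norm u)\<^sup>2"
      by (simp add: d_def algebra_simps)
    moreover have "c * d = of_real (- t * (cmod d)\<^sup>2)"
      using complex_norm_square[of d] by (simp add: c_def mult.commute)
    moreover have "(cmod c)\<^sup>2 = t\<^sup>2 * (cmod d)\<^sup>2" using t by (simp add: c_def norm_mult power_mult_distrib)
    ultimately have "0 \<le> - (2 * (t * (cmod d)\<^sup>2)) + t * (cmod d)\<^sup>2 * (t * (norm u)\<^sup>2)"
      by (simp add: power2_eq_square algebra_simps)
    also have "\<dots> = (t * (cmod d)\<^sup>2) * (t * (norm u)\<^sup>2 - 2)" by (simp add: algebra_simps)
    also have "\<dots> < 0" using t ne by (intro mult_pos_neg) (auto simp: d_def)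
    finally show False by simp
  qed
  \<comment> \<open>By \<open>rep\<close>, \<open>a n\<close> is the product of \<open>x n\<close>
    with \<open>y\<close>, so the minimum of \<open>J\<close> is - |y|^2. The assumed lower bound -
    C then becomes the norm estimate.\<close>
  have "(\<lambda>n. J (x n, a n)) \<longlonglongrightarrow> - (norm y)\<^sup>2"
  proof -
    have "(\<lambda>n. (norm (x n))\<^sup>2 - 2 * Re (cinner (x n) y)) \<longlonglongrightarrow> (norm y)\<^sup>2 - 2 * Re (cinner y y)"
      by (intro tendsto_intros cinner.tendsto y)
    then show ?thesis by (simp add: J_def rep[OF xa] cinner_self)
  qed
  moreover have "- C \<le> J (x n, a n)" for n using bound[OF xa[of n]] by (simp add: J_def)
  ultimately have "- C \<le> - (norm y)\<^sup>2" by (intro Lim_bounded2[where N = 0]) auto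
  moreover have "y \<in> closure (fst ` Gr)"
    unfolding closure_sequential using y xa by (intro exI[of _ x]) force
  ultimately show ?thesis using rep that by auto
qed

section \<open>Orthonormal expansions\<close>

definition orthonormal_on :: "(nat \<Rightarrow> 'h::complex_hilbert) \<Rightarrow> nat set \<Rightarrow> bool" where
  "orthonormal_on g N \<longleftrightarrow> (\<forall>n\<in>N. \<forall>m\<in>N. cinner (g n) (g m) = (if n = m then 1 else 0))"

lemma orthonormal_onD:
  "orthonormal_on g N \<Longrightarrow> n \<in> N \<Longrightarrow> m \<in> N \<Longrightarrow> cinner (g n) (g m) = (if n = m then 1 else 0)"
  by (simp add: orthonormal_on_def)

lemma orthonormal_on_subset: "orthonormal_on g N \<Longrightarrow> F \<subseteq> N \<Longrightarrow> orthonormal_on g F"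
  unfolding orthonormal_on_def by blast

lemma cinner_sum_orthonormal:
  assumes "orthonormal_on g F" "finite F" "m \<in> F"
  shows "cinner (\<Sum>n\<in>F. \<alpha> n *\<^sub>C g n) (g m) = \<alpha> m"
proof -
  have "cinner (\<Sum>n\<in>F. \<alpha> n *\<^sub>C g n) (g m) = (\<Sum>n\<in>F. if n = m then \<alpha> n else 0)"
    unfolding cinner.sum_left cinner_scaleC_left
    using assms by (intro sum.cong) (auto simp: orthonormal_onD)
  then show ?thesis using assms by simp
qed

lemma norm_sum_orthonormal:
  assumes "orthonormal_on g F" "finite F"
  shows "(norm (\<Sum>n\<in>F. \<alpha> n *\<^sub>C g n))\<^sup>2 = (\<Sum>n\<in>F. (cmod (\<alpha> n))\<^sup>2)"
proof -
  let ?S = "\<Sum>n\<in>F. \<alpha> n *\<^sub>C g n"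
  have "complex_of_real ((norm ?S)\<^sup>2) = (\<Sum>m\<in>F. cnj (\<alpha> m) * cinner ?S (g m))"
    unfolding cinner_self[symmetric] by (subst cinner.sum_right) (simp add: cinner_scaleC_right)
  also have "\<dots> = (\<Sum>m\<in>F. of_real ((cmod (\<alpha> m))\<^sup>2))"
    using assms by (intro sum.cong) (auto simp: cinner_sum_orthonormal mult.commute simp flip: complex_norm_square)
  finally show ?thesis unfolding of_real_sum[symmetric] of_real_eq_iff .
qed

text \<open>The residual is orthogonal to the span, so Pythagoras applies to the triangle with
  vertices \<open>z\<close>, its projection and \<open>x\<close>.\<close>

lemma norm_diff_sum_orthonormal_le:
  fixes z :: "'h::complex_hilbert"
  assumes g: "orthonormal_on g F" "finite F" and x: "x \<in> cspan (g ` F)"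
  shows "norm (z - (\<Sum>n\<in>F. cinner z (g n) *\<^sub>C g n)) \<le> norm (z - x)"
proof -
  let ?S = "\<Sum>n\<in>F. cinner z (g n) *\<^sub>C g n"
  have "?S \<in> cspan (g ` F)"
    by (intro complex_vector.span_sum complex_vector.span_scale complex_vector.span_base) auto
  then have "?S - x \<in> cspan (g ` F)" using x by (rule complex_vector.span_diff)
  moreover have "cinner y (z - ?S) = 0" if "y \<in> g ` F" for y
    using that cinner_sum_orthonormal[OF g] by (auto simp: cinner_commute_zero[of _ "z - ?S"] cinner_diff_left)
  ultimately have "cinner (?S - x) (z - ?S) = 0" by (rule cspan_orthogonal)
  then have "cinner (z - ?S) (?S - x) = 0" by (simp add: cinner_commute_zero[of "z - ?S"])
  then have "(norm (z - x))\<^sup>2 = (norm (z - ?S))\<^sup>2 + (norm (?S - x))\<^sup>2"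
    using norm_add_square[of "z - ?S" "?S - x"] by simp
  then have "(norm (z - ?S))\<^sup>2 \<le> (norm (z - x))\<^sup>2" by simp
  then show ?thesis by (rule power2_le_imp_le) simp
qed

text \<open>An approximant from the span uses finitely many basis vectors. By best approximation,
  the partial sum over any larger finite set is at least as close to \<open>z\<close>, which is
  convergence along the finite subsets of \<open>N\<close>. Parseval's identity is the limit of the
  finite Pythagoras identity.\<close>

lemma orthonormal_expansion:
  fixes z :: "'h::complex_hilbert"
  assumes g: "orthonormal_on g N" and z: "z \<in> closure (cspan (g ` N))"
  shows "((\<lambda>n. cinner z (g n) *\<^sub>C g n) has_sum z) N"
    and "((\<lambda>n. (cmod (cinner z (g n)))\<^sup>2) has_sum (norm z)\<^sup>2) N"
proof -
  show 1: "((\<lambda>n. cinner z (g n) *\<^sub>C g n) has_sum z) N"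
    unfolding has_sum_def tendsto_iff
  proof (intro allI impI)
    fix \<epsilon> :: real assume "\<epsilon> > 0"
    then obtain x where x: "x \<in> cspan (g ` N)" "dist x z < \<epsilon>"
      using z unfolding closure_approachable by blast
    have "\<exists>F. finite F \<and> F \<subseteq> N \<and> x \<in> cspan (g ` F)"
      using x(1)
    proof (induction rule: complex_vector.span_induct_alt)
      case base show ?case by (intro exI[of _ "{}"]) (simp add: complex_vector.span_zero)
    next
      case (step c u y)
      then obtain F n where F: "finite F" "F \<subseteq> N" "y \<in> cspan (g ` F)" "n \<in> N" "u = g n" by auto
      then have "c *\<^sub>C u + y \<in> cspan (g ` insert n F)"
        using complex_vector.span_mono[of "g ` F" "g ` insert n F"]
          complex_vector.span_base[of u "g ` insert n F"]
        by (intro complex_vector.span_add complex_vector.span_scale) auto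
      then show ?case using F by (intro exI[of _ "insert n F"]) auto
    qed
    then obtain F0 where F0: "finite F0" "F0 \<subseteq> N" "x \<in> cspan (g ` F0)" by blast
    have "dist (\<Sum>n\<in>F. cinner z (g n) *\<^sub>C g n) z < \<epsilon>" if "finite F" "F0 \<subseteq> F" "F \<subseteq> N" for F
    proof -
      have "x \<in> cspan (g ` F)" using F0(3) complex_vector.span_mono[of "g ` F0" "g ` F"] that by blast
      then have "norm (z - (\<Sum>n\<in>F. cinner z (g n) *\<^sub>C g n)) \<le> norm (z - x)"
        using norm_diff_sum_orthonormal_le orthonormal_on_subset[OF g] that by blast
      then show ?thesis using x(2) by (simp add: dist_norm norm_minus_commute)
    qed
    then show "\<forall>\<^sub>F F in finite_subsets_at_top N. dist (\<Sum>n\<in>F. cinner z (g n) *\<^sub>C g n) z < \<epsilon>"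
      unfolding eventually_finite_subsets_at_top using F0 by blast
  qed
  have "((\<lambda>F. (norm (\<Sum>n\<in>F. cinner z (g n) *\<^sub>C g n))\<^sup>2) \<longlongrightarrow> (norm z)\<^sup>2) (finite_subsets_at_top N)"
    using 1 unfolding has_sum_def by (intro tendsto_intros)
  moreover have "\<forall>\<^sub>F F in finite_subsets_at_top N.
      (norm (\<Sum>n\<in>F. cinner z (g n) *\<^sub>C g n))\<^sup>2 = (\<Sum>n\<in>F. (cmod (cinner z (g n)))\<^sup>2)"
    by (intro eventually_finite_subsets_at_top_weakI norm_sum_orthonormal orthonormal_on_subset[OF g])
  ultimately show "((\<lambda>n. (cmod (cinner z (g n)))\<^sup>2) has_sum (norm z)\<^sup>2) N"
    unfolding has_sum_def by (rule Lim_transform_eventually)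
qed

text \<open>Riesz-Fischer. The unordered sum has a meaning only once summability is known, so a
  candidate comes first: partial sums along the order of the naturals are Cauchy, their limit has
  the coefficients \<alpha>, and \<open>orthonormal_expansion\<close> for this limit gives the
  unordered sum.\<close>

lemma orthonormal_series:
  fixes g :: "nat \<Rightarrow> 'h::complex_hilbert"
  assumes g: "orthonormal_on g N" and \<alpha>: "(\<lambda>n. (cmod (\<alpha> n))\<^sup>2) summable_on N"
  defines "y \<equiv> (\<Sum>\<^sub>\<infinity>n\<in>N. \<alpha> n *\<^sub>C g n)"
  shows "y \<in> closure (cspan (g ` N))" "\<And>n. n \<in> N \<Longrightarrow> cinner y (g n) = \<alpha> n"
    and "(norm y)\<^sup>2 = (\<Sum>\<^sub>\<infinity>n\<in>N. (cmod (\<alpha> n))\<^sup>2)"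
proof -
  define S where "S k = (\<Sum>n\<in>N \<inter> {..<k}. \<alpha> n *\<^sub>C g n)" for k
  define T where "T k = (\<Sum>n\<in>N \<inter> {..<k}. (cmod (\<alpha> n))\<^sup>2)" for k
  have "incseq T" unfolding T_def by (intro incseq_SucI sum_mono2) auto
  moreover have "T k \<le> (\<Sum>\<^sub>\<infinity>n\<in>N. (cmod (\<alpha> n))\<^sup>2)" for k
    unfolding T_def using \<alpha> by (intro finite_sum_le_infsum) auto
  ultimately obtain L where "T \<longlonglongrightarrow> L" using incseq_convergent by blast
  then have CT: "Cauchy T" using LIMSEQ_imp_Cauchy by blast
  have dist: "(norm (S l - S k))\<^sup>2 = T l - T k" if "k \<le> l" for k l
  proof -
    have "N \<inter> {..<l} = (N \<inter> {..<k}) \<union> (N \<inter> {k..<l})" using that by auto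
    then have "S l - S k = (\<Sum>n\<in>N \<inter> {k..<l}. \<alpha> n *\<^sub>C g n)" "T l - T k = (\<Sum>n\<in>N \<inter> {k..<l}. (cmod (\<alpha> n))\<^sup>2)"
      unfolding S_def T_def by (simp_all add: sum.union_disjoint disjoint_iff)
    then show ?thesis
      using norm_sum_orthonormal[OF orthonormal_on_subset[OF g], of "N \<inter> {k..<l}" \<alpha>] by simp
  qed
  have "Cauchy S"
  proof (rule CauchyI)
    fix \<epsilon> :: real assume \<epsilon>: "\<epsilon> > 0"
    then obtain M where M: "\<And>m n. m \<ge> M \<Longrightarrow> n \<ge> M \<Longrightarrow> norm (T m - T n) < \<epsilon>\<^sup>2"
      using CauchyD[OF CT, of "\<epsilon>\<^sup>2"] by auto
    have *: "norm (S m - S n) < \<epsilon>" if "M \<le> n" "n \<le> m" for m n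
    proof -
      have "(norm (S m - S n))\<^sup>2 < \<epsilon>\<^sup>2" using dist[OF that(2)] M[of m n] that by simp
      then show ?thesis using \<epsilon> by (simp add: power2_less_imp_less)
    qed
    have "norm (S m - S n) < \<epsilon>" if "M \<le> n" "M \<le> m" for m n
      using *[of n m] *[of m n] that by (metis linear norm_minus_commute)
    then show "\<exists>M. \<forall>m\<ge>M. \<forall>n\<ge>M. norm (S m - S n) < \<epsilon>" by blast
  qed
  then obtain x where x: "S \<longlonglongrightarrow> x" using Cauchy_convergent convergent_def by blast
  have "S k \<in> cspan (g ` N)" for k
    unfolding S_def by (intro complex_vector.span_sum complex_vector.span_scale complex_vector.span_base) auto
  then have xc: "x \<in> closure (cspan (g ` N))" unfolding closure_sequential using x by blast
  have xg: "cinner x (g n) = \<alpha> n" if n: "n \<in> N" for n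
  proof (rule LIMSEQ_unique)
    show "(\<lambda>k. cinner (S k) (g n)) \<longlonglongrightarrow> cinner x (g n)" by (intro cinner.tendsto x tendsto_const)
    have "\<forall>k\<ge>Suc n. cinner (S k) (g n) = \<alpha> n"
      unfolding S_def using n cinner_sum_orthonormal[OF orthonormal_on_subset[OF g]] by auto
    then have "\<forall>\<^sub>F k in sequentially. cinner (S k) (g n) = \<alpha> n" unfolding eventually_sequentially by blast
    then show "(\<lambda>k. cinner (S k) (g n)) \<longlonglongrightarrow> \<alpha> n" by (rule tendsto_eventually)
  qed
  have "((\<lambda>n. \<alpha> n *\<^sub>C g n) has_sum x) N" "((\<lambda>n. (cmod (\<alpha> n))\<^sup>2) has_sum (norm x)\<^sup>2) N"
    using orthonormal_expansion[OF g xc] xg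
    by (auto cong: has_sum_cong)
  then have "y = x" "(norm x)\<^sup>2 = (\<Sum>\<^sub>\<infinity>n\<in>N. (cmod (\<alpha> n))\<^sup>2)"
    unfolding y_def by (auto simp: infsumI)
  then show "y \<in> closure (cspan (g ` N))" "\<And>n. n \<in> N \<Longrightarrow> cinner y (g n) = \<alpha> n"
    "(norm y)\<^sup>2 = (\<Sum>\<^sub>\<infinity>n\<in>N. (cmod (\<alpha> n))\<^sup>2)"
    using xc xg by auto
qed

section \<open>Gram-Schmidt orthonormalization\<close>

lemma norm_gram_schmidt: "gram_schmidt x k \<noteq> 0 \<Longrightarrow> norm (gram_schmidt x k) = 1"
  using gram_schmidt.simps[of x k] by (metis norm_sgn sgn_zero)

lemma gram_schmidt_residual:
  "x k - (\<Sum>j<k. cinner (x k) (gram_schmidt x j) *\<^sub>C gram_schmidt x j) =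
    norm (x k - (\<Sum>j<k. cinner (x k) (gram_schmidt x j) *\<^sub>C gram_schmidt x j)) *\<^sub>R gram_schmidt x k"
  (is "?v = norm ?v *\<^sub>R _")
proof -
  have "gram_schmidt x k = sgn ?v" by (rule gram_schmidt.simps)
  then show ?thesis by (simp only: sgn_div_norm scaleR_scaleR) (cases "?v = 0"; simp)
qed

text \<open>The factor is the inverse of the norm, which is 0 for a vanishing residual. Linearity
  arguments thus need no case distinction for dependent vectors.\<close>

lemma gram_schmidt_eq_scale:
  obtains c where "gram_schmidt x k =
    c *\<^sub>C (x k - (\<Sum>j<k. cinner (x k) (gram_schmidt x j) *\<^sub>C gram_schmidt x j))"
  using gram_schmidt.simps[of x k] unfolding sgn_div_norm scaleR_eq_scaleC by blast

lemma gram_schmidt_orthogonal_less: "j < k \<Longrightarrow> cinner (gram_schmidt x k) (gram_schmidt x j) = 0"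
proof (induction k arbitrary: j rule: less_induct)
  case (less k)
  let ?G = "gram_schmidt x"
  \<comment> \<open>Entries may be 0, so the earlier entries form an orthonormal system only up to
    zero vectors.\<close>
  have ortho: "cinner (?G i) (?G j) = (if i = j then if ?G j = 0 then 0 else 1 else 0)" if "i < k" for i
    using that less norm_gram_schmidt[of x j] cinner_commute_zero[of "?G i" "?G j"]
    by (cases i j rule: linorder_cases) (auto simp: cinner_self)
  have "(\<Sum>i<k. cinner (x k) (?G i) * cinner (?G i) (?G j)) = (\<Sum>i<k. if i = j then cinner (x k) (?G j) else 0)"
    by (intro sum.cong) (auto simp: ortho)
  then have zero: "cinner (x k - (\<Sum>i<k. cinner (x k) (?G i) *\<^sub>C ?G i)) (?G j) = 0"
    using less.prems by (simp add: cinner_diff_left cinner.sum_left cinner_scaleC_left)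
  obtain c where c: "?G k = c *\<^sub>C (x k - (\<Sum>i<k. cinner (x k) (?G i) *\<^sub>C ?G i))"
    by (rule gram_schmidt_eq_scale)
  show ?case by (subst c) (simp only: cinner_scaleC_left zero mult_zero_right)
qed

lemma gram_schmidt_orthogonal: "j \<noteq> k \<Longrightarrow> cinner (gram_schmidt x k) (gram_schmidt x j) = 0"
  using gram_schmidt_orthogonal_less[of j k x] gram_schmidt_orthogonal_less[of k j x]
    cinner_commute_zero[of "gram_schmidt x k" "gram_schmidt x j"]
  by (cases j k rule: linorder_cases) simp_all

lemma gram_schmidt_in_span: "gram_schmidt x k \<in> cspan (range x)"
proof (induction k rule: less_induct)
  case (less k)
  obtain c where c: "gram_schmidt x k =
      c *\<^sub>C (x k - (\<Sum>j<k. cinner (x k) (gram_schmidt x j) *\<^sub>C gram_schmidt x j))"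
    by (rule gram_schmidt_eq_scale)
  show ?case
    unfolding c
    by (intro complex_vector.span_diff complex_vector.span_sum complex_vector.span_scale
          complex_vector.span_base less.IH) auto
qed

lemma in_span_gram_schmidt: "x k \<in> cspan (range (gram_schmidt x))"
proof -
  let ?S = "\<Sum>j<k. cinner (x k) (gram_schmidt x j) *\<^sub>C gram_schmidt x j"
  have "x k = ?S + norm (x k - ?S) *\<^sub>R gram_schmidt x k"
    unfolding gram_schmidt_residual[of x k, symmetric] by simp
  also have "\<dots> \<in> cspan (range (gram_schmidt x))"
    unfolding scaleR_eq_scaleC
    by (intro complex_vector.span_add complex_vector.span_sum complex_vector.span_scale complex_vector.span_base) auto
  finally show ?thesis .
qed

lemma bij_betw_enumerate_index:
  fixes A :: "nat set"
  shows "bij_betw (\<lambda>n. enumerate A (n - 1)) {n. 1 \<le> n \<and> (finite A \<longrightarrow> n \<le> card A)} A"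
proof -
  have shift: "bij_betw (\<lambda>n. n - 1) {n. 1 \<le> n \<and> (finite A \<longrightarrow> n \<le> card A)} {n. finite A \<longrightarrow> n < card A}"
    by (rule bij_betw_byWitness[where f' = Suc]) auto
  have "bij_betw (enumerate A) {n. finite A \<longrightarrow> n < card A} A"
    using bij_enumerate[of A] finite_bij_enumerate[of A] by (cases "finite A") (auto simp: lessThan_def)
  from bij_betw_trans[OF shift this] show ?thesis by (simp add: o_def)
qed

lemma gram_schmidt_basis:
  fixes x :: "nat \<Rightarrow> 'h::complex_hilbert"
  shows "orthonormal_on (gram_schmidt_basis x) (gram_schmidt_index x)"
    and "cspan (gram_schmidt_basis x ` gram_schmidt_index x) = cspan (range x)"
proof -
  let ?A = "{k. gram_schmidt x k \<noteq> 0}"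
  let ?en = "\<lambda>n. enumerate ?A (n - 1)"
  have bij: "bij_betw ?en (gram_schmidt_index x) ?A"
    unfolding gram_schmidt_index_def by (rule bij_betw_enumerate_index)
  have basis: "gram_schmidt_basis x = gram_schmidt x \<circ> ?en"
    by (auto simp: gram_schmidt_basis_def)
  show "orthonormal_on (gram_schmidt_basis x) (gram_schmidt_index x)"
    unfolding orthonormal_on_def
  proof (intro ballI)
    fix n m assume nm: "n \<in> gram_schmidt_index x" "m \<in> gram_schmidt_index x"
    then have "?en n \<in> ?A" using bij_betwE[OF bij] by blast
    moreover have "?en n = ?en m \<longleftrightarrow> n = m"
      using inj_on_eq_iff[OF bij_betw_imp_inj_on[OF bij] nm] .
    ultimately have "gram_schmidt x (?en n) \<noteq> 0" "?en n = ?en m \<longleftrightarrow> n = m" by auto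
    then show "cinner (gram_schmidt_basis x n) (gram_schmidt_basis x m) = (if n = m then 1 else 0)"
      using gram_schmidt_orthogonal[of "?en m" "?en n" x] norm_gram_schmidt[of x "?en n"]
      unfolding basis o_def by (cases "n = m") (simp_all add: cinner_self)
  qed
  have img: "gram_schmidt_basis x ` gram_schmidt_index x = gram_schmidt x ` ?A"
    unfolding basis image_comp[symmetric] bij_betw_imp_surj_on[OF bij] ..
  show "cspan (gram_schmidt_basis x ` gram_schmidt_index x) = cspan (range x)"
    unfolding img
  proof (rule subset_antisym; rule complex_vector.span_minimal)
    show "gram_schmidt x ` ?A \<subseteq> cspan (range x)" using gram_schmidt_in_span by blast
    have "range (gram_schmidt x) \<subseteq> cspan (gram_schmidt x ` ?A)"
    proof clarify
      fix k show "gram_schmidt x k \<in> cspan (gram_schmidt x ` ?A)"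
        by (cases "gram_schmidt x k = 0") (auto intro: complex_vector.span_zero complex_vector.span_base)
    qed
    then have "cspan (range (gram_schmidt x)) \<subseteq> cspan (gram_schmidt x ` ?A)"
      by (intro complex_vector.span_minimal complex_vector.subspace_span)
    then show "range x \<subseteq> cspan (gram_schmidt x ` ?A)" using in_span_gram_schmidt by blast
  qed (rule complex_vector.subspace_span)+
qed

section \<open>The trigonometric moment problem in two dimensions\<close>

text \<open>
  Schoenberg's space-filling curve, with a cosine in place of the usual piecewise linear function.
  Lifting measures on the torus along this curve makes Prokhorov's theorem on the real line applicable.
\<close>

definition ramp :: "real \<Rightarrow> real" where
  "ramp t = max 0 (min 1 (1 / 2 - cos (pi * t)))"

definition curve_x :: "real \<Rightarrow> real" where
  "curve_x t = (\<Sum>k. ramp (9 ^ k * t) / 2 ^ Suc k)"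

definition curve_y :: "real \<Rightarrow> real" where
  "curve_y t = curve_x (3 * t)"

lemma ramp_bounds: "0 \<le> ramp t" "ramp t \<le> 1"
  by (auto simp: ramp_def)

lemma ramp_add_even: "ramp (t + 2 * real m) = ramp t"
proof -
  have "cos (pi * (t + 2 * real m)) = cos (pi * t + 2 * pi * real m)" by (simp add: algebra_simps)
  also have "\<dots> = cos (pi * t)" using cos_integer_2pi[of "real m"] sin_integer_2pi[of "real m"] by (simp add: cos_add)
  finally show ?thesis by (simp add: ramp_def)
qed

text \<open>\<open>cos (pi * s)\<close> is at least 1/2 on [0, 1/3] and at most -1/2 on [2/3, 1].
  The clipping in \<open>ramp\<close> thus creates the plateaus 0 and 1 by which the curve reads off
  a binary digit.\<close>

lemma ramp_eq_0: "0 \<le> s \<Longrightarrow> s \<le> 1 / 3 \<Longrightarrow> ramp s = 0"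
  using cos_monotone_0_pi_le[of "pi * s" "pi / 3"] mult_left_mono[of s "1/3" pi] cos_60
  by (simp add: ramp_def)

lemma ramp_eq_1: "2 / 3 \<le> s \<Longrightarrow> s \<le> 1 \<Longrightarrow> ramp s = 1"
  using cos_monotone_0_pi_le[of "2 * pi / 3" "pi * s"] mult_left_mono[of "2/3" s pi] mult_left_mono[of s 1 pi] cos_120
  by (simp add: ramp_def)

lemma continuous_on_ramp: "continuous_on A ramp"
  unfolding ramp_def by (intro continuous_intros)

lemma summable_ramp: "summable (\<lambda>k. ramp (9 ^ k * t) / 2 ^ Suc k)"
proof (rule summable_comparison_test')
  show "summable (\<lambda>k. (1 / 2 :: real) ^ Suc k)" by (subst summable_Suc_iff) (rule summable_geometric; simp)
  show "norm (ramp (9 ^ k * t) / 2 ^ Suc k) \<le> (1 / 2) ^ Suc k" for k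
    using ramp_bounds[of "9 ^ k * t"] by (simp add: power_one_over divide_right_mono)
qed

lemma curve_x_rec: "curve_x t = ramp t / 2 + curve_x (9 * t) / 2"
proof -
  have "(\<Sum>k. ramp (9 ^ Suc k * t) / 2 ^ Suc (Suc k)) = curve_x t - ramp t / 2"
    unfolding curve_x_def by (subst suminf_split_head[OF summable_ramp]) simp
  moreover have "(\<Sum>k. ramp (9 ^ Suc k * t) / 2 ^ Suc (Suc k)) = (\<Sum>k. (ramp (9 ^ k * (9 * t)) / 2 ^ Suc k) / 2)"
    by (simp add: mult_ac)
  moreover have "\<dots> = curve_x (9 * t) / 2"
    unfolding curve_x_def by (rule suminf_divide[OF summable_ramp])
  ultimately show ?thesis by simp
qed

lemma curve_x_add_even: "curve_x (t + 2 * real m) = curve_x t"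
proof -
  have "ramp (9 ^ k * (t + 2 * real m)) = ramp (9 ^ k * t)" for k
    using ramp_add_even[of "9 ^ k * t" "9 ^ k * m"] by (simp add: algebra_simps)
  then show ?thesis by (simp add: curve_x_def)
qed

lemma continuous_on_curve_x: "continuous_on UNIV curve_x"
proof -
  have "uniform_limit UNIV (\<lambda>n t. \<Sum>k<n. ramp (9 ^ k * t) / 2 ^ Suc k) (\<lambda>t. \<Sum>k. ramp (9 ^ k * t) / 2 ^ Suc k) sequentially"
  proof (rule Weierstrass_m_test)
    show "summable (\<lambda>k. (1 / 2 :: real) ^ Suc k)" by (subst summable_Suc_iff) (rule summable_geometric; simp)
    show "norm (ramp (9 ^ k * t) / 2 ^ Suc k) \<le> (1 / 2) ^ Suc k" for k t
      using ramp_bounds[of "9 ^ k * t"] by (simp add: power_one_over divide_right_mono)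
  qed
  moreover have "continuous_on UNIV (\<lambda>t. \<Sum>k<n. ramp (9 ^ k * t) / 2 ^ Suc k)" for n
    by (intro continuous_intros continuous_on_compose2[OF continuous_on_ramp[of UNIV]]) auto
  ultimately show ?thesis
    unfolding curve_x_def[abs_def] by (intro uniform_limit_theorem) auto
qed

lemma continuous_on_curve_y: "continuous_on UNIV curve_y"
  unfolding curve_y_def[abs_def]
  by (intro continuous_intros continuous_on_compose2[OF continuous_on_curve_x]) auto

text \<open>
  Prepending a binary digit \<open>a\<close> to the first and \<open>b\<close> to the second coordinate amounts to
  replacing the parameter \<open>t\<close> by \<open>2a/3 + 2b/9 + t/9\<close>.
\<close>

lemma curve_hits_dyadic:
  "j < 2 ^ p \<Longrightarrow> k < 2 ^ p \<Longrightarrow>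
    \<exists>t\<in>{0..1}. curve_x t = real j / 2 ^ p \<and> curve_y t = real k / 2 ^ p"
proof (induction p arbitrary: j k)
  case 0
  have "curve_x 0 = 0" using curve_x_rec[of 0] ramp_eq_0[of 0] by simp
  then show ?case using 0 by (intro bexI[of _ 0]) (auto simp: curve_y_def)
next
  case (Suc p)
  define a b where "a = j div 2 ^ p" and "b = k div 2 ^ p"
  define j' k' where "j' = j mod 2 ^ p" and "k' = k mod 2 ^ p"
  have ab: "a = 0 \<or> a = 1" "b = 0 \<or> b = 1"
    using Suc.prems by (auto simp: a_def b_def less_mult_imp_div_less less_Suc_eq dest!: less_mult_imp_div_less[of _ 2 "2 ^ p"])
  have jk: "j = a * 2 ^ p + j'" "k = b * 2 ^ p + k'"
    by (simp_all only: a_def b_def j'_def k'_def div_mult_mod_eq)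
  obtain t where t: "t \<in> {0..1}" "curve_x t = real j' / 2 ^ p" "curve_y t = real k' / 2 ^ p"
    using Suc.IH[of j' k'] by (auto simp: j'_def k'_def)
  define u where "u = 2 * real a / 3 + 2 * real b / 9 + t / 9"
  have u: "0 \<le> u" "u \<le> 1" using t(1) ab by (auto simp: u_def)
  \<comment> \<open>As 2b/9 + t/9 is at most 1/3, the parameter lies in [0, 1/3] for a = 0 and in
    [2/3, 1] for a = 1.\<close>
  have "ramp u = a"
    using ab t(1) by (auto simp: u_def intro!: ramp_eq_0 ramp_eq_1)
  moreover have "curve_x (9 * u) = curve_x t"
    using curve_x_add_even[of t "3 * a + b"] by (simp add: u_def algebra_simps)
  ultimately have "curve_x u = real a / 2 + real j' / 2 ^ p / 2"
    using curve_x_rec[of u] t(2) by simp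
  then have x: "curve_x u = real j / 2 ^ Suc p" by (simp add: jk(1) field_simps)
  \<comment> \<open>For the second coordinate the parameter is tripled. The digit \<open>a\<close>
    then contributes the even integer 2a, which the period 2 of \<open>ramp\<close> removes, so
    \<open>b\<close> becomes the leading digit.\<close>
  have "3 * u = (2 * real b / 3 + t / 3) + 2 * real a" by (simp add: u_def)
  then have "ramp (3 * u) = ramp (2 * real b / 3 + t / 3)"
    using ramp_add_even by simp
  also have "\<dots> = b" using ab t(1) by (auto intro!: ramp_eq_0 ramp_eq_1)
  finally have "ramp (3 * u) = b" .
  moreover have "curve_x (9 * (3 * u)) = curve_y t"
    using curve_x_add_even[of "3 * t" "9 * a + 3 * b"] by (simp add: u_def curve_y_def algebra_simps)
  ultimately have "curve_y u = real b / 2 + real k' / 2 ^ p / 2"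
    using curve_x_rec[of "3 * u"] t(3) by (simp add: curve_y_def[of u])
  then have "curve_y u = real k / 2 ^ Suc p" by (simp add: jk(2) field_simps)
  then show ?case using x u by auto
qed

section \<open>Spectral measures of stationary fields on the integer lattice\<close>

definition torus_x :: "real \<Rightarrow> complex" where "torus_x t = cis (2 * pi * curve_x t)"
definition torus_y :: "real \<Rightarrow> complex" where "torus_y t = cis (2 * pi * curve_y t)"

lemma norm_torus [simp]: "norm (torus_x t) = 1" "norm (torus_y t) = 1"
  by (simp_all add: torus_x_def torus_y_def)

lemma continuous_on_torus: "continuous_on UNIV torus_x" "continuous_on UNIV torus_y"
  unfolding torus_x_def[abs_def] torus_y_def[abs_def]
  by (intro continuous_intros continuous_on_curve_x continuous_on_curve_y)+

lemma torus_measurable [measurable]: "torus_x \<in> borel_measurable borel" "torus_y \<in> borel_measurable borel"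
  by (auto intro!: borel_measurable_continuous_onI continuous_on_torus)

lemma continuous_on_torus_powi: "continuous_on UNIV (\<lambda>t. torus_x t powi a * torus_y t powi b)"
proof -
  have "torus_x t \<noteq> 0" "torus_y t \<noteq> 0" for t by (metis norm_torus norm_zero zero_neq_one)+
  then show ?thesis by (intro continuous_intros continuous_on_torus) auto
qed

lemma sum_roots_of_unity:
  assumes "\<bar>d\<bar> < int K"
  shows "(\<Sum>j<K. cis (2 * pi * (real j / K * of_int d))) = (if d = 0 then of_nat K else 0)"
proof (cases "d = 0")
  case False
  define \<omega> where "\<omega> = cis (2 * pi * of_int d / K)"
  have K: "K > 0" using assms by (cases K) auto
  have "\<omega> \<noteq> 1"
  proof
    assume "\<omega> = 1"
    then have "cos (2 * pi * of_int d / K) = 1" by (metis \<omega>_def cis.sel(1) one_complex.sel(1))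
    then obtain n :: int where "2 * pi * of_int d / K = of_int n * 2 * pi" unfolding cos_one_2pi_int by blast
    then have "real_of_int d = of_int n * real K" using K by (simp add: field_simps)
    then have "d = n * int K" by (metis of_int_eq_iff of_int_mult of_int_of_nat_eq)
    then have "int K dvd d" by simp
    then show False using assms False zdvd_not_zless[of "\<bar>d\<bar>" "int K"] by simp
  qed
  moreover have "\<omega> ^ K = 1"
  proof -
    have "\<omega> ^ K = cis (real K * (2 * pi * of_int d / K))" unfolding \<omega>_def by (rule Complex.DeMoivre)
    also have "real K * (2 * pi * of_int d / K) = 2 * pi * of_int d" using K by simp
    finally show ?thesis by simp
  qed
  moreover have "cis (2 * pi * (real j / K * of_int d)) = \<omega> ^ j" for j
    by (simp add: \<omega>_def Complex.DeMoivre mult_ac)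
  ultimately show ?thesis using geometric_sum[of \<omega> K] False by simp
qed simp

text \<open>The number of pairs in a block of length n with difference \<alpha>; these are the
  triangular weights of the Fejer kernel.\<close>

lemma sum_diff_indicator:
  assumes "\<bar>\<alpha>\<bar> < int n"
  shows "(\<Sum>a\<in>{0..<int n}. \<Sum>a'\<in>{0..<int n}. if a - a' = \<alpha> then 1 else 0 :: complex) = of_int (int n - \<bar>\<alpha>\<bar>)"
proof -
  have "(\<Sum>a'\<in>{0..<int n}. if a - a' = \<alpha> then 1 else 0 :: complex) = (if a - \<alpha> \<in> {0..<int n} then 1 else 0)" for a
  proof -
    have "(\<Sum>a'\<in>{0..<int n}. if a - a' = \<alpha> then 1 else 0 :: complex) = (\<Sum>a'\<in>{0..<int n}. if a' = a - \<alpha> then 1 else 0)"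
      by (intro sum.cong) auto
    then show ?thesis by simp
  qed
  then have "(\<Sum>a\<in>{0..<int n}. \<Sum>a'\<in>{0..<int n}. if a - a' = \<alpha> then 1 else 0 :: complex)
      = (\<Sum>a\<in>{0..<int n}. if a - \<alpha> \<in> {0..<int n} then 1 else 0)" by simp
  also have "\<dots> = of_nat (card {a\<in>{0..<int n}. a - \<alpha> \<in> {0..<int n}})"
    by (subst sum.inter_filter[symmetric]) auto
  also have "{a\<in>{0..<int n}. a - \<alpha> \<in> {0..<int n}} = {max 0 \<alpha>..<min (int n) (int n + \<alpha>)}" by auto
  also have "of_nat (card \<dots>) = (of_int (int n - \<bar>\<alpha>\<bar>) :: complex)"
    using assms by (auto simp: min_def max_def)
  finally show ?thesis .
qed

lemma sum_square_indicator:
  fixes x y :: "int \<Rightarrow> int \<Rightarrow> complex"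
  shows "(\<Sum>p\<in>I \<times> I. \<Sum>p'\<in>I \<times> I. x (fst p) (fst p') * y (snd p) (snd p')) =
    (\<Sum>a\<in>I. \<Sum>a'\<in>I. x a a') * (\<Sum>b\<in>I. \<Sum>b'\<in>I. y b b')"
proof -
  have "(\<Sum>p'\<in>I \<times> I. x (fst p) (fst p') * y (snd p) (snd p')) =
    (\<Sum>a'\<in>I. x (fst p) a') * (\<Sum>b'\<in>I. y (snd p) b')" for p
    by (simp add: sum_product sum.cartesian_product case_prod_unfold)
  then have "(\<Sum>p\<in>I \<times> I. \<Sum>p'\<in>I \<times> I. x (fst p) (fst p') * y (snd p) (snd p')) =
    (\<Sum>p\<in>I \<times> I. (\<Sum>a'\<in>I. x (fst p) a') * (\<Sum>b'\<in>I. y (snd p) b'))" by simp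
  also have "\<dots> = (\<Sum>a\<in>I. \<Sum>a'\<in>I. x a a') * (\<Sum>b\<in>I. \<Sum>b'\<in>I. y b b')"
    unfolding sum_product[of "\<lambda>a. \<Sum>a'\<in>I. x a a'"]
    by (simp add: sum.cartesian_product case_prod_unfold)
  finally show ?thesis .
qed

text \<open>The mass at a grid point is the squared norm of the Fourier transform of an n by n block
  of the field, up to normalization, so it is non-negative without further argument. Expanding the
  square gives \<psi> damped by Fejer factors. The grid has a power of two as side length because
  the curve is known to pass through dyadic points.\<close>

lemma discrete_spectral_measure:
  fixes f :: "int \<Rightarrow> int \<Rightarrow> 'h::complex_hilbert" and \<psi> :: "int \<Rightarrow> int \<Rightarrow> complex"
  assumes \<psi>: "\<And>a b a' b'. cinner (f a b) (f a' b') = \<psi> (a - a') (b - b')"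
    and one: "\<psi> 0 0 = 1" and n: "0 < n" "2 * n \<le> 2 ^ q"
  obtains M :: "real measure" where "real_distribution M" "measure M {0..1} = 1"
    "\<And>\<alpha> \<beta>. \<bar>\<alpha>\<bar> < int n \<Longrightarrow> \<bar>\<beta>\<bar> < int n \<Longrightarrow>
      (\<integral>t. torus_x t powi \<alpha> * torus_y t powi \<beta> \<partial>M) =
      of_int (int n - \<bar>\<alpha>\<bar>) * of_int (int n - \<bar>\<beta>\<bar>) / (of_nat n)\<^sup>2 * \<psi> \<alpha> \<beta>"
proof -
  define K :: nat where "K = 2 ^ q"
  have K: "K > 0" by (simp add: K_def)
  define E where "E j a = cis (2 * pi * (real j / K * of_int a))" for j :: nat and a :: int
  have E_mult: "E j \<alpha> * (cnj (E j a) * E j a') = E j (\<alpha> - (a - a'))" for j \<alpha> a a'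
    by (simp add: E_def cis_cnj cis_mult algebra_simps add_divide_distrib)
  define I where "I = {0..<int n}"
  define J where "J = {..<K} \<times> {..<K}"
  define v where "v jk = (\<Sum>p\<in>I \<times> I. cnj (E (fst jk) (fst p) * E (snd jk) (snd p)) *\<^sub>C f (fst p) (snd p))" for jk
  \<comment> \<open>Summation over the grid contributes the factor K^2 by orthogonality of
    characters, and the block contributes n^2 pairs on the diagonal; dividing by both makes the
    total mass \<open>\<psi> 0 0\<close>, that is, 1.\<close>
  define wt where "wt jk = (norm (v jk))\<^sup>2 / (real K * real n)\<^sup>2" for jk
  have wt_nonneg: "wt jk \<ge> 0" for jk by (simp add: wt_def)
  have norm_v: "of_real ((norm (v jk))\<^sup>2) =
      (\<Sum>p\<in>I \<times> I. \<Sum>p'\<in>I \<times> I. cnj (E (fst jk) (fst p) * E (snd jk) (snd p)) *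
        (E (fst jk) (fst p') * E (snd jk) (snd p')) * \<psi> (fst p - fst p') (snd p - snd p'))" for jk
    unfolding cinner_self[symmetric] v_def cinner.sum_left cinner.sum_right
    by (subst sum.swap) (simp add: cinner_scaleC_left cinner_scaleC_right \<psi> mult_ac)
  have coeff: "(\<Sum>jk\<in>J. of_real (wt jk) * (E (fst jk) \<alpha> * E (snd jk) \<beta>)) =
      of_int (int n - \<bar>\<alpha>\<bar>) * of_int (int n - \<bar>\<beta>\<bar>) / (of_nat n)\<^sup>2 * \<psi> \<alpha> \<beta>"
    if ab: "\<bar>\<alpha>\<bar> < int n" "\<bar>\<beta>\<bar> < int n" for \<alpha> \<beta>
  proof -
    have inner: "(\<Sum>jk\<in>J. E (fst jk) (\<alpha> - (a - a')) * E (snd jk) (\<beta> - (b - b'))) =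
        (if a - a' = \<alpha> then of_nat K else 0) * (if b - b' = \<beta> then of_nat K else 0)"
      if "a \<in> I" "a' \<in> I" "b \<in> I" "b' \<in> I" for a a' b b'
    proof -
      \<comment> \<open>No aliasing: |\<alpha>| and |a - a'| are both below n, so the frequency is
        smaller than the grid size in modulus and is a multiple of it only if it is 0.\<close>
      have "int (2 * n) \<le> int K" unfolding K_def using n(2) by (simp only: of_nat_le_iff)
      then have "\<bar>\<alpha> - (a - a')\<bar> < int K" "\<bar>\<beta> - (b - b')\<bar> < int K" using ab that by (auto simp: I_def)
      then have "(\<Sum>j<K. E j (\<alpha> - (a - a'))) * (\<Sum>j<K. E j (\<beta> - (b - b'))) =
        (if a - a' = \<alpha> then of_nat K else 0) * (if b - b' = \<beta> then of_nat K else 0)"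
        unfolding E_def by (subst (1 2) sum_roots_of_unity) auto
      then show ?thesis
        by (simp add: J_def sum_product sum.cartesian_product case_prod_unfold)
    qed
    have "(\<Sum>jk\<in>J. of_real ((norm (v jk))\<^sup>2) * (E (fst jk) \<alpha> * E (snd jk) \<beta>)) =
        (\<Sum>jk\<in>J. \<Sum>p\<in>I \<times> I. \<Sum>p'\<in>I \<times> I.
          \<psi> (fst p - fst p') (snd p - snd p') *
          (E (fst jk) (\<alpha> - (fst p - fst p')) * E (snd jk) (\<beta> - (snd p - snd p'))))"
      unfolding norm_v sum_distrib_right by (simp add: mult_ac flip: E_mult)
    also have "\<dots> = (\<Sum>p\<in>I \<times> I. \<Sum>p'\<in>I \<times> I. \<Sum>jk\<in>J.
          \<psi> (fst p - fst p') (snd p - snd p') *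
          (E (fst jk) (\<alpha> - (fst p - fst p')) * E (snd jk) (\<beta> - (snd p - snd p'))))"
      by (subst sum.swap, rule sum.cong[OF refl], rule sum.swap)
    also have "\<dots> = (\<Sum>p\<in>I \<times> I. \<Sum>p'\<in>I \<times> I. (of_nat K)\<^sup>2 * \<psi> \<alpha> \<beta> *
          ((if fst p - fst p' = \<alpha> then 1 else 0) * (if snd p - snd p' = \<beta> then 1 else 0)))"
    proof (intro sum.cong refl)
      fix p p' assume "p \<in> I \<times> I" "p' \<in> I \<times> I"
      then have "fst p \<in> I" "fst p' \<in> I" "snd p \<in> I" "snd p' \<in> I" by auto
      from inner[OF this]
      show "(\<Sum>jk\<in>J. \<psi> (fst p - fst p') (snd p - snd p') *
          (E (fst jk) (\<alpha> - (fst p - fst p')) * E (snd jk) (\<beta> - (snd p - snd p')))) =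
        (of_nat K)\<^sup>2 * \<psi> \<alpha> \<beta> *
          ((if fst p - fst p' = \<alpha> then 1 else 0) * (if snd p - snd p' = \<beta> then 1 else 0))"
        unfolding sum_distrib_left[symmetric] by (simp add: power2_eq_square)
    qed
    also have "\<dots> = (of_nat K)\<^sup>2 * \<psi> \<alpha> \<beta> * (of_int (int n - \<bar>\<alpha>\<bar>) * of_int (int n - \<bar>\<beta>\<bar>))"
      unfolding sum_distrib_left[symmetric]
      by (subst sum_square_indicator) (simp only: I_def sum_diff_indicator ab)
    finally have *: "(\<Sum>jk\<in>J. of_real ((norm (v jk))\<^sup>2) * (E (fst jk) \<alpha> * E (snd jk) \<beta>)) = \<dots>" .
    have "(\<Sum>jk\<in>J. of_real (wt jk) * (E (fst jk) \<alpha> * E (snd jk) \<beta>)) =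
      (\<Sum>jk\<in>J. of_real ((norm (v jk))\<^sup>2) * (E (fst jk) \<alpha> * E (snd jk) \<beta>)) / (of_nat K * of_nat n)\<^sup>2"
      unfolding sum_divide_distrib by (simp add: wt_def)
    also have "\<dots> = (of_nat K)\<^sup>2 * (of_int (int n - \<bar>\<alpha>\<bar>) * of_int (int n - \<bar>\<beta>\<bar>) * \<psi> \<alpha> \<beta>) / ((of_nat K)\<^sup>2 * (of_nat n)\<^sup>2)"
      unfolding * power_mult_distrib by (simp only: mult_ac)
    also have "\<dots> = (of_int (int n - \<bar>\<alpha>\<bar>) * of_int (int n - \<bar>\<beta>\<bar>) * \<psi> \<alpha> \<beta>) / (of_nat n)\<^sup>2"
      using K by (intro mult_divide_mult_cancel_left) simp
    finally show ?thesis by simp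
  qed
  have sum_wt: "sum wt J = 1"
  proof -
    have "E j 0 = 1" for j by (simp add: E_def)
    then have "complex_of_real (sum wt J) = 1" using coeff[of 0 0] n one by (simp add: power2_eq_square)
    then show ?thesis by (metis of_real_eq_1_iff)
  qed
  have "\<exists>t\<in>{0..1}. curve_x t = real (fst jk) / K \<and> curve_y t = real (snd jk) / K" if "jk \<in> J" for jk
    using that curve_hits_dyadic[of "fst jk" q "snd jk"] by (auto simp: J_def K_def)
  then obtain \<tau> where \<tau>: "\<And>jk. jk \<in> J \<Longrightarrow> \<tau> jk \<in> {0..1} \<and> curve_x (\<tau> jk) = real (fst jk) / K \<and> curve_y (\<tau> jk) = real (snd jk) / K"
    by metis
  have torus: "torus_x (\<tau> jk) powi \<alpha> * torus_y (\<tau> jk) powi \<beta> = E (fst jk) \<alpha> * E (snd jk) \<beta>"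
    if "jk \<in> J" for jk \<alpha> \<beta>
    using \<tau>[OF that] by (simp add: torus_x_def torus_y_def E_def cis_power_int mult_ac)
  define P where "P = point_measure J (\<lambda>jk. ennreal (wt jk))"
  define M where "M = distr P borel \<tau>"
  have fin: "finite J" by (simp add: J_def)
  have meas: "\<tau> \<in> measurable P borel" by (simp add: P_def)
  have spP: "space P = J" by (simp add: P_def space_point_measure)
  have "emeasure P (space P) = 1"
    unfolding spP unfolding P_def using fin sum_wt wt_nonneg by (simp add: emeasure_point_measure_finite sum_ennreal)
  then interpret P: prob_space P by (rule prob_spaceI)
  interpret M: prob_space M unfolding M_def using meas by (rule P.prob_space_distr)
  show thesis
  proof
    show "real_distribution M"
      by unfold_locales (simp_all add: M_def)
    have "measure M {0..1} = measure P (\<tau> -` {0..1} \<inter> space P)"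
      unfolding M_def using meas by (simp add: measure_distr)
    also have "\<tau> -` {0..1} \<inter> space P = space P" using \<tau> spP by auto
    finally show "measure M {0..1} = 1" by (simp add: P.prob_space)
    show "(\<integral>t. torus_x t powi \<alpha> * torus_y t powi \<beta> \<partial>M) =
      of_int (int n - \<bar>\<alpha>\<bar>) * of_int (int n - \<bar>\<beta>\<bar>) / (of_nat n)\<^sup>2 * \<psi> \<alpha> \<beta>"
      if ab: "\<bar>\<alpha>\<bar> < int n" "\<bar>\<beta>\<bar> < int n" for \<alpha> \<beta>
    proof -
      have "(\<integral>t. torus_x t powi \<alpha> * torus_y t powi \<beta> \<partial>M) =
        (\<integral>jk. torus_x (\<tau> jk) powi \<alpha> * torus_y (\<tau> jk) powi \<beta> \<partial>P)"
        unfolding M_def using meas borel_measurable_continuous_onI[OF continuous_on_torus_powi]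
        by (rule integral_distr)
      also have "\<dots> = (\<Sum>jk\<in>J. of_real (wt jk) * (E (fst jk) \<alpha> * E (snd jk) \<beta>))"
        unfolding P_def using fin wt_nonneg
        by (subst lebesgue_integral_point_measure_finite) (auto simp: torus scaleR_conv_of_real)
      finally show ?thesis using coeff[OF ab] by simp
    qed
  qed
qed

text \<open>Herglotz' theorem in two variables. The discrete measures all live on [0, 1] after
  lifting, hence are tight, and the Fejer factors tend to 1 as the blocks grow. If the field
  vanishes at the origin, \<psi> is zero, since each of its values is a product with that
  vector.\<close>

lemma stationary_spectral_measure:
  fixes f :: "int \<Rightarrow> int \<Rightarrow> 'h::complex_hilbert" and \<psi> :: "int \<Rightarrow> int \<Rightarrow> complex"
  assumes \<psi>: "\<And>a b a' b'. cinner (f a b) (f a' b') = \<psi> (a - a') (b - b')"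
  obtains M :: "real measure" where "finite_measure M" "sets M = sets borel"
    "\<And>a b. (\<integral>t. torus_x t powi a * torus_y t powi b \<partial>M) = \<psi> a b"
proof (cases "f 0 0 = 0")
  case True
  have "\<psi> a b = 0" for a b using \<psi>[of a b 0 0] True by simp
  then show ?thesis
    by (intro that[of "null_measure borel"]) (auto intro!: finite_measureI)
next
  case False
  define c where "c = (norm (f 0 0))\<^sup>2"
  have c: "c > 0" using False by (simp add: c_def)
  have \<psi>00: "\<psi> 0 0 = of_real c" using \<psi>[of 0 0 0 0] by (simp add: c_def cinner_self)
  \<comment> \<open>The discrete measures are probability measures, so the field is normalized here;
    the factor \<open>c\<close> returns as a constant density at the end.\<close>
  define f' where "f' a b = complex_of_real (1 / sqrt c) *\<^sub>C f a b" for a b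
  define \<psi>' where "\<psi>' a b = \<psi> a b / of_real c" for a b
  have \<psi>': "cinner (f' a b) (f' a' b') = \<psi>' (a - a') (b - b')" for a b a' b'
    using c by (simp add: f'_def \<psi>'_def cinner_scaleC_left cinner_scaleC_right \<psi> flip: of_real_mult)
  have one: "\<psi>' 0 0 = 1" using \<psi>00 c by (simp add: \<psi>'_def)
  define \<rho> where "\<rho> q \<alpha> = complex_of_int (int (2 ^ q) - \<bar>\<alpha>\<bar>) / of_nat (2 ^ q)" for q \<alpha>
  have "\<exists>M. real_distribution M \<and> measure M {0..1} = 1 \<and> (\<forall>\<alpha> \<beta>. \<bar>\<alpha>\<bar> < int (2 ^ q) \<longrightarrow> \<bar>\<beta>\<bar> < int (2 ^ q) \<longrightarrow>
      (\<integral>t. torus_x t powi \<alpha> * torus_y t powi \<beta> \<partial>M) = \<rho> q \<alpha> * \<rho> q \<beta> * \<psi>' \<alpha> \<beta>)" for q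
  proof -
    obtain M :: "real measure" where "real_distribution M" "measure M {0..1} = 1"
      "\<And>\<alpha> \<beta>. \<bar>\<alpha>\<bar> < int (2 ^ q) \<Longrightarrow> \<bar>\<beta>\<bar> < int (2 ^ q) \<Longrightarrow>
      (\<integral>t. torus_x t powi \<alpha> * torus_y t powi \<beta> \<partial>M) =
      of_int (int (2 ^ q) - \<bar>\<alpha>\<bar>) * of_int (int (2 ^ q) - \<bar>\<beta>\<bar>) / (of_nat (2 ^ q))\<^sup>2 * \<psi>' \<alpha> \<beta>"
      using discrete_spectral_measure[where f = f' and \<psi> = \<psi>', OF \<psi>' one, of "2 ^ q" "Suc q"] by auto
    then show ?thesis by (intro exI[of _ M]) (simp add: \<rho>_def power2_eq_square)
  qed
  then obtain \<mu> where \<mu>: "\<And>q. real_distribution (\<mu> q)" "\<And>q. measure (\<mu> q) {0..1} = 1"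
    "\<And>q \<alpha> \<beta>. \<bar>\<alpha>\<bar> < int (2 ^ q) \<Longrightarrow> \<bar>\<beta>\<bar> < int (2 ^ q) \<Longrightarrow>
      (\<integral>t. torus_x t powi \<alpha> * torus_y t powi \<beta> \<partial>\<mu> q) = \<rho> q \<alpha> * \<rho> q \<beta> * \<psi>' \<alpha> \<beta>"
    by metis
  have "tight \<mu>"
    unfolding tight_def
  proof (intro conjI allI impI)
    fix \<epsilon> :: real assume \<epsilon>: "\<epsilon> > 0"
    have "measure (\<mu> q) {-1<..1} > 1 - \<epsilon>" for q
    proof -
      interpret real_distribution "\<mu> q" by (rule \<mu>)
      have "measure (\<mu> q) {0..1} \<le> measure (\<mu> q) {-1<..1}" by (intro finite_measure_mono) auto
      then show ?thesis using \<mu>(2)[of q] \<epsilon> by simp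
    qed
    then show "\<exists>a b::real. a < b \<and> (\<forall>n. measure (\<mu> n) {a<..b} > 1 - \<epsilon>)"
      by (intro exI[of _ "-1"] exI[of _ 1]) auto
  qed (rule \<mu>)
  then obtain r M where r: "strict_mono r" and M: "real_distribution M" and weak: "weak_conv_m (\<mu> \<circ> id \<circ> r) M"
    using tight_imp_convergent_subsubsequence[OF _ strict_mono_id] by blast
  interpret M: real_distribution M by (rule M)
  have int_M: "(\<integral>t. torus_x t powi \<alpha> * torus_y t powi \<beta> \<partial>M) = \<psi>' \<alpha> \<beta>" for \<alpha> \<beta>
  proof (rule LIMSEQ_unique)
    have cont: "isCont (\<lambda>t. torus_x t powi \<alpha> * torus_y t powi \<beta>) t" for t
      using continuous_on_torus_powi[of \<alpha> \<beta>] by (simp add: continuous_on_eq_continuous_at)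
    show "(\<lambda>q. \<integral>t. torus_x t powi \<alpha> * torus_y t powi \<beta> \<partial>\<mu> (r q)) \<longlonglongrightarrow>
        (\<integral>t. torus_x t powi \<alpha> * torus_y t powi \<beta> \<partial>M)"
      using weak_conv_imp_integral_bdd_continuous_conv[OF _ M weak cont, of 1] \<mu>(1)
      by (simp add: norm_mult norm_power_int)
    have \<rho>: "(\<lambda>q. \<rho> q \<alpha>) \<longlonglongrightarrow> 1" for \<alpha>
    proof -
      have "(\<lambda>q. 1 - of_int \<bar>\<alpha>\<bar> * (1 / 2) ^ q :: complex) \<longlonglongrightarrow> 1 - of_int \<bar>\<alpha>\<bar> * 0"
        by (intro tendsto_intros LIMSEQ_power_zero) (simp add: norm_divide)
      then show ?thesis by (simp add: \<rho>_def diff_divide_distrib power_one_over)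
    qed
    have "(\<lambda>q. \<rho> (r q) \<alpha> * \<rho> (r q) \<beta> * \<psi>' \<alpha> \<beta>) \<longlonglongrightarrow> 1 * 1 * \<psi>' \<alpha> \<beta>"
      using LIMSEQ_subseq_LIMSEQ[OF \<rho> r] by (intro tendsto_intros) (simp_all add: o_def)
    moreover have "\<forall>\<^sub>F q in sequentially. \<rho> (r q) \<alpha> * \<rho> (r q) \<beta> * \<psi>' \<alpha> \<beta> =
        (\<integral>t. torus_x t powi \<alpha> * torus_y t powi \<beta> \<partial>\<mu> (r q))"
      unfolding eventually_sequentially
    proof (intro exI allI impI)
      fix q assume q: "nat (\<bar>\<alpha>\<bar> + \<bar>\<beta>\<bar>) \<le> q"
      have "q \<le> r q" using r by (rule strict_mono_imp_increasing)
      also have "r q < 2 ^ r q" by (rule less_exp)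
      finally have "int q < int (2 ^ r q)" by (simp only: of_nat_less_iff)
      then have "\<bar>\<alpha>\<bar> < int (2 ^ r q)" "\<bar>\<beta>\<bar> < int (2 ^ r q)" using q by linarith+
      then show "\<rho> (r q) \<alpha> * \<rho> (r q) \<beta> * \<psi>' \<alpha> \<beta> = (\<integral>t. torus_x t powi \<alpha> * torus_y t powi \<beta> \<partial>\<mu> (r q))"
        using \<mu>(3) by simp
    qed
    ultimately show "(\<lambda>q. \<integral>t. torus_x t powi \<alpha> * torus_y t powi \<beta> \<partial>\<mu> (r q)) \<longlonglongrightarrow> \<psi>' \<alpha> \<beta>"
      using Lim_transform_eventually by fastforce
  qed
  show ?thesis
  proof
    show "finite_measure (density M (\<lambda>_. ennreal c))"
      by (rule finite_measureI) (use M.emeasure_space_1 in \<open>simp add: emeasure_density_const\<close>)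
    show "(\<integral>t. torus_x t powi a * torus_y t powi b \<partial>density M (\<lambda>_. ennreal c)) = \<psi> a b" for a b
    proof -
      have [measurable]: "(\<lambda>t. torus_x t powi a * torus_y t powi b) \<in> borel_measurable M"
        using borel_measurable_continuous_onI[OF continuous_on_torus_powi] M.events_eq_borel
        by (simp cong: measurable_cong_sets)
      have "(\<integral>t. torus_x t powi a * torus_y t powi b \<partial>density M (\<lambda>_. ennreal c)) =
        (\<integral>t. c *\<^sub>R (torus_x t powi a * torus_y t powi b) \<partial>M)"
        using c by (intro integral_density) auto
      also have "\<dots> = \<psi> a b" using c by (simp add: int_M \<psi>'_def scaleR_conv_of_real)
      finally show ?thesis .
    qed
  qed simp
qed

section \<open>Measures determined by trigonometric moments\<close>

lemma measure_eqI_continuous: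
  fixes M N :: "'a::metric_space measure"
  assumes "finite_measure M" "finite_measure N" and sets: "sets M = sets borel" "sets N = sets borel"
    and eq: "\<And>f :: 'a \<Rightarrow> real. continuous_on UNIV f \<Longrightarrow> (\<And>x. 0 \<le> f x) \<Longrightarrow> (\<And>x. f x \<le> 1) \<Longrightarrow>
      (\<integral>x. f x \<partial>M) = (\<integral>x. f x \<partial>N)"
  shows "M = N"
proof -
  interpret M: finite_measure M by fact
  interpret N: finite_measure N by fact
  have sp: "space M = UNIV" "space N = UNIV" using sets_eq_imp_space_eq[OF sets(1)] sets_eq_imp_space_eq[OF sets(2)] by simp_all
  have meas: "measure M C = measure N C" if C: "closed C" "C \<noteq> {}" for C
  proof -
    \<comment> \<open>Continuous functions that decrease to the indicator of \<open>C\<close>,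
      because a point at distance 0 from a closed set belongs to it. Equality on closed sets
      suffices, as these are stable under intersection and generate the Borel sets.\<close>
    define f where "f n x = max 0 (1 - real n * infdist x C)" for n x
    have cont: "continuous_on UNIV (f n)" for n unfolding f_def by (intro continuous_intros)
    have f01: "0 \<le> f n x" "f n x \<le> 1" for n x by (auto simp: f_def infdist_nonneg)
    have lim: "(\<lambda>n. f n x) \<longlonglongrightarrow> indicator C x" for x
    proof (cases "x \<in> C")
      case False
      then have pos: "infdist x C > 0" using C by (simp add: infdist_pos_not_in_closed)
      obtain n0 where "1 / infdist x C < real n0" using reals_Archimedean2 by blast
      then have "f n x = 0" if "n \<ge> n0" for n
      proof -
        have "1 < real n0 * infdist x C" using \<open>1 / infdist x C < real n0\<close> pos by (simp add: field_simps)
        also have "\<dots> \<le> real n * infdist x C" using that by (intro mult_right_mono infdist_nonneg) auto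
        finally show ?thesis by (simp add: f_def)
      qed
      then have "\<forall>\<^sub>F n in sequentially. f n x = 0" unfolding eventually_sequentially by blast
      then show ?thesis using False by (auto intro: tendsto_eventually)
    qed (simp add: f_def)
    have "(\<lambda>n. \<integral>x. f n x \<partial>Q) \<longlonglongrightarrow> (\<integral>x. indicator C x \<partial>Q)"
      if "finite_measure Q" "sets Q = sets borel" for Q :: "'a measure"
    proof (rule integral_dominated_convergence[where w = "\<lambda>_. 1"])
      interpret finite_measure Q by fact
      show "integrable Q (\<lambda>_. 1 :: real)" by simp
      show "(\<lambda>x. indicator C x :: real) \<in> borel_measurable Q"
        unfolding measurable_cong_sets[OF that(2) refl] using C by (simp add: borel_closed)
      show "f n \<in> borel_measurable Q" for n
        unfolding measurable_cong_sets[OF that(2) refl] by (rule borel_measurable_continuous_onI[OF cont])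
    qed (use lim f01 in \<open>auto simp: abs_of_nonneg\<close>)
    note lims = this[OF assms(1) sets(1)] this[OF assms(2) sets(2)]
    have "(\<integral>x. f n x \<partial>M) = (\<integral>x. f n x \<partial>N)" for n by (rule eq[OF cont f01])
    with lims have "(\<integral>x. indicator C x \<partial>M) = (\<integral>x. indicator C x \<partial>N :: real)"
      by (intro LIMSEQ_unique[OF lims(1)]) simp
    then show ?thesis using C sets sp by simp
  qed
  show ?thesis
  proof (rule measure_eqI_generator_eq[where \<Omega> = UNIV and E = "Collect closed" and A = "\<lambda>_. UNIV"])
    show "Int_stable (Collect closed :: 'a set set)" by (auto simp: Int_stable_def)
    show "sets M = sigma_sets UNIV (Collect closed)" "sets N = sigma_sets UNIV (Collect closed)"
      unfolding sets borel_eq_closed by simp_all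
    show "emeasure M X = emeasure N X" if "X \<in> Collect closed" for X
      using meas[of X] that by (cases "X = {}") (simp_all add: M.emeasure_eq_measure N.emeasure_eq_measure)
  qed auto
qed

text \<open>The domain is left general for two uses: the plane with the Cayley transform, and the
  line with the space-filling curve. In the second case the map into the torus is not injective, so
  only images of measures can be compared.\<close>

locale torus_functions =
  fixes Z W :: "'a \<Rightarrow> complex" and M N :: "'a measure"
  assumes finite_M: "finite_measure M" and finite_N: "finite_measure N" and sets_eq: "sets N = sets M"
    and ZW_measurable: "Z \<in> borel_measurable M" "W \<in> borel_measurable M"
    and norm_ZW: "\<And>x. norm (Z x) = 1" "\<And>x. norm (W x) = 1"
    and coeffs_eq: "\<And>a b. (\<integral>x. Z x powi a * W x powi b \<partial>M) = (\<integral>x. Z x powi a * W x powi b \<partial>N)"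
begin

sublocale M: finite_measure M by (rule finite_M)
sublocale N: finite_measure N by (rule finite_N)

declare ZW_measurable [measurable]

lemma measurable_N: "borel_measurable N = (borel_measurable M :: ('a \<Rightarrow> 'b::topological_space) set)"
  by (rule measurable_cong_sets[OF sets_eq refl])

lemma ZW_nonzero [simp]: "Z x \<noteq> 0" "W x \<noteq> 0"
  using norm_ZW(1)[of x] norm_ZW(2)[of x] by auto

lemma powi_measurable [measurable]:
  "(\<lambda>x. Z x powi a) \<in> borel_measurable M" "(\<lambda>x. W x powi a) \<in> borel_measurable M"
  unfolding power_int_def by measurable

text \<open>Closed under multiplication by \<open>Z\<^sup>\<plusminus>\<^sup>1\<close> and \<open>W\<^sup>\<plusminus>\<^sup>1\<close>, hence by polynomials in their real and imaginary parts.\<close>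

definition test_functions :: "('a \<Rightarrow> complex) set" where
  "test_functions = {u. u \<in> borel_measurable M \<and> (\<exists>B. \<forall>x. norm (u x) \<le> B) \<and>
    (\<forall>a b. (\<integral>x. u x * (Z x powi a * W x powi b) \<partial>M) = (\<integral>x. u x * (Z x powi a * W x powi b) \<partial>N))}"

lemma test_eq:
  "u \<in> test_functions \<Longrightarrow>
    (\<integral>x. u x * (Z x powi a * W x powi b) \<partial>M) = (\<integral>x. u x * (Z x powi a * W x powi b) \<partial>N)"
  by (simp add: test_functions_def)

lemma integrable_test:
  assumes "u \<in> test_functions"
  shows "integrable M (\<lambda>x. u x * (Z x powi a * W x powi b))" "integrable N (\<lambda>x. u x * (Z x powi a * W x powi b))"
proof -
  obtain B where B: "\<And>x. norm (u x) \<le> B" and u[measurable]: "u \<in> borel_measurable M"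
    using assms by (auto simp: test_functions_def)
  have meas: "(\<lambda>x. u x * (Z x powi a * W x powi b)) \<in> borel_measurable M" by measurable
  show "integrable M (\<lambda>x. u x * (Z x powi a * W x powi b))" "integrable N (\<lambda>x. u x * (Z x powi a * W x powi b))"
    using B meas by (auto intro!: M.integrable_const_bound[where B = B] N.integrable_const_bound[where B = B]
      simp: norm_mult norm_power_int norm_ZW measurable_N)
qed

lemma test_add: "u \<in> test_functions \<Longrightarrow> v \<in> test_functions \<Longrightarrow> (\<lambda>x. u x + v x) \<in> test_functions"
proof -
  assume u: "u \<in> test_functions" and v: "v \<in> test_functions"
  then obtain B C where "\<forall>x. norm (u x) \<le> B" "\<forall>x. norm (v x) \<le> C" by (auto simp: test_functions_def)
  then have "\<forall>x. norm (u x + v x) \<le> B + C" by (meson norm_triangle_mono)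
  then show ?thesis
    using u v integrable_test[OF u] integrable_test[OF v]
    by (auto simp: test_functions_def distrib_right)
qed

lemma test_scale: "u \<in> test_functions \<Longrightarrow> (\<lambda>x. c * u x) \<in> test_functions"
proof -
  assume u: "u \<in> test_functions"
  then obtain B where "\<forall>x. norm (u x) \<le> B" by (auto simp: test_functions_def)
  then have "\<forall>x. norm (c * u x) \<le> norm c * B" by (simp add: norm_mult mult_left_mono)
  then show ?thesis using u by (auto simp: test_functions_def mult.assoc)
qed

lemma test_powi: "u \<in> test_functions \<Longrightarrow> (\<lambda>x. Z x powi c * W x powi d * u x) \<in> test_functions"
proof -
  assume u: "u \<in> test_functions"
  then have "\<exists>B. \<forall>x. norm (Z x powi c * W x powi d * u x) \<le> B"
    by (auto simp: test_functions_def norm_mult norm_power_int norm_ZW)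
  moreover have eq: "Z x powi c * W x powi d * u x * (Z x powi a * W x powi b) = u x * (Z x powi (c + a) * W x powi (d + b))" for x a b
    by (simp add: power_int_add)
  moreover have "(\<lambda>x. Z x powi c * W x powi d * u x) \<in> borel_measurable M"
    using u by (intro borel_measurable_times powi_measurable) (simp add: test_functions_def)
  ultimately show ?thesis using u unfolding test_functions_def mem_Collect_eq eq by simp
qed

text \<open>The test function \<open>u\<close> stays arbitrary in the induction. A product f * g is
  handled by applying the claim for f to the test function g * u, so test functions need not be
  closed under products.\<close>

lemma test_polynomial:
  fixes p :: "complex \<times> complex \<Rightarrow> real"
  assumes "real_polynomial_function p" "u \<in> test_functions"
  shows "(\<lambda>x. of_real (p (Z x, W x)) * u x) \<in> test_functions"
  using assms
proof (induction arbitrary: u rule: real_polynomial_function.induct)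
  case (linear f)
  interpret bounded_linear f by fact
  define c where "c z = complex_of_real (f (z, 0))" for z
  define d where "d z = complex_of_real (f (0, z))" for z
  \<comment> \<open>On the circle the inverse of \<open>Z x\<close> is its conjugate, so the real
    and imaginary parts of \<open>Z x\<close> are combinations of \<open>Z x\<close> and its
    inverse; the same holds for \<open>W x\<close>. The coefficients are the values of the
    functional on 1 and i in each component.\<close>
  have f: "complex_of_real (f (Z x, W x)) =
      ((c 1 - \<i> * c \<i>) / 2) * Z x powi 1 + ((c 1 + \<i> * c \<i>) / 2) * Z x powi (-1) +
      ((d 1 - \<i> * d \<i>) / 2) * W x powi 1 + ((d 1 + \<i> * d \<i>) / 2) * W x powi (-1)" for x
  proof -
    have inv: "inverse (Z x) = cnj (Z x)" "inverse (W x) = cnj (W x)"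
      using complex_norm_square[of "Z x"] complex_norm_square[of "W x"] norm_ZW[of x]
      by (auto intro!: inverse_unique)
    have "(Z x, W x) = Re (Z x) *\<^sub>R (1, 0) + Im (Z x) *\<^sub>R (\<i>, 0) + Re (W x) *\<^sub>R (0, 1) + Im (W x) *\<^sub>R (0, \<i>)"
      by (auto simp: complex_eq_iff)
    then have "f (Z x, W x) = f (Re (Z x) *\<^sub>R (1, 0) + Im (Z x) *\<^sub>R (\<i>, 0) + Re (W x) *\<^sub>R (0, 1) + Im (W x) *\<^sub>R (0, \<i>))"
      by (rule arg_cong)
    also have "\<dots> = Re (Z x) * f (1, 0) + Im (Z x) * f (\<i>, 0) + Re (W x) * f (0, 1) + Im (W x) * f (0, \<i>)"
      by (simp only: add scaleR real_scaleR_def)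
    finally show ?thesis
      by (simp add: c_def d_def inv power_int_minus) (simp add: complex_eq_iff field_simps)
  qed
  have Zu: "(\<lambda>x. Z x powi c * u x) \<in> test_functions" for c using test_powi[OF linear.prems, of c 0] by simp
  have Wu: "(\<lambda>x. W x powi c * u x) \<in> test_functions" for c using test_powi[OF linear.prems, of 0 c] by simp
  show ?case
    unfolding f distrib_right mult.assoc by (intro test_add test_scale Zu Wu)
next
  case (const c)
  then show ?case using test_scale[of u "of_real c"] by simp
next
  case (add f g)
  then show ?case using test_add[OF add.IH] by (simp add: distrib_right)
next
  case (mult f g)
  then show ?case using mult.IH(1)[OF mult.IH(2)] by (simp add: mult.assoc)
qed

text \<open>Real polynomials in the four real coordinates of the torus have equal integrals, and by
  Stone-Weierstrass they approximate continuous functions uniformly on this compact set, which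
  carries both images.\<close>

lemma torus_distr_eq: "distr M borel (\<lambda>x. (Z x, W x)) = distr N borel (\<lambda>x. (Z x, W x))"
proof -
  let ?ZW = "\<lambda>x. (Z x, W x)"
  have meas[measurable]: "?ZW \<in> measurable M borel" "?ZW \<in> measurable N borel"
    by (auto simp: measurable_N)
  have one: "(\<lambda>_. 1) \<in> test_functions" using coeffs_eq by (auto simp: test_functions_def)
  have poly: "(\<integral>x. p (?ZW x) \<partial>M) = (\<integral>x. p (?ZW x) \<partial>N)" if "real_polynomial_function p" for p
  proof -
    have "(\<integral>x. complex_of_real (p (?ZW x)) \<partial>M) = (\<integral>x. complex_of_real (p (?ZW x)) \<partial>N)"
      using test_eq[OF test_polynomial[OF that one], of 0 0] by simp
    then show ?thesis by simp
  qed
  let ?T = "sphere 0 1 \<times> sphere 0 1 :: (complex \<times> complex) set"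
  have T: "?ZW x \<in> ?T" for x by (simp add: norm_ZW)
  have compT: "compact ?T" by (rule compact_Times[OF compact_sphere compact_sphere])
  show ?thesis
  proof (rule measure_eqI_continuous)
    show "finite_measure (distr M borel ?ZW)" "finite_measure (distr N borel ?ZW)"
      by (rule M.finite_measure_distr[OF meas(1)], rule N.finite_measure_distr[OF meas(2)])
    fix f :: "complex \<times> complex \<Rightarrow> real"
    assume f: "continuous_on UNIV f" "\<And>x. 0 \<le> f x" "\<And>x. f x \<le> 1"
    have fmeas[measurable]: "f \<in> borel_measurable borel" using f(1) by (rule borel_measurable_continuous_onI)
    define K where "K = measure M (space M) + measure N (space N)"
    have int_bound: "integrable M (\<lambda>x. v (?ZW x))" "integrable N (\<lambda>x. v (?ZW x))"
      if "continuous_on UNIV v" for v :: "complex \<times> complex \<Rightarrow> real"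
    proof -
      have "compact (v ` ?T)"
        by (rule compact_continuous_image[OF continuous_on_subset[OF that subset_UNIV] compT])
      then have "bounded (v ` ?T)" by (rule compact_imp_bounded)
      then obtain B where "\<forall>y\<in>v ` ?T. norm y \<le> B" unfolding bounded_iff by blast
      then have B: "norm (v (?ZW x)) \<le> B" for x using T[of x] by blast
      have [measurable]: "v \<in> borel_measurable borel" using that by (rule borel_measurable_continuous_onI)
      show "integrable M (\<lambda>x. v (?ZW x))" "integrable N (\<lambda>x. v (?ZW x))"
        using B by (auto intro!: M.integrable_const_bound[where B = B] N.integrable_const_bound[where B = B])
    qed
    have "\<bar>(\<integral>x. f (?ZW x) \<partial>M) - (\<integral>x. f (?ZW x) \<partial>N)\<bar> \<le> \<epsilon>" if "\<epsilon> > 0" for \<epsilon>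
    proof -
      \<comment> \<open>The error is at most \<delta> times the total mass of both measures; the
        added 1 avoids division by zero when both vanish.\<close>
      define \<delta> where "\<delta> = \<epsilon> / (K + 1)"
      have K: "K \<ge> 0" by (simp add: K_def)
      then have \<delta>: "\<delta> > 0" "\<delta> * K \<le> \<epsilon>" using that by (auto simp: \<delta>_def field_simps)
      obtain g where g: "polynomial_function g" "\<And>y. y \<in> ?T \<Longrightarrow> norm (f y - g y) < \<delta>"
        using Stone_Weierstrass_polynomial_function[OF compT continuous_on_subset[OF f(1) subset_UNIV] \<delta>(1)] by blast
      then have g1: "real_polynomial_function g" by (simp add: real_polynomial_function_eq)
      have contg: "continuous_on UNIV g"
        using g1 by (simp add: continuous_on_polymonial_function g(1))
      have close: "\<bar>(\<integral>x. f (?ZW x) \<partial>Q) - (\<integral>x. g (?ZW x) \<partial>Q)\<bar> \<le> \<delta> * measure Q (space Q)"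
        if "finite_measure Q" "integrable Q (\<lambda>x. f (?ZW x))" "integrable Q (\<lambda>x. g (?ZW x))" for Q
      proof -
        interpret finite_measure Q by fact
        have "\<bar>(\<integral>x. f (?ZW x) \<partial>Q) - (\<integral>x. g (?ZW x) \<partial>Q)\<bar> = \<bar>\<integral>x. f (?ZW x) - g (?ZW x) \<partial>Q\<bar>"
          using that by simp
        also have "\<dots> \<le> (\<integral>x. \<bar>f (?ZW x) - g (?ZW x)\<bar> \<partial>Q)" by (rule integral_abs_bound)
        also have "\<dots> \<le> (\<integral>x. \<delta> \<partial>Q)"
          using that g(2)[OF T] by (intro integral_mono) (auto intro: less_imp_le)
        finally show ?thesis by (simp add: mult.commute)
      qed
      have "\<bar>(\<integral>x. f (?ZW x) \<partial>M) - (\<integral>x. f (?ZW x) \<partial>N)\<bar> \<le> \<delta> * measure M (space M) + \<delta> * measure N (space N)"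
        using close[OF finite_M int_bound(1)[OF f(1)] int_bound(1)[OF contg]]
          close[OF finite_N int_bound(2)[OF f(1)] int_bound(2)[OF contg]] poly[OF g1] by linarith
      also have "\<dots> = \<delta> * K" by (simp only: K_def distrib_left)
      finally show ?thesis using \<delta>(2) by simp
    qed
    then have "\<bar>(\<integral>x. f (?ZW x) \<partial>M) - (\<integral>x. f (?ZW x) \<partial>N)\<bar> \<le> 0"
      by (rule field_le_epsilon) simp
    then have "(\<integral>x. f (?ZW x) \<partial>M) = (\<integral>x. f (?ZW x) \<partial>N)" by simp
    then show "(\<integral>x. f x \<partial>distr M borel ?ZW) = (\<integral>x. f x \<partial>distr N borel ?ZW)"
      by (simp add: integral_distr)
  qed simp_all
qed

end

section \<open>The extended moment problem\<close>

definition cayley :: "real \<Rightarrow> complex" where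
  "cayley x = (of_real x + \<i>) / (of_real x - \<i>)"

text \<open>On the circle without the point 1 the quotient is already real. At 1, division by zero
  yields the value 0, and \<open>cayley 0\<close> is -1: there the two maps are not inverse to each
  other, which is why mass at 1 has to be excluded.\<close>

definition inv_cayley :: "complex \<Rightarrow> real" where
  "inv_cayley z = Re (\<i> * (z + 1) / (z - 1))"

lemma of_real_plus_minus_i [simp]:
  "complex_of_real x + \<i> \<noteq> 0" "complex_of_real x - \<i> \<noteq> 0" "complex_of_real x \<noteq> \<i>"
  by (auto simp: complex_eq_iff)

lemma of_real_plus_times_minus: "(complex_of_real x + \<i>) * (complex_of_real x - \<i>) = of_real (x\<^sup>2 + 1)"
  by (simp add: algebra_simps power2_eq_square)

lemma norm_cayley [simp]: "norm (cayley x) = 1"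
proof -
  have "norm (complex_of_real x + \<i>) = norm (complex_of_real x - \<i>)" by (simp add: cmod_def)
  then show ?thesis by (simp add: cayley_def norm_divide)
qed

lemma cayley_minus_1: "cayley x - 1 = 2 * \<i> / (of_real x - \<i>)"
  by (simp add: cayley_def divide_simps)

lemma inv_cayley_cayley: "inv_cayley (cayley x) = x"
proof -
  have "cayley x + 1 = 2 * of_real x / (of_real x - \<i>)" by (simp add: cayley_def divide_simps)
  then have "\<i> * (cayley x + 1) / (cayley x - 1) = of_real x"
    unfolding cayley_minus_1 by (simp add: field_simps)
  then show ?thesis by (simp add: inv_cayley_def)
qed

lemma cayley_inv_cayley:
  assumes "norm z = 1" "z \<noteq> 1"
  shows "cayley (inv_cayley z) = z"
proof -
  define y where "y = \<i> * (z + 1) / (z - 1)"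
  have z: "z \<noteq> 0" "z - 1 \<noteq> 0" using assms by auto
  have "cnj z = inverse z" using assms(1) complex_norm_square[of z] by (auto intro!: inverse_unique[symmetric])
  then have "cnj y = y" using z by (simp add: y_def divide_simps) (simp add: algebra_simps)
  then have "y = of_real (inv_cayley z)" unfolding inv_cayley_def y_def[symmetric] by (simp add: complex_eq_iff)
  moreover have "y + \<i> = 2 * \<i> * z / (z - 1)" "y - \<i> = 2 * \<i> / (z - 1)"
    using z by (simp_all add: y_def divide_simps) (simp_all add: algebra_simps)
  ultimately show ?thesis using z by (simp add: cayley_def)
qed

lemma cmod_minus_1_square:
  assumes "norm z = 1"
  shows "complex_of_real ((cmod (z - 1))\<^sup>2) = 2 - z - z powi (-1)"
proof -
  have "cnj z = inverse z" "z * cnj z = 1" using assms complex_norm_square[of z] by (auto intro!: inverse_unique[symmetric])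
  then show ?thesis unfolding complex_norm_square by (simp add: algebra_simps power_int_minus)
qed

text \<open>The key conversion: a trigonometric polynomial on the torus becomes the weight 1 / (x^2
  + 1) on the line, so multiplying by it lowers the exponent of x^2 + 1 by one.\<close>

lemma cmod_cayley_minus_1: "(cmod (cayley x - 1))\<^sup>2 / 4 = 1 / (x\<^sup>2 + 1)"
proof -
  have "(cmod (of_real x - \<i>))\<^sup>2 = x\<^sup>2 + 1" by (simp add: cmod_power2)
  then have "(cmod (cayley x - 1))\<^sup>2 = 4 * (1 / (x\<^sup>2 + 1))"
    unfolding cayley_minus_1 by (simp add: norm_divide power_divide norm_mult)
  then show ?thesis by (simp only: nonzero_mult_div_cancel_left[of 4] zero_neq_numeral)
qed

lemma cayley_measurable [measurable]: "cayley \<in> borel_measurable borel"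
  unfolding cayley_def[abs_def] by measurable

lemma inv_cayley_measurable [measurable]: "inv_cayley \<in> borel_measurable borel"
  unfolding inv_cayley_def[abs_def] by measurable

lemma powi_borel_measurable [measurable]:
  fixes f :: "'a \<Rightarrow> 'b::{real_normed_field, second_countable_topology}"
  assumes [measurable]: "f \<in> borel_measurable M"
  shows "(\<lambda>x. f x powi a) \<in> borel_measurable M"
  unfolding power_int_def by measurable

lemma borel_measurable_fst_snd [measurable]:
  "fst \<in> measurable (borel :: ('a::topological_space \<times> 'b::topological_space) measure) borel"
  "snd \<in> measurable (borel :: ('a::topological_space \<times> 'b::topological_space) measure) borel"
  by (intro borel_measurable_continuous_onI continuous_intros)+

text \<open>\<open>inv_cayley\<close> is a Borel left inverse of \<open>cayley\<close>, so a measure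
  on the plane is recovered from its image on the torus, where trigonometric moments determine
  it.\<close>

lemma plane_measure_eqI:
  fixes M N :: "(real \<times> real) measure"
  assumes fin: "finite_measure M" "finite_measure N" and sets: "sets M = sets borel" "sets N = sets borel"
    and eq: "\<And>a b. (\<integral>x. cayley (fst x) powi a * cayley (snd x) powi b \<partial>M) =
      (\<integral>x. cayley (fst x) powi a * cayley (snd x) powi b \<partial>N)"
  shows "M = N"
proof -
  let ?C = "\<lambda>x. (cayley (fst x), cayley (snd x))"
  let ?I = "\<lambda>z. (inv_cayley (fst z), inv_cayley (snd z))"
  have m: "?C \<in> measurable borel borel" "?I \<in> measurable borel borel"
    by measurable
  interpret torus_functions "cayley \<circ> fst" "cayley \<circ> snd" M N
  proof (rule torus_functions.intro)
    show "cayley \<circ> fst \<in> borel_measurable M" "cayley \<circ> snd \<in> borel_measurable M"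
      unfolding measurable_cong_sets[OF sets(1) refl] by (intro measurable_comp[where N = borel] borel_measurable_fst_snd cayley_measurable)+
  qed (simp_all add: fin sets eq)
  have "P = distr (distr P borel ?C) borel ?I" if "sets P = sets borel" for P :: "(real \<times> real) measure"
  proof -
    have "?C \<in> measurable P borel" unfolding measurable_cong_sets[OF that refl] by (rule m)
    then have "distr (distr P borel ?C) borel ?I = distr P borel (?I \<circ> ?C)"
      by (rule distr_distr[OF m(2)])
    also have "?I \<circ> ?C = (\<lambda>x. x)" by (simp add: fun_eq_iff inv_cayley_cayley)
    also have "distr P borel (\<lambda>x. x) = P" by (rule distr_id2[OF that[symmetric]])
    finally show ?thesis by (rule sym)
  qed
  from this[OF sets(1)] this[OF sets(2)] show ?thesis
    using torus_distr_eq by (simp add: o_def)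
qed

text \<open>As \<open>g\<close> is positive, a step with density 1 / g can be undone with density g,
  and the induction runs over the integers in both directions from 0.\<close>

lemma density_powi:
  fixes M :: "int \<Rightarrow> 'a measure" and g :: "'a \<Rightarrow> real"
  assumes g: "g \<in> borel_measurable (M 0)" "\<And>x. g x > 0"
    and sets: "\<And>p. sets (M p) = sets (M 0)"
    and step: "\<And>p. M p = density (M (p + 1)) (\<lambda>x. ennreal (1 / g x))"
  shows "M p = density (M 0) (\<lambda>x. ennreal (g x powi p))"
proof -
  have [measurable]: "g \<in> borel_measurable (M p)" for p
    unfolding measurable_cong_sets[OF sets[of p] refl] by (rule g(1))
  have step': "M (p + 1) = density (M p) (\<lambda>x. ennreal (g x))" for p
  proof -
    have "density (M p) (\<lambda>x. ennreal (g x)) = density (M (p + 1)) (\<lambda>x. ennreal (1 / g x) * ennreal (g x))"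
      by (subst step) (simp add: density_density_eq)
    also have "(\<lambda>x. ennreal (1 / g x) * ennreal (g x)) = (\<lambda>_. 1)"
      using g(2) by (simp add: ennreal_mult[symmetric] less_imp_le order_less_imp_not_eq2)
    finally show ?thesis by (simp add: density_1)
  qed
  show ?thesis
  proof (induction p rule: int_induct[where k = 0])
    case base
    show ?case by (simp add: density_1)
  next
    case (step1 i)
    have "M (i + 1) = density (density (M 0) (\<lambda>x. ennreal (g x powi i))) (\<lambda>x. ennreal (g x))"
      unfolding step1.IH[symmetric] by (rule step')
    also have "\<dots> = density (M 0) (\<lambda>x. ennreal (g x powi (i + 1)))"
      using g(2) by (simp add: density_density_eq ennreal_mult[symmetric] less_imp_le power_int_add order_less_imp_not_eq2)
    finally show ?case .
  next
    case (step2 i)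
    have "M (i - 1) = density (density (M 0) (\<lambda>x. ennreal (g x powi i))) (\<lambda>x. ennreal (1 / g x))"
      unfolding step2.IH[symmetric] using step[of "i - 1"] by simp
    also have "\<dots> = density (M 0) (\<lambda>x. ennreal (g x powi (i - 1)))"
      using g(2) by (simp add: density_density_eq ennreal_mult[symmetric] less_imp_le power_int_diff order_less_imp_not_eq2)
    finally show ?case .
  qed
qed

section \<open>Monomials of the extended problem\<close>

fun ext_monomial :: "idx \<Rightarrow> real \<times> real \<Rightarrow> complex" where
  "ext_monomial (m, k, l, n, r, t) (x1, x2) =
     complex_of_real x1 ^ m * (complex_of_real x1 + \<i>) powi k * (complex_of_real x1 - \<i>) powi l *
     complex_of_real x2 ^ n * (complex_of_real x2 + \<i>) powi r * (complex_of_real x2 - \<i>) powi t"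

lemma extended_moment_solution_iff:
  "extended_moment_solution \<phi> \<mu> \<longleftrightarrow> sets \<mu> = sets borel \<and> (\<forall>I. has_bochner_integral \<mu> (ext_monomial I) (\<phi> I))"
proof -
  have "ext_monomial (m, k, l, n, r, t) = (\<lambda>(x1, x2).
     complex_of_real x1 ^ m * (complex_of_real x1 + \<i>) powi k * (complex_of_real x1 - \<i>) powi l *
     complex_of_real x2 ^ n * (complex_of_real x2 + \<i>) powi r * (complex_of_real x2 - \<i>) powi t)" for m k l n r t
    by auto
  then show ?thesis unfolding extended_moment_solution_def by simp
qed

lemma ext_monomial_shift:
  "ext_monomial (m + 1, k, l, n, r, t) x = of_real (fst x) * ext_monomial (m, k, l, n, r, t) x"
  "ext_monomial (m, k + 1, l, n, r, t) x = (of_real (fst x) + \<i>) * ext_monomial (m, k, l, n, r, t) x"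
  "ext_monomial (m, k, l + 1, n, r, t) x = (of_real (fst x) - \<i>) * ext_monomial (m, k, l, n, r, t) x"
  "ext_monomial (m, k, l, n + 1, r, t) x = of_real (snd x) * ext_monomial (m, k, l, n, r, t) x"
  "ext_monomial (m, k, l, n, r + 1, t) x = (of_real (snd x) + \<i>) * ext_monomial (m, k, l, n, r, t) x"
  "ext_monomial (m, k, l, n, r, t + 1) x = (of_real (snd x) - \<i>) * ext_monomial (m, k, l, n, r, t) x"
  by (cases x; simp add: power_int_add mult_ac)+

lemma ext_monomial_relations:
  "ext_monomial (m + 1, k, l, n, r, t) x + \<i> * ext_monomial (m, k, l, n, r, t) x = ext_monomial (m, k + 1, l, n, r, t) x"
  "ext_monomial (m + 1, k, l, n, r, t) x - \<i> * ext_monomial (m, k, l, n, r, t) x = ext_monomial (m, k, l + 1, n, r, t) x"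
  "ext_monomial (m, k, l, n + 1, r, t) x + \<i> * ext_monomial (m, k, l, n, r, t) x = ext_monomial (m, k, l, n, r + 1, t) x"
  "ext_monomial (m, k, l, n + 1, r, t) x - \<i> * ext_monomial (m, k, l, n, r, t) x = ext_monomial (m, k, l, n, r, t + 1) x"
  by (simp_all only: ext_monomial_shift distrib_right left_diff_distrib)

text \<open>These are the indices with both exponent sums even, namely 2p and 2q. For them the
  monomial splits into a real weight and a trigonometric monomial in the Cayley coordinates.\<close>

lemma ext_monomial_cayley:
  "ext_monomial (0, a + p, p - a, 0, b + q, q - b) x =
    (((fst x)\<^sup>2 + 1) powi p * ((snd x)\<^sup>2 + 1) powi q) *\<^sub>R (cayley (fst x) powi a * cayley (snd x) powi b)"
proof -
  have *: "(complex_of_real y + \<i>) powi (c + s) * (complex_of_real y - \<i>) powi (s - c) =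
    of_real ((y\<^sup>2 + 1) powi s) * cayley y powi c" for y c s
  proof -
    have "of_real ((y\<^sup>2 + 1) powi s) = (complex_of_real y + \<i>) powi s * (complex_of_real y - \<i>) powi s"
      by (metis of_real_power_int of_real_plus_times_minus power_int_mult_distrib)
    then show ?thesis
      by (simp add: cayley_def power_int_add power_int_diff power_int_divide_distrib)
  qed
  show ?thesis
    using *[of "fst x" a p] *[of "snd x" b q]
    by (cases x) (simp add: scaleR_conv_of_real mult_ac)
qed

lemma ext_monomial_zero: "ext_monomial (0, 0, 0, 0, 0, 0) x = 1"
  by (cases x) simp

lemma extended_solution_finite:
  assumes "extended_moment_solution \<phi> \<mu>"
  shows "finite_measure \<mu>"
proof -
  have "has_bochner_integral \<mu> (\<lambda>_. 1 :: complex) (\<phi> (0, 0, 0, 0, 0, 0))"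
    using assms unfolding extended_moment_solution_iff by (metis (no_types, lifting) ext_monomial_zero has_bochner_integral_cong)
  then have "integrable \<mu> (\<lambda>_. 1 :: complex)" by (auto simp: has_bochner_integral_iff)
  then have "(\<integral>\<^sup>+x. 1 \<partial>\<mu>) < \<infinity>" by (simp add: integrable_iff_bounded)
  then show ?thesis by (intro finite_measureI) simp
qed

text \<open>The indices with k + l = r + t = 0 and m = n = 0 carry the weight 1, and their moments
  are the trigonometric moments of the measure itself.\<close>

lemma extended_solution_unique:
  assumes "extended_moment_solution \<phi> \<mu>" "extended_moment_solution \<phi> \<nu>"
  shows "\<mu> = \<nu>"
proof (rule plane_measure_eqI)
  have "(\<integral>x. cayley (fst x) powi a * cayley (snd x) powi b \<partial>\<rho>) = \<phi> (0, a, - a, 0, b, - b)"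
    if "extended_moment_solution \<phi> \<rho>" for \<rho> a b
  proof -
    have "(\<integral>x. ext_monomial (0, a, - a, 0, b, - b) x \<partial>\<rho>) = \<phi> (0, a, - a, 0, b, - b)"
      using that by (simp add: extended_moment_solution_iff has_bochner_integral_iff)
    then show ?thesis using ext_monomial_cayley[of a 0 b 0] by simp
  qed
  then show "(\<integral>x. cayley (fst x) powi a * cayley (snd x) powi b \<partial>\<mu>) =
      (\<integral>x. cayley (fst x) powi a * cayley (snd x) powi b \<partial>\<nu>)" for a b using assms by simp
qed (use assms in \<open>auto simp: extended_solution_finite extended_moment_solution_iff\<close>)


text \<open>On the circle |Z - 1|^2 = 2 - Z - 1/Z, so this density acts on the Fourier coefficients
  as a second difference in the first index. Division by 4 keeps the density at most 1.\<close>

lemma density_cmod_minus_1: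
  fixes Z W :: "'a \<Rightarrow> complex"
  assumes fin: "finite_measure M"
    and ZW [measurable]: "Z \<in> borel_measurable M" "W \<in> borel_measurable M"
    and norm: "\<And>x. norm (Z x) = 1" "\<And>x. norm (W x) = 1"
  shows "finite_measure (density M (\<lambda>x. ennreal ((cmod (Z x - 1))\<^sup>2 / 4)))" (is "finite_measure ?D")
    and "(\<integral>x. Z x powi a * W x powi b \<partial>density M (\<lambda>x. ennreal ((cmod (Z x - 1))\<^sup>2 / 4))) =
      (2 * (\<integral>x. Z x powi a * W x powi b \<partial>M) - (\<integral>x. Z x powi (a + 1) * W x powi b \<partial>M)
        - (\<integral>x. Z x powi (a - 1) * W x powi b \<partial>M)) / 4"
proof -
  interpret finite_measure M by fact
  let ?w = "\<lambda>x. (cmod (Z x - 1))\<^sup>2 / 4"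
  have w_meas: "?w \<in> borel_measurable M" by measurable
  have nz: "Z x \<noteq> 0" "W x \<noteq> 0" for x using norm by (metis norm_zero zero_neq_one)+
  define C where "C a b x = Z x powi a * W x powi b" for a b x
  have C_meas: "C a b \<in> borel_measurable M" for a b unfolding C_def by measurable
  have C_int: "integrable M (C a b)" for a b
    by (rule integrable_const_bound[where B = 1]) (use C_meas in \<open>auto simp: C_def norm_mult norm_power_int norm\<close>)
  have w_C: "?w x *\<^sub>R C a b x = (2 * C a b x - C (a + 1) b x - C (a - 1) b x) / 4" for a b x
  proof -
    have "complex_of_real (?w x) = (2 - Z x - Z x powi (-1)) / 4"
      using cmod_minus_1_square[OF norm(1)] by simp
    moreover have "C (a + 1) b x = Z x * C a b x" "C (a - 1) b x = Z x powi (-1) * C a b x"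
      using nz by (simp_all add: C_def power_int_add power_int_diff power_int_minus divide_inverse mult_ac)
    ultimately show ?thesis
      by (simp add: scaleR_conv_of_real left_diff_distrib mult.assoc)
  qed
  have "?w x \<le> 1" for x
  proof -
    have "cmod (Z x - 1) \<le> 2" using norm_triangle_ineq4[of "Z x" 1] norm(1)[of x] by simp
    then have "(cmod (Z x - 1))\<^sup>2 \<le> 2\<^sup>2" by (intro power_mono) auto
    then show ?thesis by simp
  qed
  then have "(\<integral>\<^sup>+x. ennreal (?w x) \<partial>M) \<le> (\<integral>\<^sup>+x. 1 \<partial>M)" by (intro nn_integral_mono) simp
  also have "\<dots> < \<infinity>" using emeasure_finite[of "space M"] by (simp add: less_top[symmetric])
  finally have "emeasure ?D (space ?D) \<noteq> \<infinity>"
    using w_meas by (simp add: emeasure_density cong: nn_integral_cong)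
  then show "finite_measure ?D" by (rule finite_measureI)
  have "(\<integral>x. C a b x \<partial>?D) = (\<integral>x. ?w x *\<^sub>R C a b x \<partial>M)"
    using w_meas C_meas by (intro integral_density) auto
  also have "\<dots> = (2 * (\<integral>x. C a b x \<partial>M) - (\<integral>x. C (a + 1) b x \<partial>M) - (\<integral>x. C (a - 1) b x \<partial>M)) / 4"
    unfolding w_C using C_int by simp
  finally show "(\<integral>x. Z x powi a * W x powi b \<partial>?D) =
      (2 * (\<integral>x. Z x powi a * W x powi b \<partial>M) - (\<integral>x. Z x powi (a + 1) * W x powi b \<partial>M)
        - (\<integral>x. Z x powi (a - 1) * W x powi b \<partial>M)) / 4"
    by (simp only: C_def)
qed

text \<open>
  The point \<open>1\<close> of the circle corresponds to infinity under the Cayley transform.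
\<close>

lemma no_mass_at_one:
  fixes Z W :: "'a \<Rightarrow> complex"
  assumes fin: "finite_measure M" "finite_measure M'" and sets: "sets M' = sets M"
    and ZW: "Z \<in> borel_measurable M" "W \<in> borel_measurable M"
    and norm: "\<And>x. norm (Z x) = 1" "\<And>x. norm (W x) = 1"
    and rel: "\<And>a b. (\<integral>x. Z x powi a * W x powi b \<partial>M) =
      (2 * (\<integral>x. Z x powi a * W x powi b \<partial>M') - (\<integral>x. Z x powi (a + 1) * W x powi b \<partial>M')
        - (\<integral>x. Z x powi (a - 1) * W x powi b \<partial>M')) / 4"
  shows "AE x in M. Z x \<noteq> 1"
proof -
  let ?w = "\<lambda>x. (cmod (Z x - 1))\<^sup>2 / 4"
  let ?D = "density M' (\<lambda>x. ennreal (?w x))"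
  have ZW' [measurable]: "Z \<in> borel_measurable M'" "W \<in> borel_measurable M'"
    using ZW by (simp_all add: measurable_cong_sets[OF sets refl])
  have w_meas: "?w \<in> borel_measurable M'" by measurable
  have coeffs: "(\<integral>x. Z x powi a * W x powi b \<partial>M) = (\<integral>x. Z x powi a * W x powi b \<partial>?D)" for a b
    by (simp only: rel density_cmod_minus_1(2)[OF fin(2) ZW' norm])
  interpret torus_functions Z W M ?D
    by (rule torus_functions.intro)
      (simp_all only: fin(1) density_cmod_minus_1(1)[OF fin(2) ZW' norm] ZW norm sets sets_density coeffs)
  let ?A = "{z :: complex \<times> complex. fst z = 1}"
  let ?P = "\<lambda>x. (Z x, W x)"
  have A: "?A \<in> sets borel" by (intro borel_closed closed_Collect_eq continuous_intros)
  have P: "?P \<in> measurable M borel" "?P \<in> measurable ?D borel"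
    using ZW ZW' by simp_all
  have sp: "space ?D = space M" using sets_eq_imp_space_eq[OF sets] by simp
  let ?N = "?P -` ?A \<inter> space M"
  have N: "?N \<in> sets M" "?N \<in> sets M'" using measurable_sets[OF P(1) A] sets by auto
  \<comment> \<open>The set is the preimage of a Borel set of the torus, where both measures have
    the same image, and the density of \<open>?D\<close> vanishes on it.\<close>
  have "emeasure M ?N = emeasure ?D ?N"
    using arg_cong[OF torus_distr_eq, of "\<lambda>M. emeasure M ?A"] A P sp by (simp only: emeasure_distr)
  also have "\<dots> = (\<integral>\<^sup>+x. ennreal (?w x) * indicator ?N x \<partial>M')"
    using w_meas N by (intro emeasure_density) auto
  also have "\<dots> = (\<integral>\<^sup>+x. 0 \<partial>M')" by (intro nn_integral_cong) (auto simp: indicator_def)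
  finally have "?N \<in> null_sets M" using N by auto
  then show ?thesis by (rule AE_I') auto
qed

text \<open>The solution is the measure for p = q = 0. The measures for the other exponents are
  finite and turn out to have densities with respect to it, and this is the source of integrability
  for the positive powers of x^2 + 1.\<close>

lemma extended_solution_exists:
  fixes f :: "idx \<Rightarrow> 'h::complex_hilbert"
  assumes rep: "represents f \<phi>"
    and rel: "\<And>m k l n r t. f (m + 1, k, l, n, r, t) + \<i> *\<^sub>C f (m, k, l, n, r, t) = f (m, k + 1, l, n, r, t)"
      "\<And>m k l n r t. f (m + 1, k, l, n, r, t) - \<i> *\<^sub>C f (m, k, l, n, r, t) = f (m, k, l + 1, n, r, t)"
      "\<And>m k l n r t. f (m, k, l, n + 1, r, t) + \<i> *\<^sub>C f (m, k, l, n, r, t) = f (m, k, l, n, r + 1, t)"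
      "\<And>m k l n r t. f (m, k, l, n + 1, r, t) - \<i> *\<^sub>C f (m, k, l, n, r, t) = f (m, k, l, n, r, t + 1)"
  obtains \<mu> where "extended_moment_solution \<phi> \<mu>"
proof -
  have \<phi>_eq: "\<phi> (m, k, l, n, r, t) = cinner (f (m, k, l, n, r, t)) (f (0, 0, 0, 0, 0, 0))" for m k l n r t
    using rep unfolding represents_def by simp
  have \<phi>_rel:
    "\<phi> (m + 1, k, l, n, r, t) + \<i> * \<phi> (m, k, l, n, r, t) = \<phi> (m, k + 1, l, n, r, t)"
    "\<phi> (m + 1, k, l, n, r, t) - \<i> * \<phi> (m, k, l, n, r, t) = \<phi> (m, k, l + 1, n, r, t)"
    "\<phi> (m, k, l, n + 1, r, t) + \<i> * \<phi> (m, k, l, n, r, t) = \<phi> (m, k, l, n, r + 1, t)"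
    "\<phi> (m, k, l, n + 1, r, t) - \<i> * \<phi> (m, k, l, n, r, t) = \<phi> (m, k, l, n, r, t + 1)" for m k l n r t
    unfolding \<phi>_eq rel[symmetric] by (simp_all only: cinner_add_left cinner_diff_left cinner_scaleC_left)
  have \<phi>_diff1: "\<phi> (m, k + 1, l, n, r, t) - \<phi> (m, k, l + 1, n, r, t) = 2 * \<i> * \<phi> (m, k, l, n, r, t)"
    and \<phi>_diff2: "\<phi> (m, k, l, n, r + 1, t) - \<phi> (m, k, l, n, r, t + 1) = 2 * \<i> * \<phi> (m, k, l, n, r, t)" for m k l n r t
    unfolding \<phi>_rel[symmetric] by simp_all
  \<comment> \<open>Two nested differences, each contributing the factor 2i: the numerator is -
    (2i)^2 x = 4x.\<close>
  have second_difference: "(2 * u - v - w) / 4 = x"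
    if "v - u = 2 * \<i> * y" "u - w = 2 * \<i> * z" "y - z = 2 * \<i> * x" for u v w x y z :: complex
  proof -
    have v: "v = u + 2 * \<i> * y" and w: "w = u - 2 * \<i> * z" and y: "y = z + 2 * \<i> * x"
      using that by (simp_all add: algebra_simps)
    show ?thesis unfolding v w y by (simp add: algebra_simps)
  qed

  define \<psi> where "\<psi> p q a b = \<phi> (0, a + p, p - a, 0, b + q, q - b)" for p q a b
  have \<psi>_rel1: "\<psi> p q a b = (2 * \<psi> (p + 1) q a b - \<psi> (p + 1) q (a + 1) b - \<psi> (p + 1) q (a - 1) b) / 4" for p q a b
    by (rule second_difference[symmetric,
          of _ _ "\<phi> (0, a + p + 1, p - a, 0, b + q, q - b)" _ "\<phi> (0, a + p, p - a + 1, 0, b + q, q - b)"])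
      (use \<phi>_diff1[of 0 "a + p + 1" "p - a" 0 "b + q" "q - b"] \<phi>_diff1[of 0 "a + p" "p - a + 1" 0 "b + q" "q - b"]
        \<phi>_diff1[of 0 "a + p" "p - a" 0 "b + q" "q - b"] in \<open>simp_all add: \<psi>_def algebra_simps\<close>)
  have \<psi>_rel2: "\<psi> p q a b = (2 * \<psi> p (q + 1) a b - \<psi> p (q + 1) a (b + 1) - \<psi> p (q + 1) a (b - 1)) / 4" for p q a b
    by (rule second_difference[symmetric,
          of _ _ "\<phi> (0, a + p, p - a, 0, b + q + 1, q - b)" _ "\<phi> (0, a + p, p - a, 0, b + q, q - b + 1)"])
      (use \<phi>_diff2[of 0 "a + p" "p - a" 0 "b + q + 1" "q - b"] \<phi>_diff2[of 0 "a + p" "p - a" 0 "b + q" "q - b + 1"]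
        \<phi>_diff2[of 0 "a + p" "p - a" 0 "b + q" "q - b"] in \<open>simp_all add: \<psi>_def algebra_simps\<close>)

  have "\<exists>M :: real measure. finite_measure M \<and> sets M = sets borel \<and>
      (\<forall>a b. (\<integral>t. torus_x t powi a * torus_y t powi b \<partial>M) = \<psi> p q a b)" for p q
  proof -
    \<comment> \<open>Products add k to l' and l to k', so the exponents combine to (a - a') + p and
      p - (a - a'), and likewise for b and q. The product depends on differences only: the field is
      stationary.\<close>
    have "cinner (f (0, a + p, - a, 0, b + q, - b)) (f (0, a' + p, - a', 0, b' + q, - b')) = \<psi> p q (a - a') (b - b')"
      for a b a' b'
      using rep unfolding represents_def \<psi>_def by (simp add: algebra_simps)
    then show ?thesis
      by (rule stationary_spectral_measure[where f = "\<lambda>a b. f (0, a + p, - a, 0, b + q, - b)" and \<psi> = "\<psi> p q"]) blast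
  qed
  then obtain L :: "int \<Rightarrow> int \<Rightarrow> real measure" where
    L_fin: "\<And>p q. finite_measure (L p q)" and L_sets: "\<And>p q. sets (L p q) = sets borel" and
    L_int: "\<And>p q a b. (\<integral>t. torus_x t powi a * torus_y t powi b \<partial>L p q) = \<psi> p q a b"
    by metis
  note L_meas = measurable_cong_sets[OF L_sets refl]
  \<comment> \<open>Every integer p has the neighbour p + 1, and by \<open>\<psi>_rel1\<close> the
    coefficients for p are those for p + 1 after weighting with |z - 1|^2 / 4. So no exponent is
    exceptional.\<close>
  have AE_x: "AE t in L p q. torus_x t \<noteq> 1" for p q
  proof (rule no_mass_at_one)
    show "(\<integral>x. torus_x x powi a * torus_y x powi b \<partial>L p q) =
      (2 * (\<integral>x. torus_x x powi a * torus_y x powi b \<partial>L (p + 1) q) - (\<integral>x. torus_x x powi (a + 1) * torus_y x powi b \<partial>L (p + 1) q)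
        - (\<integral>x. torus_x x powi (a - 1) * torus_y x powi b \<partial>L (p + 1) q)) / 4" for a b
      unfolding L_int by (rule \<psi>_rel1)
  qed (simp_all add: L_fin L_sets L_meas)
  have AE_y: "AE t in L p q. torus_y t \<noteq> 1" for p q
  proof (rule no_mass_at_one)
    show "(\<integral>x. torus_y x powi b * torus_x x powi a \<partial>L p q) =
      (2 * (\<integral>x. torus_y x powi b * torus_x x powi a \<partial>L p (q + 1)) - (\<integral>x. torus_y x powi (b + 1) * torus_x x powi a \<partial>L p (q + 1))
        - (\<integral>x. torus_y x powi (b - 1) * torus_x x powi a \<partial>L p (q + 1))) / 4" for a b
      unfolding mult.commute[of "torus_y _ powi _"] L_int by (rule \<psi>_rel2)
  qed (simp_all add: L_fin L_sets L_meas)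
  have AE_cayley: "AE t in L p q. cayley (inv_cayley (torus_x t)) = torus_x t \<and>
      cayley (inv_cayley (torus_y t)) = torus_y t" for p q
    using AE_x[of p q] AE_y[of p q] by eventually_elim (simp add: cayley_inv_cayley)

  \<comment> \<open>The lifts \<open>L p q\<close> were obtained independently, and nothing relates
    them on the line itself. Density relations are claimed only for their images on the
    plane.\<close>
  define \<mu> where "\<mu> p q = distr (L p q) borel (\<lambda>t. (inv_cayley (torus_x t), inv_cayley (torus_y t)))" for p q
  have \<mu>_sets: "sets (\<mu> p q) = sets borel" for p q by (simp add: \<mu>_def)
  note \<mu>_meas = measurable_cong_sets[OF \<mu>_sets refl]
  have I_meas: "(\<lambda>t. (inv_cayley (torus_x t), inv_cayley (torus_y t))) \<in> measurable (L p q) borel" for p q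
    unfolding L_meas by measurable
  have \<mu>_fin: "finite_measure (\<mu> p q)" for p q
  proof -
    interpret finite_measure "L p q" by (rule L_fin)
    show ?thesis unfolding \<mu>_def by (rule finite_measure_distr[OF I_meas])
  qed
  have \<mu>_int: "(\<integral>x. cayley (fst x) powi a * cayley (snd x) powi b \<partial>\<mu> p q) = \<psi> p q a b" for p q a b
  proof -
    have m: "(\<lambda>x :: real \<times> real. cayley (fst x) powi a * cayley (snd x) powi b) \<in> borel_measurable borel"
      by measurable
    have "(\<integral>x. cayley (fst x) powi a * cayley (snd x) powi b \<partial>\<mu> p q) =
      (\<integral>t. cayley (inv_cayley (torus_x t)) powi a * cayley (inv_cayley (torus_y t)) powi b \<partial>L p q)"
      unfolding \<mu>_def by (simp add: integral_distr[OF I_meas m])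
    also have "\<dots> = (\<integral>t. torus_x t powi a * torus_y t powi b \<partial>L p q)"
    proof (rule integral_cong_AE)
      show "AE t in L p q. cayley (inv_cayley (torus_x t)) powi a * cayley (inv_cayley (torus_y t)) powi b =
          torus_x t powi a * torus_y t powi b"
        using AE_cayley[of p q] by eventually_elim simp
    qed (unfold L_meas, measurable)
    finally show ?thesis by (simp add: L_int)
  qed
  define g1 g2 where "g1 x = (fst x)\<^sup>2 + 1" and "g2 x = (snd x)\<^sup>2 + 1" for x :: "real \<times> real"
  have g_pos: "g1 x > 0" "g2 x > 0" for x by (auto simp: g1_def g2_def add_nonneg_pos)
  have g_meas [measurable]: "g1 \<in> borel_measurable borel" "g2 \<in> borel_measurable borel"
    unfolding g1_def[abs_def] g2_def[abs_def] by measurable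
  have comp_meas: "(\<lambda>x. cayley (fst x)) \<in> borel_measurable (\<mu> p q)" "(\<lambda>x. cayley (snd x)) \<in> borel_measurable (\<mu> p q)" for p q
    unfolding \<mu>_meas by measurable
  \<comment> \<open>Both sides are finite measures on the plane, and \<open>\<psi>_rel1\<close> says
    that their trigonometric moments coincide.\<close>
  have step1: "\<mu> p q = density (\<mu> (p + 1) q) (\<lambda>x. ennreal (1 / g1 x))" for p q
  proof (rule plane_measure_eqI)
    note D = density_cmod_minus_1[OF \<mu>_fin comp_meas norm_cayley norm_cayley, of "p + 1" q, unfolded cmod_cayley_minus_1 g1_def[symmetric]]
    show "finite_measure (density (\<mu> (p + 1) q) (\<lambda>x. ennreal (1 / g1 x)))" by (rule D(1))
    show "(\<integral>x. cayley (fst x) powi a * cayley (snd x) powi b \<partial>\<mu> p q) =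
      (\<integral>x. cayley (fst x) powi a * cayley (snd x) powi b \<partial>density (\<mu> (p + 1) q) (\<lambda>x. ennreal (1 / g1 x)))" for a b
      unfolding D(2) \<mu>_int by (rule \<psi>_rel1)
  qed (simp_all add: \<mu>_fin \<mu>_sets)
  have \<mu>_p: "\<mu> p q = density (\<mu> 0 q) (\<lambda>x. ennreal (g1 x powi p))" for p q
    by (rule density_powi[where M = "\<lambda>p. \<mu> p q", OF _ g_pos(1) _ step1]) (simp_all add: \<mu>_sets \<mu>_meas g_meas)
  have step2: "\<mu> 0 q = density (\<mu> 0 (q + 1)) (\<lambda>x. ennreal (1 / g2 x))" for q
  proof (rule plane_measure_eqI)
    note D = density_cmod_minus_1[OF \<mu>_fin comp_meas(2,1) norm_cayley norm_cayley, of 0 "q + 1", unfolded cmod_cayley_minus_1 g2_def[symmetric]]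
    show "finite_measure (density (\<mu> 0 (q + 1)) (\<lambda>x. ennreal (1 / g2 x)))" by (rule D(1))
    show "(\<integral>x. cayley (fst x) powi a * cayley (snd x) powi b \<partial>\<mu> 0 q) =
      (\<integral>x. cayley (fst x) powi a * cayley (snd x) powi b \<partial>density (\<mu> 0 (q + 1)) (\<lambda>x. ennreal (1 / g2 x)))" for a b
      unfolding mult.commute[of "cayley (fst _) powi _"] D(2)
      unfolding mult.commute[of "cayley (snd _) powi _"] \<mu>_int by (rule \<psi>_rel2)
  qed (simp_all add: \<mu>_fin \<mu>_sets)
  have \<mu>_q: "\<mu> 0 q = density (\<mu> 0 0) (\<lambda>x. ennreal (g2 x powi q))" for q
    by (rule density_powi[where M = "\<lambda>q. \<mu> 0 q", OF _ g_pos(2) _ step2]) (simp_all add: \<mu>_sets \<mu>_meas g_meas)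
  \<comment> \<open>The exponent p is brought to 0 for fixed q, and then q is brought to 0 along p =
    0.\<close>
  have dens: "\<mu> p q = density (\<mu> 0 0) (\<lambda>x. ennreal (g1 x powi p * g2 x powi q))" for p q
  proof -
    have "\<mu> p q = density (density (\<mu> 0 0) (\<lambda>x. ennreal (g2 x powi q))) (\<lambda>x. ennreal (g1 x powi p))"
      by (simp only: \<mu>_p[of p q] \<mu>_q[of q])
    also have "\<dots> = density (\<mu> 0 0) (\<lambda>x. ennreal (g2 x powi q) * ennreal (g1 x powi p))"
      by (rule density_density_eq) (unfold \<mu>_meas, measurable)
    also have "(\<lambda>x. ennreal (g2 x powi q) * ennreal (g1 x powi p)) = (\<lambda>x. ennreal (g1 x powi p * g2 x powi q))"
      using g_pos by (simp add: ennreal_mult[symmetric] less_imp_le mult.commute)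
    finally show ?thesis .
  qed
  let ?good = "\<lambda>I. has_bochner_integral (\<mu> 0 0) (ext_monomial I) (\<phi> I)"
  have even: "?good (0, a + p, p - a, 0, b + q, q - b)" for a b p q
  proof -
    interpret finite_measure "\<mu> p q" by (rule \<mu>_fin)
    have C_meas: "(\<lambda>x. cayley (fst x) powi a * cayley (snd x) powi b) \<in> borel_measurable (\<mu> p q)" for p q
      unfolding \<mu>_meas by measurable
    have "integrable (\<mu> p q) (\<lambda>x. cayley (fst x) powi a * cayley (snd x) powi b)"
      by (rule integrable_const_bound[where B = 1]) (use C_meas in \<open>auto simp: norm_mult norm_power_int\<close>)
    moreover have "(\<integral>x. cayley (fst x) powi a * cayley (snd x) powi b \<partial>\<mu> p q) = \<psi> p q a b" by (rule \<mu>_int)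
    moreover have "(\<lambda>x. g1 x powi p * g2 x powi q) \<in> borel_measurable (\<mu> 0 0)" unfolding \<mu>_meas by measurable
    moreover have "AE x in \<mu> 0 0. 0 \<le> g1 x powi p * g2 x powi q" using g_pos by (simp add: less_imp_le)
    ultimately have "has_bochner_integral (\<mu> 0 0)
        (\<lambda>x. (g1 x powi p * g2 x powi q) *\<^sub>R (cayley (fst x) powi a * cayley (snd x) powi b)) (\<psi> p q a b)"
      unfolding dens[of p q] has_bochner_integral_iff
      using integrable_density[OF C_meas[of 0 0]] integral_density[OF C_meas[of 0 0]] by simp
    then show ?thesis
      unfolding ext_monomial_cayley[abs_def] \<psi>_def g1_def g2_def .
  qed
  have good_diff: "?good I" if "?good J" "?good K" "\<And>x. ext_monomial J x - ext_monomial K x = 2 * \<i> * ext_monomial I x"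
      "\<phi> J - \<phi> K = 2 * \<i> * \<phi> I" for I J K
  proof -
    have "has_bochner_integral (\<mu> 0 0) (\<lambda>x. (ext_monomial J x - ext_monomial K x) / (2 * \<i>)) ((\<phi> J - \<phi> K) / (2 * \<i>))"
      by (intro has_bochner_integral_divide has_bochner_integral_diff that)
    then show ?thesis unfolding that(3,4) by simp
  qed
  have good_lin: "?good I" if "?good J" "?good K" "\<And>x. ext_monomial I x + \<i> * ext_monomial K x = ext_monomial J x"
      "\<phi> I + \<i> * \<phi> K = \<phi> J" for I J K
  proof -
    have "has_bochner_integral (\<mu> 0 0) (\<lambda>x. ext_monomial J x - \<i> * ext_monomial K x) (\<phi> J - \<i> * \<phi> K)"
      by (intro has_bochner_integral_mult_right has_bochner_integral_diff that)
    then show ?thesis unfolding that(3,4)[symmetric] by simp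
  qed
  \<comment> \<open>If k + l is odd, raising either exponent by one gives an even sum, and the
    difference of the two monomials is 2i times the wanted one.\<close>
  have half: "?good (0, k, l, 0, b + q, q - b)" for k l b q
  proof (cases "even (k + l)")
    case True
    then obtain p where "k + l = 2 * p" by blast
    then have "k = (k - p) + p" "l = p - (k - p)" by simp_all
    then show ?thesis using even[of "k - p" p b q] by metis
  next
    case False
    then obtain p where p: "k + l + 1 = 2 * p" by (metis even_plus_one_iff evenE)
    show ?thesis
    proof (rule good_diff)
      have "k + 1 = (k + 1 - p) + p" "l = p - (k + 1 - p)" "k = (k - p) + p" "l + 1 = p - (k - p)"
        using p by simp_all
      then show "?good (0, k + 1, l, 0, b + q, q - b)" "?good (0, k, l + 1, 0, b + q, q - b)"
        using even[of "k + 1 - p" p b q] even[of "k - p" p b q] by metis+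
    qed (simp_all add: \<phi>_diff1 flip: ext_monomial_relations(1,2))
  qed
  have full: "?good (0, k, l, 0, r, t)" for k l r t
  proof (cases "even (r + t)")
    case True
    then obtain q where "r + t = 2 * q" by blast
    then have "r = (r - q) + q" "t = q - (r - q)" by simp_all
    then show ?thesis using half[of k l "r - q" q] by metis
  next
    case False
    then obtain q where q: "r + t + 1 = 2 * q" by (metis even_plus_one_iff evenE)
    show ?thesis
    proof (rule good_diff)
      have "r + 1 = (r + 1 - q) + q" "t = q - (r + 1 - q)" "r = (r - q) + q" "t + 1 = q - (r - q)"
        using q by simp_all
      then show "?good (0, k, l, 0, r + 1, t)" "?good (0, k, l, 0, r, t + 1)"
        using half[of k l "r + 1 - q" q] half[of k l "r - q" q] by metis+
    qed (simp_all add: \<phi>_diff2 flip: ext_monomial_relations(3,4))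
  qed
  \<comment> \<open>A power of x is traded for a factor x + i through x = (x + i) - i, which is why
    k has to vary in the induction.\<close>
  have good_m: "?good (m, k, l, 0, r, t)" for m k l r t
  proof (induction m arbitrary: k l)
    case (Suc m)
    show ?case
      using good_lin[OF Suc.IH[of "k + 1" l] Suc.IH[of k l] ext_monomial_relations(1) \<phi>_rel(1)] by simp
  qed (rule full)
  have "?good (m, k, l, n, r, t)" for m k l n r t
  proof (induction n arbitrary: r t)
    case (Suc n)
    show ?case
      using good_lin[OF Suc.IH[of "r + 1" t] Suc.IH[of r t] ext_monomial_relations(3) \<phi>_rel(3)] by simp
  qed (rule good_m)
  then have "extended_moment_solution \<phi> (\<mu> 0 0)"
    unfolding extended_moment_solution_iff using \<mu>_sets by auto
  then show ?thesis by (rule that)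
qed

section \<open>The sets produced by the algorithm\<close>

lemma eqn_holds_cong:
  assumes "\<And>I J. I \<in> involved E \<Longrightarrow> J \<in> involved E \<Longrightarrow> K I J = K' I J"
  shows "eqn_holds K E \<longleftrightarrow> eqn_holds K' E"
proof (cases E)
  case (Eqn cs J I' J')
  have "map (\<lambda>(c, I). c * K I J) cs = map (\<lambda>(c, I). c * K' I J) cs"
  proof (rule map_cong[OF refl])
    fix x assume "x \<in> set cs"
    then have "K (snd x) J = K' (snd x) J" using Eqn by (intro assms) auto
    then show "(case x of (c, I) \<Rightarrow> c * K I J) = (case x of (c, I) \<Rightarrow> c * K' I J)"
      by (simp add: case_prod_beta)
  qed
  moreover have "K I' J' = K' I' J'" using Eqn by (intro assms) auto
  ultimately show ?thesis unfolding Eqn eqn_holds.simps by (simp only:)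
qed

lemma finite_involved: "finite (involved E)"
  by (cases E) simp

locale moment_algorithm =
  fixes s :: "nat \<Rightarrow> nat \<Rightarrow> complex"
    and h :: "nat \<Rightarrow> nat \<Rightarrow> 'h::complex_hilbert"
    and e :: "nat \<Rightarrow> 'h"
    and w :: "nat \<Rightarrow> idx"
    and arr :: "nat \<Rightarrow> nat \<times> nat"
    and g :: "nat \<Rightarrow> 'h"
    and N :: "nat set"
    and M :: "nat \<Rightarrow> real"
  assumes model: "model_space s h e"
    and w: "bij_betw w {1..} Omega'"
    and arr: "bij arr"
    and g_def: "g = gram_schmidt_basis (\<lambda>i. case_prod h (arr i))"
    and N_def: "N = gram_schmidt_index (\<lambda>i. case_prod h (arr i))"
    and bounds: "bounding_constants s w M"
begin

lemma M_pos: "1 \<le> j \<Longrightarrow> M j > 0"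
  using bounds by (auto simp: bounding_constants_def)

lemma cinner_h: "cinner (h m n) (h m' n') = s (m + m') (n + n')"
  and norm_e: "1 \<le> j \<Longrightarrow> norm (e j) = 1"
  and e_orthogonal: "1 \<le> i \<Longrightarrow> 1 \<le> j \<Longrightarrow> i \<noteq> j \<Longrightarrow> cinner (e i) (e j) = 0"
  and H0_e: "x \<in> H0 h \<Longrightarrow> 1 \<le> j \<Longrightarrow> cinner x (e j) = 0"
  using model unfolding model_space_def by blast+

lemma cinner_e: "1 \<le> i \<Longrightarrow> 1 \<le> j \<Longrightarrow> cinner (e i) (e j) = (if i = j then 1 else 0)"
  using norm_e[of i] e_orthogonal[of i j] by (auto simp: cinner_self)

lemma orthonormal_e: "orthonormal_on e {1..}"
  by (auto simp: orthonormal_on_def cinner_e)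

lemma orthonormal_g: "orthonormal_on g N"
  unfolding g_def N_def by (rule gram_schmidt_basis)

lemma closure_cspan_g: "closure (cspan (g ` N)) = H0 h"
proof -
  have "range (\<lambda>i. case_prod h (arr i)) = case_prod h ` range arr" by (simp only: image_comp o_def)
  then show ?thesis
    unfolding g_def N_def gram_schmidt_basis(2) H0_def using arr by (simp add: bij_is_surj)
qed

lemma H0_add: "x \<in> H0 h \<Longrightarrow> y \<in> H0 h \<Longrightarrow> x + y \<in> H0 h"
  and H0_scale: "x \<in> H0 h \<Longrightarrow> c *\<^sub>C x \<in> H0 h"
  and H0_zero: "0 \<in> H0 h"
  and h_in_H0: "h m n \<in> H0 h"
  and H0_closed: "closed (H0 h)"
proof -
  show "0 \<in> H0 h" unfolding H0_def by (rule subsetD[OF closure_subset complex_vector.span_zero])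
  have "h m n \<in> range (case_prod h)" by (metis case_prod_conv rangeI)
  then show "h m n \<in> H0 h"
    unfolding H0_def by (intro subsetD[OF closure_subset] complex_vector.span_base)
qed (simp_all add: H0_def closure_cspan_add closure_cspan_scale)

text \<open>What remains of \<open>y\<close> after its components along e_1, ..., e_q are removed.
  Describing the finite orthogonal sum as the preimage of \<open>H0 h\<close> under this continuous
  linear map makes it a closed subspace at once.\<close>

definition res :: "nat \<Rightarrow> 'h \<Rightarrow> 'h" where
  "res q y = y - (\<Sum>j\<in>{1..q}. cinner y (e j) *\<^sub>C e j)"

text \<open>\<open>level q\<close> is the space \<open>H\<^sub>0 \<oplus> H\<^sub>1 \<oplus> \<dots> \<oplus> H\<^sub>q\<close>.\<close>

definition level :: "nat \<Rightarrow> 'h set" where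
  "level q = {y. res q y \<in> H0 h}"

lemma res_add: "res q (x + y) = res q x + res q y"
  by (simp add: res_def cinner_add_left scaleC_add_left sum.distrib)

lemma res_scale: "res q (c *\<^sub>C x) = c *\<^sub>C res q x"
  by (simp add: res_def cinner_scaleC_left complex_vector.scale_right_diff_distrib complex_vector.scale_sum_right)

lemma level_add: "x \<in> level q \<Longrightarrow> y \<in> level q \<Longrightarrow> x + y \<in> level q"
  by (simp add: level_def res_add H0_add)

lemma level_scale: "x \<in> level q \<Longrightarrow> c *\<^sub>C x \<in> level q"
  by (simp add: level_def res_scale H0_scale)

lemma H0_level: "x \<in> H0 h \<Longrightarrow> x \<in> level q"
  by (simp add: level_def res_def H0_e)

lemma e_level: "1 \<le> j \<Longrightarrow> j \<le> q \<Longrightarrow> e j \<in> level q"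
proof -
  assume j: "1 \<le> j" "j \<le> q"
  have "(\<Sum>i\<in>{1..q}. cinner (e j) (e i) *\<^sub>C e i) = (\<Sum>i\<in>{1..q}. if i = j then e j else 0)"
    using j by (intro sum.cong) (auto simp: cinner_e scaleC_one)
  then show ?thesis using j by (simp add: level_def res_def H0_zero)
qed

lemma level_diff: "x \<in> level q \<Longrightarrow> y \<in> level q \<Longrightarrow> x - y \<in> level q"
  using level_add[of x q "- y"] level_scale[of y q "-1"] by (simp add: scaleC_minus_one)

lemma level_zero: "0 \<in> level q"
  by (rule H0_level[OF H0_zero])

lemma level_sum: "(\<And>j. j \<in> A \<Longrightarrow> f j \<in> level q) \<Longrightarrow> sum f A \<in> level q"
  by (induction A rule: infinite_finite_induct) (auto intro: level_add level_zero)

lemma level_orthogonal: "y \<in> level q \<Longrightarrow> q < j \<Longrightarrow> cinner y (e j) = 0"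
proof -
  assume y: "y \<in> level q" and j: "q < j"
  have "cinner (res q y) (e j) = cinner y (e j) - (\<Sum>i\<in>{1..q}. cinner y (e i) * cinner (e i) (e j))"
    by (simp add: res_def cinner_diff_left cinner.sum_left cinner_scaleC_left)
  also have "(\<Sum>i\<in>{1..q}. cinner y (e i) * cinner (e i) (e j)) = 0"
    using j by (intro sum.neutral) (auto simp: cinner_e)
  finally show ?thesis using y j by (simp add: level_def H0_e)
qed

lemma level_Suc_iff: "y \<in> level q \<longleftrightarrow> y \<in> level (Suc q) \<and> cinner y (e (Suc q)) = 0"
proof -
  have "res (Suc q) y = res q y - cinner y (e (Suc q)) *\<^sub>C e (Suc q)"
    by (simp add: res_def)
  then show ?thesis using level_orthogonal[of y q "Suc q"] by (auto simp: level_def)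
qed

lemma level_mono: "p \<le> q \<Longrightarrow> y \<in> level p \<Longrightarrow> y \<in> level q"
proof (induction rule: dec_induct)
  case (step n)
  then show ?case using level_Suc_iff[of y n] by blast
qed

lemma closed_level: "closed (level q)"
proof -
  have "continuous_on UNIV (res q)"
    unfolding res_def[abs_def] by (intro continuous_intros scaleC.continuous_on cinner.continuous_on)
  then have "closed (res q -` H0 h)" using closed_vimage[OF H0_closed] by blast
  then show ?thesis by (simp add: level_def vimage_def)
qed

lemma partial_vec:
  assumes \<alpha>: "(\<lambda>n. (cmod (\<alpha> n))\<^sup>2) summable_on N"
  shows "partial_vec g N e (Suc p) \<alpha> \<beta> \<in> level p"
    and "(norm (partial_vec g N e (Suc p) \<alpha> \<beta>))\<^sup>2 = sqnorm_coeffs N (Suc p) \<alpha> \<beta>"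
proof -
  let ?x = "\<Sum>\<^sub>\<infinity>n\<in>N. \<alpha> n *\<^sub>C g n"
  let ?y = "\<Sum>j\<in>{1..p}. \<beta> j *\<^sub>C e j"
  note x = orthonormal_series[OF orthonormal_g \<alpha>]
  have x0: "?x \<in> H0 h" using x(1) closure_cspan_g by simp
  have pv: "partial_vec g N e (Suc p) \<alpha> \<beta> = ?x + ?y"
    by (simp add: partial_vec_def atLeastLessThanSuc_atLeastAtMost)
  have "?y \<in> level p" by (intro level_sum level_scale e_level) auto
  then show "partial_vec g N e (Suc p) \<alpha> \<beta> \<in> level p"
    unfolding pv by (intro level_add H0_level[OF x0])
  have "cinner ?x ?y = 0"
    unfolding cinner.sum_right cinner_scaleC_right by (intro sum.neutral) (simp add: H0_e[OF x0])
  then show "(norm (partial_vec g N e (Suc p) \<alpha> \<beta>))\<^sup>2 = sqnorm_coeffs N (Suc p) \<alpha> \<beta>"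
    unfolding pv norm_add_square sqnorm_coeffs_def x(3)
    by (simp add: norm_sum_orthonormal[OF orthonormal_on_subset[OF orthonormal_e]] subset_iff atLeastLessThanSuc_atLeastAtMost)
qed

text \<open>The converse of \<open>partial_vec\<close>: the unknowns \<alpha> and \<beta> of step p
  + 1 parametrize all of \<open>level p\<close>.\<close>

lemma partial_vec_coeffs:
  assumes y: "y \<in> level p"
  defines "\<alpha> \<equiv> \<lambda>n. cinner (res p y) (g n)" and "\<beta> \<equiv> \<lambda>j. cinner y (e j)"
  shows "(\<lambda>n. (cmod (\<alpha> n))\<^sup>2) summable_on N" "partial_vec g N e (Suc p) \<alpha> \<beta> = y"
proof -
  have r: "res p y \<in> closure (cspan (g ` N))" using y closure_cspan_g by (simp add: level_def)
  note x = orthonormal_expansion[OF orthonormal_g r]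
  show "(\<lambda>n. (cmod (\<alpha> n))\<^sup>2) summable_on N"
    unfolding \<alpha>_def using x(2) by (rule has_sum_imp_summable)
  have "(\<Sum>\<^sub>\<infinity>n\<in>N. \<alpha> n *\<^sub>C g n) = res p y" unfolding \<alpha>_def using x(1) by (rule infsumI)
  then show "partial_vec g N e (Suc p) \<alpha> \<beta> = y"
    by (simp add: partial_vec_def res_def \<beta>_def atLeastLessThanSuc_atLeastAtMost)
qed

lemma w_Omega': "1 \<le> q \<Longrightarrow> w q \<notin> Omega0"
  using bij_betwE[OF w] by (auto simp: Omega'_def)

lemma w_inj: "1 \<le> p \<Longrightarrow> 1 \<le> q \<Longrightarrow> w p = w q \<longleftrightarrow> p = q"
  using bij_betw_imp_inj_on[OF w] by (auto simp: inj_on_eq_iff)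

lemma Omega_cases:
  obtains m n where "I = (m, 0, 0, n, 0, 0)" | q where "1 \<le> q" "I = w q"
proof (cases "I \<in> Omega0")
  case True
  then show ?thesis using that(1) by (auto simp: Omega0_def)
next
  case False
  then have "I \<in> w ` {1..}" using bij_betw_imp_surj_on[OF w] by (auto simp: Omega'_def)
  then show ?thesis using that(2) by auto
qed

lemma family_of_Omega0 [simp]: "family_of h w v (m, 0, 0, n, 0, 0) = h m n"
  by (simp add: family_of_def Omega0_def)

lemma family_of_w [simp]: "1 \<le> q \<Longrightarrow> family_of h w v (w q) = v q"
  using w_Omega'[of q] inv_into_f_f[OF bij_betw_imp_inj_on[OF w], of q] by (simp add: family_of_def)

section \<open>Gram matrices and admissible sequences\<close>

definition gram :: "(nat \<Rightarrow> 'h) \<Rightarrow> idx \<Rightarrow> idx \<Rightarrow> complex" where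
  "gram v I J = cinner (family_of h w v I) (family_of h w v J)"

definition stage :: "nat \<Rightarrow> idx set" where
  "stage q = Omega0 \<union> w ` {1..q}"

lemma stage_cases:
  assumes "I \<in> stage q"
  obtains m n where "I = (m, 0, 0, n, 0, 0)" | p where "1 \<le> p" "p \<le> q" "I = w p"
  using assms by (auto simp: stage_def Omega0_def)

lemma stage_Suc: "stage (Suc q) = insert (w (Suc q)) (stage q)"
  by (auto simp: stage_def atLeastAtMostSuc_conv)

lemma stage_mono: "p \<le> q \<Longrightarrow> stage p \<subseteq> stage q"
  by (auto simp: stage_def)

lemma in_stage: "\<exists>q. I \<in> stage q"
proof (cases I rule: Omega_cases)
  case (1 m n)
  then show ?thesis by (auto simp: stage_def Omega0_def)
next
  case (2 q)
  then have "I \<in> stage q" by (simp add: stage_def)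
  then show ?thesis ..
qed

lemma family_of_cong: "I \<in> stage q \<Longrightarrow> (\<And>p. 1 \<le> p \<Longrightarrow> p \<le> q \<Longrightarrow> v p = v' p) \<Longrightarrow> family_of h w v I = family_of h w v' I"
  by (erule stage_cases) auto

lemma family_of_level: "I \<in> stage q \<Longrightarrow> (\<And>p. 1 \<le> p \<Longrightarrow> p \<le> q \<Longrightarrow> v p \<in> level p) \<Longrightarrow> family_of h w v I \<in> level q"
  by (erule stage_cases) (auto intro: H0_level h_in_H0 level_mono)

lemma L_eqs_iff: "E \<in> L_eqs w q \<longleftrightarrow> E \<in> equations \<and> w q \<in> involved E \<and> involved E \<subseteq> stage q"
  by (simp add: L_eqs_def stage_def)

text \<open>Earlier vectors lie in \<open>level p\<close> and are orthogonal to
  \<open>e (Suc p)\<close>, so the component along it is visible only in the product of the new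
  vector with itself. That is the entry where the algorithm puts d.\<close>

lemma step_gram_eq:
  assumes v: "\<And>r. 1 \<le> r \<Longrightarrow> r \<le> p \<Longrightarrow> v r \<in> level r"
    and y: "y \<in> level p" "partial_vec g N e (Suc p) \<alpha> \<beta> = y"
    and d: "d = (norm (y + of_real c *\<^sub>C e (Suc p)))\<^sup>2"
    and IJ: "I \<in> stage (Suc p)" "J \<in> stage (Suc p)"
  shows "step_gram h e w g N (Suc p) \<alpha> \<beta> d v I J = gram (v(Suc p := y + of_real c *\<^sub>C e (Suc p))) I J"
proof -
  let ?q = "Suc p"
  let ?v = "v(?q := y + of_real c *\<^sub>C e ?q)" and ?u = "v(?q := y)"
  have fam: "family_of h w ?u I = family_of h w ?v I" "cinner (family_of h w ?v I) (e ?q) = 0"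
    if "I \<in> stage ?q" "I \<noteq> w ?q" for I
  proof -
    have I: "I \<in> stage p" using that by (simp add: stage_Suc)
    then show "family_of h w ?u I = family_of h w ?v I" by (rule family_of_cong) auto
    have "family_of h w ?v I \<in> level p" using I by (rule family_of_level) (auto intro: v)
    then show "cinner (family_of h w ?v I) (e ?q) = 0" by (rule level_orthogonal) simp
  qed
  show ?thesis
  proof (cases "I = w ?q"; cases "J = w ?q")
    assume "I = w ?q" "J = w ?q"
    then show ?thesis by (simp add: step_gram_def gram_def d cinner_self del: of_real_power)
  next
    assume IJ': "I = w ?q" "J \<noteq> w ?q"
    then have "cinner (e ?q) (family_of h w ?v J) = 0" using fam(2)[OF IJ(2)] by (simp add: cinner_commute_zero)
    then show ?thesis
      using IJ' fam(1)[OF IJ(2)] by (simp add: step_gram_def gram_def y cinner_add_left cinner_scaleC_left)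
  next
    assume IJ': "I \<noteq> w ?q" "J = w ?q"
    then show ?thesis
      using fam[OF IJ(1)] by (simp add: step_gram_def gram_def y cinner_add_right cinner_scaleC_right)
  next
    assume IJ': "I \<noteq> w ?q" "J \<noteq> w ?q"
    then show ?thesis
      using fam(1)[OF IJ(1)] fam(1)[OF IJ(2)] by (simp add: step_gram_def gram_def y)
  qed
qed

text \<open>The outcome of step p expressed by the vector itself, without the unknowns \<alpha>,
  \<beta> and d. Only entries up to p matter, so the sets of the algorithm become conjunctions over
  p.\<close>

definition admissible :: "(nat \<Rightarrow> 'h) \<Rightarrow> nat \<Rightarrow> bool" where
  "admissible v p \<longleftrightarrow> v p \<in> level p \<and> cinner (v p) (e p) \<in> \<real>\<^sub>\<ge>\<^sub>0 \<and> (norm (v p))\<^sup>2 \<le> M p \<and>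
    (\<forall>E\<in>L_eqs w p. eqn_holds (gram v) E)"

lemma admissible_cong:
  assumes "\<And>r. 1 \<le> r \<Longrightarrow> r \<le> p \<Longrightarrow> v r = v' r" "1 \<le> p"
  shows "admissible v p \<longleftrightarrow> admissible v' p"
proof -
  have "eqn_holds (gram v) E \<longleftrightarrow> eqn_holds (gram v') E" if "E \<in> L_eqs w p" for E
  proof (rule eqn_holds_cong)
    fix I J assume "I \<in> involved E" "J \<in> involved E"
    then have "I \<in> stage p" "J \<in> stage p" using that by (auto simp: L_eqs_iff)
    then show "gram v I J = gram v' I J" using assms(1) by (simp add: gram_def family_of_cong[of _ p v v'])
  qed
  then show ?thesis using assms by (simp add: admissible_def)
qed

lemma Suc_decomposition:
  assumes "x \<in> level (Suc p)" "cinner x (e (Suc p)) \<in> \<real>\<^sub>\<ge>\<^sub>0"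
  obtains c y where "0 \<le> c" "y \<in> level p" "x = y + of_real c *\<^sub>C e (Suc p)"
proof -
  obtain c where c: "cinner x (e (Suc p)) = of_real c" "0 \<le> c"
    using assms(2) by (auto elim: nonneg_Reals_cases)
  let ?y = "x - of_real c *\<^sub>C e (Suc p)"
  have "?y \<in> level (Suc p)" using assms(1) by (intro level_diff level_scale e_level) auto
  moreover have "cinner ?y (e (Suc p)) = 0" using c by (simp add: cinner_diff_left cinner_scaleC_left cinner_e)
  ultimately have "?y \<in> level p" using level_Suc_iff by blast
  then show ?thesis using that[of c ?y] c by simp
qed

lemma norm_Suc_decomposition:
  assumes "y \<in> level p"
  shows "(norm (y + of_real c *\<^sub>C e (Suc p)))\<^sup>2 = (norm y)\<^sup>2 + c\<^sup>2"
  using level_orthogonal[OF assms, of "Suc p"]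
  by (simp add: norm_add_square cinner_scaleC_right norm_scaleC norm_e power_mult_distrib)

lemma cinner_Suc_decomposition:
  assumes "y \<in> level p"
  shows "cinner (y + of_real c *\<^sub>C e (Suc p)) (e (Suc p)) = of_real c"
  using level_orthogonal[OF assms, of "Suc p"] by (simp add: cinner_add_left cinner_scaleC_left cinner_e)

text \<open>For y in \<open>level p\<close>, a number d that is at least |y|^2, together with the
  coefficient sqrt (d - |y|^2), is the same as a vector with part y, squared norm d and non-negative
  product with the new unit vector.\<close>

lemma G_step_eq: "G_step h e w g N M q = {v \<in> extensional {1..q}. \<forall>p\<in>{1..q}. admissible v p}"
proof (induction q)
  case 0
  then show ?case by (auto simp: extensional_def)
next
  case (Suc p)
  let ?q = "Suc p"
  show ?case
  proof (intro subset_antisym subsetI)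
    fix v' assume "v' \<in> G_step h e w g N M ?q"
    then obtain \<alpha> \<beta> d v where S: "(\<alpha>, \<beta>, d, v) \<in> Shat_step h e w g N M ?q (G_step h e w g N M p)"
      and v': "v' = v(?q := partial_vec g N e ?q \<alpha> \<beta> + complex_of_real (sqrt (d - sqnorm_coeffs N ?q \<alpha> \<beta>)) *\<^sub>C e ?q)"
      by auto
    define y c where "y = partial_vec g N e ?q \<alpha> \<beta>" and "c = sqrt (d - sqnorm_coeffs N ?q \<alpha> \<beta>)"
    have v: "v \<in> extensional {1..p}" "\<And>r. 1 \<le> r \<Longrightarrow> r \<le> p \<Longrightarrow> admissible v r"
      and \<alpha>: "(\<lambda>n. (cmod (\<alpha> n))\<^sup>2) summable_on N" and d: "sqnorm_coeffs N ?q \<alpha> \<beta> \<le> d" "d \<le> M ?q"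
      and L: "\<And>E. E \<in> L_eqs w ?q \<Longrightarrow> eqn_holds (step_gram h e w g N ?q \<alpha> \<beta> d v) E"
      using S Suc.IH by (auto simp: Shat_step_def S_step_def)
    have y: "y \<in> level p" "(norm y)\<^sup>2 = sqnorm_coeffs N ?q \<alpha> \<beta>"
      unfolding y_def using partial_vec[OF \<alpha>] by auto
    have c: "c \<ge> 0" "c\<^sup>2 = d - (norm y)\<^sup>2" using d y by (simp_all add: c_def)
    have v'_eq: "v' = v(?q := y + of_real c *\<^sub>C e ?q)" by (simp add: v' y_def c_def)
    have d_eq: "d = (norm (y + of_real c *\<^sub>C e ?q))\<^sup>2" using c by (simp add: norm_Suc_decomposition[OF y(1)])
    have "admissible v' r" if "1 \<le> r" "r \<le> p" for r
      using v(2)[OF that] that admissible_cong[of r v v'] by (simp add: v'_eq)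
    moreover have "admissible v' ?q"
      unfolding admissible_def
    proof (intro conjI ballI)
      have "y \<in> level ?q" using y(1) by (rule level_mono[rotated]) simp
      then show "v' ?q \<in> level ?q" unfolding v'_eq by (simp add: level_add level_scale e_level)
      show "cinner (v' ?q) (e ?q) \<in> \<real>\<^sub>\<ge>\<^sub>0" using c(1) by (simp add: v'_eq cinner_Suc_decomposition[OF y(1)])
      show "(norm (v' ?q))\<^sup>2 \<le> M ?q" using d(2) by (simp add: v'_eq d_eq)
      fix E assume E: "E \<in> L_eqs w ?q"
      have "eqn_holds (step_gram h e w g N ?q \<alpha> \<beta> d v) E \<longleftrightarrow> eqn_holds (gram v') E"
      proof (rule eqn_holds_cong)
        fix I J assume "I \<in> involved E" "J \<in> involved E"
        then have IJ: "I \<in> stage ?q" "J \<in> stage ?q" using E by (auto simp: L_eqs_iff)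
        show "step_gram h e w g N ?q \<alpha> \<beta> d v I J = gram v' I J"
          unfolding v'_eq using v(2) IJ by (intro step_gram_eq y(1) d_eq) (auto simp: y_def admissible_def)
      qed
      then show "eqn_holds (gram v') E" using L[OF E] by blast
    qed
    ultimately have "admissible v' r" if "r \<in> {1..?q}" for r
      using that by (cases "r = ?q") auto
    moreover have "v' \<in> extensional {1..?q}" using v(1) by (auto simp: v' extensional_def)
    ultimately show "v' \<in> {v \<in> extensional {1..?q}. \<forall>p\<in>{1..?q}. admissible v p}" by blast
  next
    fix v' assume "v' \<in> {v \<in> extensional {1..?q}. \<forall>p\<in>{1..?q}. admissible v p}"
    then have ext: "v' \<in> extensional {1..?q}" and adm: "\<And>r. 1 \<le> r \<Longrightarrow> r \<le> ?q \<Longrightarrow> admissible v' r" by auto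
    define v where "v = restrict v' {1..p}"
    have adm_v: "admissible v r" if "1 \<le> r" "r \<le> p" for r
      using adm[of r] that admissible_cong[of r v v'] by (simp add: v_def)
    then have "v \<in> G_step h e w g N M p" unfolding Suc.IH by (auto simp: v_def)
    have a: "v' ?q \<in> level ?q" "cinner (v' ?q) (e ?q) \<in> \<real>\<^sub>\<ge>\<^sub>0" "(norm (v' ?q))\<^sup>2 \<le> M ?q"
      and L: "\<And>E. E \<in> L_eqs w ?q \<Longrightarrow> eqn_holds (gram v') E"
      using adm[of ?q] by (auto simp: admissible_def)
    obtain c y where c: "0 \<le> c" and y: "y \<in> level p" and v'q: "v' ?q = y + of_real c *\<^sub>C e ?q"
      using a(1,2) by (rule Suc_decomposition)
    \<comment> \<open>The coefficients of the part without the new unit vector, and the true squared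
      norm; the root taken by the algorithm then returns \<open>c\<close>.\<close>
    define \<alpha> \<beta> d where "\<alpha> n = cinner (res p y) (g n)" and "\<beta> j = cinner y (e j)" and "d = (norm (v' ?q))\<^sup>2" for n j
    have \<alpha>: "(\<lambda>n. (cmod (\<alpha> n))\<^sup>2) summable_on N" "partial_vec g N e ?q \<alpha> \<beta> = y"
      using partial_vec_coeffs[OF y] unfolding \<alpha>_def \<beta>_def by auto
    have sq: "sqnorm_coeffs N ?q \<alpha> \<beta> = (norm y)\<^sup>2" using partial_vec(2)[OF \<alpha>(1)] \<alpha>(2) by metis
    have d: "d = (norm y)\<^sup>2 + c\<^sup>2" unfolding d_def v'q by (rule norm_Suc_decomposition[OF y])
    have v': "v' = v(?q := y + of_real c *\<^sub>C e ?q)"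
      using ext v'q by (auto simp: v_def fun_eq_iff extensional_def restrict_def)
    have "eqn_holds (step_gram h e w g N ?q \<alpha> \<beta> d v) E" if E: "E \<in> L_eqs w ?q" for E
    proof -
      have "eqn_holds (step_gram h e w g N ?q \<alpha> \<beta> d v) E \<longleftrightarrow> eqn_holds (gram v') E"
      proof (rule eqn_holds_cong)
        fix I J assume "I \<in> involved E" "J \<in> involved E"
        then have IJ: "I \<in> stage ?q" "J \<in> stage ?q" using E by (auto simp: L_eqs_iff)
        show "step_gram h e w g N ?q \<alpha> \<beta> d v I J = gram v' I J"
          unfolding v' using adm_v IJ
          by (intro step_gram_eq y \<alpha>(2)) (auto simp: admissible_def d_def v'q)
      qed
      then show "eqn_holds (step_gram h e w g N ?q \<alpha> \<beta> d v) E" using L[OF E] by blast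
    qed
    moreover have "sqnorm_coeffs N ?q \<alpha> \<beta> \<le> d" "d \<le> M ?q"
      using sq d a(3) by (simp_all add: d_def)
    ultimately have "(\<alpha>, \<beta>, d, v) \<in> Shat_step h e w g N M ?q (G_step h e w g N M p)"
      using \<open>v \<in> G_step h e w g N M p\<close> \<alpha>(1) by (simp add: Shat_step_def S_step_def)
    moreover have "v' = v(?q := partial_vec g N e ?q \<alpha> \<beta> + complex_of_real (sqrt (d - sqnorm_coeffs N ?q \<alpha> \<beta>)) *\<^sub>C e ?q)"
      unfolding \<alpha>(2) sq using v' c by (simp add: d)
    ultimately show "v' \<in> G_step h e w g N M ?q"
      by (auto intro!: image_eqI[where x = "(\<alpha>, \<beta>, d, v)"])
  qed
qed

text \<open>Admissibility at j contains the bound M j for the squared norm. This gives the tail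
  condition of every step, and 1 as a bound for the weighted norms.\<close>

lemma bold_G_iff:
  "v \<in> bold_G h e w g N M \<longleftrightarrow> v \<in> extensional {1..} \<and> (\<forall>p\<ge>1. admissible v p)"
proof -
  have res_adm: "(\<forall>p\<in>{1..q}. admissible (restrict v {1..q}) p) \<longleftrightarrow> (\<forall>p\<in>{1..q}. admissible v p)" for q
    using admissible_cong[of _ "restrict v {1..q}" v] by (intro ball_cong) auto
  have norm_le: "norm (v j) \<le> sqrt (M j)" if "admissible v j" for j
    using that by (auto simp: admissible_def intro: real_le_rsqrt)
  show ?thesis
  proof
    assume v: "v \<in> bold_G h e w g N M"
    then have "\<forall>p\<in>{1..q}. admissible v p" if "q \<ge> 1" for q
      using that unfolding bold_G_def bold_G_step_def G_step_eq using res_adm by auto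
    moreover have "v \<in> extensional {1..}" using v by (auto simp: bold_G_def bold_G_step_def bold_H_def)
    ultimately show "v \<in> extensional {1..} \<and> (\<forall>p\<ge>1. admissible v p)" by auto
  next
    assume v: "v \<in> extensional {1..} \<and> (\<forall>p\<ge>1. admissible v p)"
    have "bdd_above ((\<lambda>q. norm (v q) / sqrt (M q)) ` {1..})"
      using v norm_le M_pos by (intro bdd_aboveI2[of _ _ 1]) (auto simp: divide_le_eq)
    then show "v \<in> bold_G h e w g N M"
      using v norm_le res_adm unfolding bold_G_def bold_G_step_def G_step_eq bold_H_def by auto
  qed
qed

end

section \<open>From the algorithm to a solution\<close>

text \<open>Complex conjugation exchanges x + i and x - i, hence the crosswise addition of the
  exponents.\<close>

fun idx_join :: "idx \<Rightarrow> idx \<Rightarrow> idx" where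
  "idx_join (m, k, l, n, r, t) (m', k', l', n', r', t') = (m + m', k + l', l + k', n + n', r + t', t + r')"

lemma represents_iff: "represents f \<phi> \<longleftrightarrow> (\<forall>I J. cinner (f I) (f J) = \<phi> (idx_join I J))"
  unfolding represents_def by auto

lemma ext_monomial_join: "ext_monomial I x * cnj (ext_monomial J x) = ext_monomial (idx_join I J) x"
  by (cases I; cases J; cases x) (simp add: power_add power_int_add mult_ac)

lemma ext_monomial_eq: "ext_monomial (m, k, l, n, r, t) x =
   of_real (fst x) ^ m * (of_real (fst x) + \<i>) powi k * (of_real (fst x) - \<i>) powi l *
   of_real (snd x) ^ n * (of_real (snd x) + \<i>) powi r * (of_real (snd x) - \<i>) powi t"
  by (cases x) simp

section \<open>Integrability of the extended monomials\<close>

lemma ext_monomial_measurable [measurable]: "ext_monomial I \<in> borel_measurable borel"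
proof -
  obtain m k l n r t where I: "I = (m, k, l, n, r, t)" by (rule prod_cases6)
  show ?thesis unfolding I ext_monomial_eq[abs_def] by measurable
qed

text \<open>A crude polynomial majorant. Negative powers of x + i and x - i are harmless because
  both have modulus at least 1.\<close>

lemma norm_factor_le:
  "norm (complex_of_real x ^ m * (of_real x + \<i>) powi k * (of_real x - \<i>) powi l) \<le> (1 + x\<^sup>2) ^ (m + nat \<bar>k\<bar> + nat \<bar>l\<bar>)"
proof -
  have one: "1 \<le> (1 + x\<^sup>2) ^ j" for j by (intro one_le_power) simp
  have "0 \<le> (\<bar>x\<bar> - 1)\<^sup>2" by simp
  then have "\<bar>x\<bar> \<le> 1 + x\<^sup>2" by (simp add: power2_diff power2_abs)
  then have xm: "\<bar>x\<bar> ^ m \<le> (1 + x\<^sup>2) ^ m" by (intro power_mono) auto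
  have powi: "c powi j \<le> (1 + x\<^sup>2) ^ nat \<bar>j\<bar>" if c: "c\<^sup>2 = 1 + x\<^sup>2" "0 \<le> c" for c :: real and j :: int
  proof -
    have "1\<^sup>2 \<le> c\<^sup>2" using c by simp
    then have c1: "1 \<le> c" using c(2) by (rule power2_le_imp_le)
    then have "c \<le> 1 + x\<^sup>2" using self_le_power[OF c1, of 2] c(1) by simp
    show ?thesis
    proof (cases "0 \<le> j")
      case True
      then have "c powi j = c ^ nat \<bar>j\<bar>" by (simp add: power_int_def)
      also have "\<dots> \<le> (1 + x\<^sup>2) ^ nat \<bar>j\<bar>" using \<open>c \<le> 1 + x\<^sup>2\<close> c(2) by (intro power_mono)
      finally show ?thesis .
    next
      case False
      then have "c powi j = inverse (c ^ nat (- j))" by (simp add: power_int_def power_inverse)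
      also have "\<dots> \<le> 1" using one_le_power[OF c1, of "nat (- j)"] by (simp add: inverse_le_1_iff)
      finally show ?thesis using one[of "nat \<bar>j\<bar>"] by linarith
    qed
  qed
  have c: "(cmod (of_real x + \<i>))\<^sup>2 = 1 + x\<^sup>2" "(cmod (of_real x - \<i>))\<^sup>2 = 1 + x\<^sup>2"
    by (simp_all add: cmod_power2)
  from powi[OF c(1) norm_ge_zero, of k] powi[OF c(2) norm_ge_zero, of l] have "\<bar>x\<bar> ^ m * cmod (of_real x + \<i>) powi k * cmod (of_real x - \<i>) powi l \<le>
      (1 + x\<^sup>2) ^ m * (1 + x\<^sup>2) ^ nat \<bar>k\<bar> * (1 + x\<^sup>2) ^ nat \<bar>l\<bar>"
    using xm by (intro mult_mono mult_nonneg_nonneg) auto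
  then show ?thesis by (simp add: norm_mult norm_power norm_power_int power_add)
qed

text \<open>The majorant is a product of powers of 1 + x1^2 and 1 + x2^2. Its integrability follows
  from that of the ordinary monomials by splitting off one factor at a time.\<close>

lemma integrable_ext_monomial:
  assumes "moment_solution s \<mu>"
  shows "integrable \<mu> (ext_monomial I)"
proof -
  have sets: "sets \<mu> = sets borel" using assms by (simp add: moment_solution_def)
  have base: "integrable \<mu> (\<lambda>x. fst x ^ m * snd x ^ n)" for m n
  proof -
    have "integrable \<mu> (\<lambda>(x1, x2). complex_of_real (x1 ^ m * x2 ^ n))"
      using assms by (auto simp: moment_solution_def has_bochner_integral_iff)
    then show ?thesis
      using complex_of_real_integrable_eq[of \<mu> "\<lambda>x. fst x ^ m * snd x ^ n"] by (simp add: case_prod_unfold)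
  qed
  have step1: "integrable \<mu> (\<lambda>x. (1 + (fst x)\<^sup>2) ^ a * (fst x ^ m * snd x ^ n))" for a m n
  proof (induction a arbitrary: m)
    case (Suc a)
    have "integrable \<mu> (\<lambda>x. (1 + (fst x)\<^sup>2) ^ a * (fst x ^ m * snd x ^ n) + (1 + (fst x)\<^sup>2) ^ a * (fst x ^ (m + 2) * snd x ^ n))"
      by (intro Bochner_Integration.integrable_add Suc.IH)
    also have "(\<lambda>x :: real \<times> real. (1 + (fst x)\<^sup>2) ^ a * (fst x ^ m * snd x ^ n) + (1 + (fst x)\<^sup>2) ^ a * (fst x ^ (m + 2) * snd x ^ n)) =
      (\<lambda>x. (1 + (fst x)\<^sup>2) ^ Suc a * (fst x ^ m * snd x ^ n))"
      by (rule ext) (simp add: power_add power2_eq_square algebra_simps)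
    finally show ?case .
  qed (simp add: base)
  have step2: "integrable \<mu> (\<lambda>x. (1 + (snd x)\<^sup>2) ^ b * ((1 + (fst x)\<^sup>2) ^ a * snd x ^ n))" for a b n
  proof (induction b arbitrary: n)
    case 0
    then show ?case using step1[of a 0 n] by simp
  next
    case (Suc b)
    have "integrable \<mu> (\<lambda>x. (1 + (snd x)\<^sup>2) ^ b * ((1 + (fst x)\<^sup>2) ^ a * snd x ^ n) + (1 + (snd x)\<^sup>2) ^ b * ((1 + (fst x)\<^sup>2) ^ a * snd x ^ (n + 2)))"
      by (intro Bochner_Integration.integrable_add Suc.IH)
    also have "(\<lambda>x :: real \<times> real. (1 + (snd x)\<^sup>2) ^ b * ((1 + (fst x)\<^sup>2) ^ a * snd x ^ n) + (1 + (snd x)\<^sup>2) ^ b * ((1 + (fst x)\<^sup>2) ^ a * snd x ^ (n + 2))) =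
      (\<lambda>x. (1 + (snd x)\<^sup>2) ^ Suc b * ((1 + (fst x)\<^sup>2) ^ a * snd x ^ n))"
      by (rule ext) (simp add: power_add power2_eq_square algebra_simps)
    finally show ?case .
  qed
  obtain m k l n r t where I: "I = (m, k, l, n, r, t)" by (rule prod_cases6)
  show ?thesis
  proof (rule Bochner_Integration.integrable_bound)
    show "integrable \<mu> (\<lambda>x. (1 + (snd x)\<^sup>2) ^ (n + nat \<bar>r\<bar> + nat \<bar>t\<bar>) * (1 + (fst x)\<^sup>2) ^ (m + nat \<bar>k\<bar> + nat \<bar>l\<bar>))"
      using step2[of "n + nat \<bar>r\<bar> + nat \<bar>t\<bar>" "m + nat \<bar>k\<bar> + nat \<bar>l\<bar>" 0] by simp
    show "ext_monomial I \<in> borel_measurable \<mu>"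
      unfolding measurable_cong_sets[OF sets refl] by measurable
    show "AE x in \<mu>. norm (ext_monomial I x) \<le>
        norm ((1 + (snd x)\<^sup>2) ^ (n + nat \<bar>r\<bar> + nat \<bar>t\<bar>) * (1 + (fst x)\<^sup>2) ^ (m + nat \<bar>k\<bar> + nat \<bar>l\<bar>))"
    proof (intro always_eventually allI)
      fix x :: "real \<times> real"
      have eq: "ext_monomial I x = (of_real (fst x) ^ m * (of_real (fst x) + \<i>) powi k * (of_real (fst x) - \<i>) powi l) *
        (of_real (snd x) ^ n * (of_real (snd x) + \<i>) powi r * (of_real (snd x) - \<i>) powi t)"
        unfolding I ext_monomial_eq by (simp only: mult.assoc)
      have "norm (ext_monomial I x) \<le> (1 + (fst x)\<^sup>2) ^ (m + nat \<bar>k\<bar> + nat \<bar>l\<bar>) * (1 + (snd x)\<^sup>2) ^ (n + nat \<bar>r\<bar> + nat \<bar>t\<bar>)"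
        unfolding eq
        by (subst norm_mult, rule mult_mono[OF norm_factor_le[of "fst x" m k l] norm_factor_le[of "snd x" n r t] _ norm_ge_zero])
          (rule zero_le_power, simp)
      also have "\<dots> = (1 + (snd x)\<^sup>2) ^ (n + nat \<bar>r\<bar> + nat \<bar>t\<bar>) * (1 + (fst x)\<^sup>2) ^ (m + nat \<bar>k\<bar> + nat \<bar>l\<bar>)"
        by (rule mult.commute)
      also have "\<dots> \<le> norm \<dots>" by (simp only: real_norm_def abs_ge_self)
      finally show "norm (ext_monomial I x) \<le>
        norm ((1 + (snd x)\<^sup>2) ^ (n + nat \<bar>r\<bar> + nat \<bar>t\<bar>) * (1 + (fst x)\<^sup>2) ^ (m + nat \<bar>k\<bar> + nat \<bar>l\<bar>))" .
    qed
  qed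
qed

text \<open>The equations test a relation only against members of the family, but the defect of the
  relation is itself a combination of members, so it is orthogonal to itself.\<close>

lemma inner_determined:
  fixes f :: "'i \<Rightarrow> 'h::complex_hilbert"
  assumes "\<And>J. cinner (f A) (f J) + c * cinner (f B) (f J) = cinner (f C) (f J)"
  shows "f A + c *\<^sub>C f B = f C"
proof -
  let ?d = "f A + c *\<^sub>C f B - f C"
  have "cinner ?d (f J) = 0" for J
    using assms[of J] by (simp add: cinner_diff_left cinner_add_left cinner_scaleC_left)
  then have "cinner ?d ?d = 0"
    unfolding cinner_diff_right[of ?d] cinner_add_right[of ?d] cinner_scaleC_right[of ?d] by simp
  then show ?thesis by (simp add: cinner_self)
qed

lemma extended_is_moment_solution:
  assumes "extended_moment_solution \<phi> \<mu>" "\<And>m n. \<phi> (m, 0, 0, n, 0, 0) = s m n"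
  shows "moment_solution s \<mu>"
proof -
  have "ext_monomial (m, 0, 0, n, 0, 0) = (\<lambda>(x1, x2). complex_of_real (x1 ^ m * x2 ^ n))" for m n
    by auto
  then show ?thesis
    using assms unfolding extended_moment_solution_iff moment_solution_def by metis
qed

lemma equations_shift:
  fixes m m' n n' i j :: nat and k l r t k' l' r' t' a b :: int
  shows
  "m + m' = i + j \<Longrightarrow> Eqn [(1, (m, k, l, n, r, t))] (m', k', l', n', r', t') (i, k, l, n, r, t) (j, k', l', n', r', t') \<in> equations"
  "k + l' = a + b \<Longrightarrow> Eqn [(1, (m, k, l, n, r, t))] (m', k', l', n', r', t') (m, a, l, n, r, t) (m', k', b, n', r', t') \<in> equations"
  "l + k' = a + b \<Longrightarrow> Eqn [(1, (m, k, l, n, r, t))] (m', k', l', n', r', t') (m, k, a, n, r, t) (m', b, l', n', r', t') \<in> equations"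
  "n + n' = i + j \<Longrightarrow> Eqn [(1, (m, k, l, n, r, t))] (m', k', l', n', r', t') (m, k, l, i, r, t) (m', k', l', j, r', t') \<in> equations"
  "r + t' = a + b \<Longrightarrow> Eqn [(1, (m, k, l, n, r, t))] (m', k', l', n', r', t') (m, k, l, n, a, t) (m', k', l', n', r', b) \<in> equations"
  "t + r' = a + b \<Longrightarrow> Eqn [(1, (m, k, l, n, r, t))] (m', k', l', n', r', t') (m, k, l, n, r, a) (m', k', l', n', b, t') \<in> equations"
  subgoal unfolding equations_def E5_def by blast
  subgoal unfolding equations_def E6_def by blast
  subgoal unfolding equations_def E7_def by blast
  subgoal unfolding equations_def E8_def by blast
  subgoal unfolding equations_def E9_def by blast
  subgoal unfolding equations_def E10_def by blast
  done

context moment_algorithm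
begin

text \<open>Equations whose vectors all have indices in \<open>Omega0\<close> enter no
  \<open>L_eqs w q\<close>; they are exactly the ones checked at step 0.\<close>

lemma all_equations:
  assumes step0: "step0_condition h w" and v: "\<And>p. 1 \<le> p \<Longrightarrow> admissible v p" and E: "E \<in> equations"
  shows "eqn_holds (gram v) E"
proof (cases "involved E \<subseteq> Omega0")
  case True
  then have "eqn_holds (\<lambda>I J. cinner (family_of h w (\<lambda>_. 0) I) (family_of h w (\<lambda>_. 0) J)) E"
    using step0 E by (simp add: step0_condition_def)
  moreover have "family_of h w (\<lambda>_. 0) I = family_of h w v I" if "I \<in> involved E" for I
    using that True by (intro family_of_cong[of I 0]) (auto simp: stage_def)
  ultimately show ?thesis
    using eqn_holds_cong[of E "\<lambda>I J. cinner (family_of h w (\<lambda>_. 0) I) (family_of h w (\<lambda>_. 0) J)" "gram v"]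
    by (simp add: gram_def)
next
  case False
  define Q where "Q = {q. 1 \<le> q \<and> w q \<in> involved E}"
  have "finite Q"
  proof (rule finite_imageD)
    show "finite (w ` Q)" by (rule finite_subset[OF _ finite_involved[of E]]) (auto simp: Q_def)
    show "inj_on w Q" by (rule inj_on_subset[OF bij_betw_imp_inj_on[OF w]]) (auto simp: Q_def)
  qed
  moreover have "Q \<noteq> {}"
  proof -
    obtain I where I: "I \<in> involved E" "I \<notin> Omega0" using False by blast
    then show ?thesis by (cases I rule: Omega_cases) (auto simp: Q_def Omega0_def)
  qed
  ultimately have q: "Max Q \<in> Q" "\<And>p. p \<in> Q \<Longrightarrow> p \<le> Max Q" by auto
  have "involved E \<subseteq> stage (Max Q)"
  proof
    fix I assume I: "I \<in> involved E"
    show "I \<in> stage (Max Q)"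
    proof (cases I rule: Omega_cases)
      case (1 m n)
      then show ?thesis by (simp add: stage_def Omega0_def)
    next
      case (2 p)
      then have "p \<in> Q" using I by (simp add: Q_def)
      then show ?thesis using 2 q(2) by (auto simp: stage_def)
    qed
  qed
  then have "E \<in> L_eqs w (Max Q)" using E q(1) by (simp add: L_eqs_iff Q_def)
  then show ?thesis using v[of "Max Q"] q(1) by (simp add: admissible_def Q_def)
qed

lemma equations_imply:
  assumes "\<And>E. E \<in> equations \<Longrightarrow> eqn_holds (gram v) E"
  defines "f \<equiv> family_of h w v"
  shows "f (m + 1, k, l, n, r, t) + \<i> *\<^sub>C f (m, k, l, n, r, t) = f (m, k + 1, l, n, r, t)"
    and "f (m + 1, k, l, n, r, t) - \<i> *\<^sub>C f (m, k, l, n, r, t) = f (m, k, l + 1, n, r, t)"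
    and "f (m, k, l, n + 1, r, t) + \<i> *\<^sub>C f (m, k, l, n, r, t) = f (m, k, l, n, r + 1, t)"
    and "f (m, k, l, n + 1, r, t) - \<i> *\<^sub>C f (m, k, l, n, r, t) = f (m, k, l, n, r, t + 1)"
    and "represents f (\<lambda>I. cinner (f I) (f (0, 0, 0, 0, 0, 0)))"
proof -
  have gram: "gram v I J = cinner (f I) (f J)" for I J by (simp add: gram_def f_def)
  have minus: "x - \<i> *\<^sub>C y = x + (- \<i>) *\<^sub>C y" for x y :: 'h
    by (simp add: complex_vector.scale_minus_left)
  show "f (m + 1, k, l, n, r, t) + \<i> *\<^sub>C f (m, k, l, n, r, t) = f (m, k + 1, l, n, r, t)"
  proof (rule inner_determined[where f = f and A = "(m + 1, k, l, n, r, t)" and B = "(m, k, l, n, r, t)" and C = "(m, k + 1, l, n, r, t)" and c = "\<i>"])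
    fix J
    have "Eqn [(1, (m + 1, k, l, n, r, t)), (\<i>, (m, k, l, n, r, t))] J (m, k + 1, l, n, r, t) J \<in> equations"
      unfolding equations_def E1_def by blast
    from assms(1)[OF this] show "cinner (f (m + 1, k, l, n, r, t)) (f J) + \<i> * cinner (f (m, k, l, n, r, t)) (f J) =
        cinner (f (m, k + 1, l, n, r, t)) (f J)" by (simp add: gram)
  qed
  show "f (m + 1, k, l, n, r, t) - \<i> *\<^sub>C f (m, k, l, n, r, t) = f (m, k, l + 1, n, r, t)"
    unfolding minus
  proof (rule inner_determined[where f = f and A = "(m + 1, k, l, n, r, t)" and B = "(m, k, l, n, r, t)" and C = "(m, k, l + 1, n, r, t)" and c = "- \<i>"])
    fix J
    have "Eqn [(1, (m + 1, k, l, n, r, t)), (- \<i>, (m, k, l, n, r, t))] J (m, k, l + 1, n, r, t) J \<in> equations"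
      unfolding equations_def E2_def by blast
    from assms(1)[OF this] show "cinner (f (m + 1, k, l, n, r, t)) (f J) + - \<i> * cinner (f (m, k, l, n, r, t)) (f J) =
        cinner (f (m, k, l + 1, n, r, t)) (f J)" by (simp add: gram)
  qed
  show "f (m, k, l, n + 1, r, t) + \<i> *\<^sub>C f (m, k, l, n, r, t) = f (m, k, l, n, r + 1, t)"
  proof (rule inner_determined[where f = f and A = "(m, k, l, n + 1, r, t)" and B = "(m, k, l, n, r, t)" and C = "(m, k, l, n, r + 1, t)" and c = "\<i>"])
    fix J
    have "Eqn [(1, (m, k, l, n + 1, r, t)), (\<i>, (m, k, l, n, r, t))] J (m, k, l, n, r + 1, t) J \<in> equations"
      unfolding equations_def E3_def by blast
    from assms(1)[OF this] show "cinner (f (m, k, l, n + 1, r, t)) (f J) + \<i> * cinner (f (m, k, l, n, r, t)) (f J) =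
        cinner (f (m, k, l, n, r + 1, t)) (f J)" by (simp add: gram)
  qed
  show "f (m, k, l, n + 1, r, t) - \<i> *\<^sub>C f (m, k, l, n, r, t) = f (m, k, l, n, r, t + 1)"
    unfolding minus
  proof (rule inner_determined[where f = f and A = "(m, k, l, n + 1, r, t)" and B = "(m, k, l, n, r, t)" and C = "(m, k, l, n, r, t + 1)" and c = "- \<i>"])
    fix J
    have "Eqn [(1, (m, k, l, n + 1, r, t)), (- \<i>, (m, k, l, n, r, t))] J (m, k, l, n, r, t + 1) J \<in> equations"
      unfolding equations_def E4_def by blast
    from assms(1)[OF this] show "cinner (f (m, k, l, n + 1, r, t)) (f J) + - \<i> * cinner (f (m, k, l, n, r, t)) (f J) =
        cinner (f (m, k, l, n, r, t + 1)) (f J)" by (simp add: gram)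
  qed
  have shift: "cinner (f I) (f J) = cinner (f I') (f J')" if "Eqn [(1, I)] J I' J' \<in> equations" for I J I' J'
    using assms(1)[OF that] by (simp add: gram)
  show "represents f (\<lambda>I. cinner (f I) (f (0, 0, 0, 0, 0, 0)))"
    unfolding represents_def
  proof (intro allI)
    fix m k l n r t m' k' l' n' r' t'
    \<comment> \<open>Each of the shifts (E5)-(E10) moves one exponent of the second index over to
      the first, until the second index is zero. So \<phi> can be the product with the vector of
      index zero.\<close>
    have "cinner (f (m, k, l, n, r, t)) (f (m', k', l', n', r', t')) = cinner (f (m + m', k, l, n, r, t)) (f (0, k', l', n', r', t'))"
      by (rule shift, rule equations_shift(1)) simp
    also have "\<dots> = cinner (f (m + m', k + l', l, n, r, t)) (f (0, k', 0, n', r', t'))"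
      by (rule shift, rule equations_shift(2)) simp
    also have "\<dots> = cinner (f (m + m', k + l', l + k', n, r, t)) (f (0, 0, 0, n', r', t'))"
      by (rule shift, rule equations_shift(3)) simp
    also have "\<dots> = cinner (f (m + m', k + l', l + k', n + n', r, t)) (f (0, 0, 0, 0, r', t'))"
      by (rule shift, rule equations_shift(4)) simp
    also have "\<dots> = cinner (f (m + m', k + l', l + k', n + n', r + t', t)) (f (0, 0, 0, 0, r', 0))"
      by (rule shift, rule equations_shift(5)) simp
    also have "\<dots> = cinner (f (m + m', k + l', l + k', n + n', r + t', t + r')) (f (0, 0, 0, 0, 0, 0))"
      by (rule shift, rule equations_shift(6)) simp
    finally show "cinner (f (m, k, l, n, r, t)) (f (m', k', l', n', r', t')) =
      cinner (f (m + m', k + l', l + k', n + n', r + t', t + r')) (f (0, 0, 0, 0, 0, 0))" .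
  qed
qed

lemma bold_G_sound:
  assumes step0: "step0_condition h w" and v: "v \<in> bold_G h e w g N M"
  shows "family_of h w v \<in> X_set h e w"
    and "represents (family_of h w v) \<phi> \<Longrightarrow> \<exists>\<mu>. extended_moment_solution \<phi> \<mu>"
    and "\<exists>\<phi>. represents (family_of h w v) \<phi>"
    and "represents (family_of h w v) \<phi> \<Longrightarrow> \<phi> (m, 0, 0, n, 0, 0) = s m n"
proof -
  have adm: "admissible v p" if "1 \<le> p" for p using v that by (simp add: bold_G_iff)
  have all: "eqn_holds (gram v) E" if "E \<in> equations" for E
    by (rule all_equations[OF step0 adm that])
  note eqs = equations_imply[of v, OF all]
  show rep: "\<exists>\<phi>. represents (family_of h w v) \<phi>" using eqs(5) by blast
  \<comment> \<open>Taking all positive integers for \<Lambda> turns the condition into membership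
    of \<open>v q\<close> in \<open>level q\<close>.\<close>
  have "\<exists>\<Lambda>\<subseteq>{1..}. \<forall>q\<ge>1. v q \<in> {x + y | x y. x \<in> H0 h \<and> y \<in> cspan (e ` {j \<in> \<Lambda>. j \<le> q})} \<and>
      cinner (v q) (e q) \<in> \<real>\<^sub>\<ge>\<^sub>0"
  proof (intro exI[of _ "{1..}"] conjI allI impI subset_refl)
    fix q :: nat assume q: "1 \<le> q"
    have "(\<Sum>j\<in>{1..q}. cinner (v q) (e j) *\<^sub>C e j) \<in> cspan (e ` {j \<in> {1..}. j \<le> q})"
      by (intro complex_vector.span_sum complex_vector.span_scale complex_vector.span_base) auto
    moreover have "v q = res q (v q) + (\<Sum>j\<in>{1..q}. cinner (v q) (e j) *\<^sub>C e j)" by (simp add: res_def)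
    moreover have "res q (v q) \<in> H0 h" using adm[OF q] by (simp add: admissible_def level_def)
    ultimately show "v q \<in> {x + y | x y. x \<in> H0 h \<and> y \<in> cspan (e ` {j \<in> {1..}. j \<le> q})}" by blast
    show "cinner (v q) (e q) \<in> \<real>\<^sub>\<ge>\<^sub>0" using adm[OF q] by (simp add: admissible_def)
  qed
  then show "family_of h w v \<in> X_set h e w"
    unfolding X_set_def using eqs(1-4) rep by simp
  show "\<exists>\<mu>. extended_moment_solution \<phi> \<mu>" if "represents (family_of h w v) \<phi>"
    by (rule extended_solution_exists[OF that eqs(1-4)]) (assumption+, rule exI)
  show "\<phi> (m, 0, 0, n, 0, 0) = s m n" if "represents (family_of h w v) \<phi>"
  proof -
    have "\<phi> (m + 0, 0 + 0, 0 + 0, n + 0, 0 + 0, 0 + 0) = cinner (h m n) (h 0 0)"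
      using that unfolding represents_def by (metis family_of_Omega0)
    then show ?thesis by (simp add: cinner_h)
  qed
qed

end

section \<open>From a solution to the algorithm\<close>

locale moment_algorithm_solution = moment_algorithm +
  fixes \<mu> :: "(real \<times> real) measure"
  assumes sol: "moment_solution s \<mu>"
begin

definition ext_moment :: "idx \<Rightarrow> complex" where
  "ext_moment I = (\<integral>x. ext_monomial I x \<partial>\<mu>)"

text \<open>The Gram matrix of the extended monomials in L^2(\<mu>), which the vectors in the model
  space have to reproduce.\<close>

definition kernel :: "idx \<Rightarrow> idx \<Rightarrow> complex" where
  "kernel I J = ext_moment (idx_join I J)"

lemma has_integral_ext: "has_bochner_integral \<mu> (ext_monomial I) (ext_moment I)"
  using integrable_ext_monomial[OF sol] by (simp add: has_bochner_integral_iff ext_moment_def)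

lemma ext_moment_solution: "extended_moment_solution ext_moment \<mu>"
  using sol has_integral_ext by (simp add: extended_moment_solution_iff moment_solution_def)

lemma has_integral_kernel: "has_bochner_integral \<mu> (\<lambda>x. ext_monomial I x * cnj (ext_monomial J x)) (kernel I J)"
  unfolding ext_monomial_join kernel_def by (rule has_integral_ext)

lemma ext_moment_rel:
  "ext_moment (m + 1, k, l, n, r, t) + \<i> * ext_moment (m, k, l, n, r, t) = ext_moment (m, k + 1, l, n, r, t)"
  "ext_moment (m + 1, k, l, n, r, t) + - \<i> * ext_moment (m, k, l, n, r, t) = ext_moment (m, k, l + 1, n, r, t)"
  "ext_moment (m, k, l, n + 1, r, t) + \<i> * ext_moment (m, k, l, n, r, t) = ext_moment (m, k, l, n, r + 1, t)"
  "ext_moment (m, k, l, n + 1, r, t) + - \<i> * ext_moment (m, k, l, n, r, t) = ext_moment (m, k, l, n, r, t + 1)"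
proof -
  have lin: "ext_moment A + c * ext_moment B = ext_moment C"
    if "\<And>x. ext_monomial A x + c * ext_monomial B x = ext_monomial C x" for A B C c
  proof -
    have "has_bochner_integral \<mu> (\<lambda>x. ext_monomial A x + c * ext_monomial B x) (ext_moment A + c * ext_moment B)"
      by (intro has_bochner_integral_add has_bochner_integral_mult_right has_integral_ext)
    then have "has_bochner_integral \<mu> (ext_monomial C) (ext_moment A + c * ext_moment B)" by (simp only: that)
    then show ?thesis using has_integral_ext by (rule has_bochner_integral_eq)
  qed
  note rel = ext_monomial_relations[unfolded diff_conv_add_uminus mult_minus_left[symmetric]]
  show "ext_moment (m + 1, k, l, n, r, t) + \<i> * ext_moment (m, k, l, n, r, t) = ext_moment (m, k + 1, l, n, r, t)"
    by (rule lin[OF rel(1)])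
  show "ext_moment (m + 1, k, l, n, r, t) + - \<i> * ext_moment (m, k, l, n, r, t) = ext_moment (m, k, l + 1, n, r, t)"
    by (rule lin[OF rel(2)])
  show "ext_moment (m, k, l, n + 1, r, t) + \<i> * ext_moment (m, k, l, n, r, t) = ext_moment (m, k, l, n, r + 1, t)"
    by (rule lin[OF rel(3)])
  show "ext_moment (m, k, l, n + 1, r, t) + - \<i> * ext_moment (m, k, l, n, r, t) = ext_moment (m, k, l, n, r, t + 1)"
    by (rule lin[OF rel(4)])
qed

lemma kernel_equations:
  assumes "E \<in> equations"
  shows "eqn_holds kernel E"
proof -
  have shift: "kernel (m + 1, k, l, n, r, t) J + \<i> * kernel (m, k, l, n, r, t) J = kernel (m, k + 1, l, n, r, t) J"
    "kernel (m + 1, k, l, n, r, t) J + - \<i> * kernel (m, k, l, n, r, t) J = kernel (m, k, l + 1, n, r, t) J"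
    "kernel (m, k, l, n + 1, r, t) J + \<i> * kernel (m, k, l, n, r, t) J = kernel (m, k, l, n, r + 1, t) J"
    "kernel (m, k, l, n + 1, r, t) J + - \<i> * kernel (m, k, l, n, r, t) J = kernel (m, k, l, n, r, t + 1) J" for m k l n r t J
  proof -
    obtain m' k' l' n' r' t' where J: "J = (m', k', l', n', r', t')" by (rule prod_cases6)
    note rel = ext_moment_rel[of "m + m'" "k + l'" "l + k'" "n + n'" "r + t'" "t + r'"]
    have comm: "m + 1 + m' = m + m' + 1" "k + 1 + l' = k + l' + 1" "l + 1 + k' = l + k' + 1"
      "n + 1 + n' = n + n' + 1" "r + 1 + t' = r + t' + 1" "t + 1 + r' = t + r' + 1" by simp_all
    show "kernel (m + 1, k, l, n, r, t) J + \<i> * kernel (m, k, l, n, r, t) J = kernel (m, k + 1, l, n, r, t) J"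
      unfolding J kernel_def idx_join.simps comm by (rule rel(1))
    show "kernel (m + 1, k, l, n, r, t) J + - \<i> * kernel (m, k, l, n, r, t) J = kernel (m, k, l + 1, n, r, t) J"
      unfolding J kernel_def idx_join.simps comm by (rule rel(2))
    show "kernel (m, k, l, n + 1, r, t) J + \<i> * kernel (m, k, l, n, r, t) J = kernel (m, k, l, n, r + 1, t) J"
      unfolding J kernel_def idx_join.simps comm by (rule rel(3))
    show "kernel (m, k, l, n + 1, r, t) J + - \<i> * kernel (m, k, l, n, r, t) J = kernel (m, k, l, n, r, t + 1) J"
      unfolding J kernel_def idx_join.simps comm by (rule rel(4))
  qed
  from assms consider "E \<in> E1" | "E \<in> E2" | "E \<in> E3" | "E \<in> E4" | "E \<in> E5" | "E \<in> E6" | "E \<in> E7" | "E \<in> E8" | "E \<in> E9" | "E \<in> E10"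
    unfolding equations_def by blast
  then show ?thesis
  proof cases
    case 1 then show ?thesis unfolding E1_def using shift(1) by (clarsimp simp del: One_nat_def)
  next
    case 2 then show ?thesis unfolding E2_def using shift(2) by (clarsimp simp del: One_nat_def)
  next
    case 3 then show ?thesis unfolding E3_def using shift(3) by (clarsimp simp del: One_nat_def)
  next
    case 4 then show ?thesis unfolding E4_def using shift(4) by (clarsimp simp del: One_nat_def)
  next
    case 5 then show ?thesis unfolding E5_def by (clarsimp simp: kernel_def)
  next
    case 6 then show ?thesis unfolding E6_def by (clarsimp simp: kernel_def)
  next
    case 7 then show ?thesis unfolding E7_def by (clarsimp simp: kernel_def)
  next
    case 8 then show ?thesis unfolding E8_def by (clarsimp simp: kernel_def)
  next
    case 9 then show ?thesis unfolding E9_def by (clarsimp simp: kernel_def)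
  next
    case 10 then show ?thesis unfolding E10_def by (clarsimp simp: kernel_def)
  qed
qed

lemma kernel_commute: "kernel J I = cnj (kernel I J)"
proof -
  have "has_bochner_integral \<mu> (\<lambda>x. cnj (ext_monomial I x * cnj (ext_monomial J x))) (cnj (kernel I J))"
    by (rule has_bochner_integral_cnj[OF has_integral_kernel])
  then have "has_bochner_integral \<mu> (\<lambda>x. ext_monomial J x * cnj (ext_monomial I x)) (cnj (kernel I J))"
    by (simp add: mult.commute)
  with has_integral_kernel show ?thesis by (rule has_bochner_integral_eq)
qed

lemma kernel_self: "kernel I I = of_real (Re (kernel I I))"
  using kernel_commute[of I I] by (simp add: complex_eq_iff)

text \<open>On the diagonal the crosswise addition gives x + i and x - i the same exponent k + l, so
  they multiply to a power of x^2 + 1. The entry is precisely the integral that M bounds.\<close>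

lemma kernel_w_le: "1 \<le> q \<Longrightarrow> Re (kernel (w q) (w q)) \<le> M q"
proof -
  assume q: "1 \<le> q"
  obtain m k l n r t where I: "w q = (m, k, l, n, r, t)" by (rule prod_cases6)
  let ?F = "\<lambda>(x1, x2). x1 ^ (2 * m) * (x1\<^sup>2 + 1) powi (k + l) * x2 ^ (2 * n) * (x2\<^sup>2 + 1) powi (r + t)"
  have factor: "(of_real y + \<i>) powi a * (of_real y - \<i>) powi a = complex_of_real ((y\<^sup>2 + 1) powi a)" for y :: real and a
    unfolding of_real_power_int of_real_plus_times_minus[symmetric] by (rule power_int_mult_distrib[symmetric])
  have "ext_monomial (idx_join (w q) (w q)) x = complex_of_real (?F x)" for x
  proof -
    have "ext_monomial (idx_join (w q) (w q)) x = complex_of_real (fst x) ^ (m + m) *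
      ((of_real (fst x) + \<i>) powi (k + l) * (of_real (fst x) - \<i>) powi (k + l)) * of_real (snd x) ^ (n + n) *
      ((of_real (snd x) + \<i>) powi (r + t) * (of_real (snd x) - \<i>) powi (r + t))"
      unfolding I idx_join.simps ext_monomial_eq by (simp only: add.commute[of l k] add.commute[of t r] mult.assoc)
    then show ?thesis
      unfolding factor by (simp add: case_prod_beta mult_2)
  qed
  then have "kernel (w q) (w q) = (\<integral>x. complex_of_real (?F x) \<partial>\<mu>)" by (simp only: kernel_def ext_moment_def)
  then have "Re (kernel (w q) (w q)) = (\<integral>x. ?F x \<partial>\<mu>)" by simp
  also have "\<dots> \<le> M q"
    using bounds[unfolded bounding_constants_def, THEN spec, THEN mp, OF q, THEN conjunct2, THEN spec, THEN mp, OF sol]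
    by (simp only: I prod.case)
  finally show ?thesis .
qed

lemma kernel_Omega0: "kernel (m, 0, 0, n, 0, 0) (m', 0, 0, n', 0, 0) = s (m + m') (n + n')"
proof -
  have eq: "ext_monomial (a, 0, 0, b, 0, 0) = (\<lambda>(x1, x2). complex_of_real (x1 ^ a * x2 ^ b))" for a b
    by auto
  have "has_bochner_integral \<mu> (ext_monomial (m + m', 0, 0, n + n', 0, 0)) (s (m + m') (n + n'))"
    using sol unfolding eq moment_solution_def by blast
  with has_integral_ext have "ext_moment (m + m', 0, 0, n + n', 0, 0) = s (m + m') (n + n')"
    by (rule has_bochner_integral_eq)
  then show ?thesis by (simp add: kernel_def)
qed

lemma step0: "step0_condition h w"
  unfolding step0_condition_def
proof (intro ballI impI)
  fix E assume E: "E \<in> equations" "involved E \<subseteq> Omega0"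
  have "cinner (family_of h w (\<lambda>_. 0) I) (family_of h w (\<lambda>_. 0) J) = kernel I J"
    if "I \<in> Omega0" "J \<in> Omega0" for I J
    using that by (auto simp: Omega0_def cinner_h kernel_Omega0)
  then have "eqn_holds (\<lambda>I J. cinner (family_of h w (\<lambda>_. 0) I) (family_of h w (\<lambda>_. 0) J)) E \<longleftrightarrow> eqn_holds kernel E"
    using E(2) by (intro eqn_holds_cong) blast
  then show "eqn_holds (\<lambda>I J. cinner (family_of h w (\<lambda>_. 0) I) (family_of h w (\<lambda>_. 0) J)) E"
    using kernel_equations[OF E(1)] by blast
qed

text \<open>The value is the squared L^2(\<mu>) distance between a combination of monomials and the
  monomial with index \<open>u\<close>. It supplies the lower bound required by
  \<open>riesz_representation_graph\<close>, without setting up the space L^2(\<mu>).\<close>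

lemma kernel_distance_nonneg:
  assumes "finite B"
  shows "0 \<le> Re (\<Sum>I\<in>B. \<Sum>J\<in>B. c I * cnj (c J) * kernel I J) - 2 * Re (\<Sum>I\<in>B. c I * kernel I u) + Re (kernel u u)"
proof -
  define p where "p x = (\<Sum>I\<in>B. c I * ext_monomial I x)" for x
  let ?S = "\<Sum>I\<in>B. \<Sum>J\<in>B. c I * cnj (c J) * kernel I J" and ?T = "\<Sum>I\<in>B. c I * kernel I u"
  have pu: "has_bochner_integral \<mu> (\<lambda>x. p x * cnj (ext_monomial u x)) ?T"
  proof -
    have "has_bochner_integral \<mu> (\<lambda>x. \<Sum>I\<in>B. c I * (ext_monomial I x * cnj (ext_monomial u x))) ?T"
      by (intro has_bochner_integral_sum has_bochner_integral_mult_right has_integral_kernel)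
    then show ?thesis by (simp add: p_def sum_distrib_right mult.assoc)
  qed
  have pp: "has_bochner_integral \<mu> (\<lambda>x. p x * cnj (p x)) ?S"
  proof -
    have "has_bochner_integral \<mu> (\<lambda>x. \<Sum>I\<in>B. \<Sum>J\<in>B. c I * cnj (c J) * (ext_monomial I x * cnj (ext_monomial J x))) ?S"
      by (intro has_bochner_integral_sum has_bochner_integral_mult_right has_integral_kernel)
    then show ?thesis by (simp add: p_def sum_product cnj_sum mult_ac)
  qed
  have up: "has_bochner_integral \<mu> (\<lambda>x. cnj (p x * cnj (ext_monomial u x))) (cnj ?T)"
    by (rule has_bochner_integral_cnj[OF pu])
  have "has_bochner_integral \<mu> (\<lambda>x. p x * cnj (p x) - p x * cnj (ext_monomial u x) - cnj (p x * cnj (ext_monomial u x))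
      + ext_monomial u x * cnj (ext_monomial u x)) (?S - ?T - cnj ?T + kernel u u)"
    by (intro has_bochner_integral_add has_bochner_integral_diff pp pu up has_integral_kernel)
  also have "(\<lambda>x. p x * cnj (p x) - p x * cnj (ext_monomial u x) - cnj (p x * cnj (ext_monomial u x))
      + ext_monomial u x * cnj (ext_monomial u x)) = (\<lambda>x. complex_of_real ((cmod (p x - ext_monomial u x))\<^sup>2))"
    unfolding complex_norm_square by (rule ext) (simp add: algebra_simps)
  finally have "has_bochner_integral \<mu> (\<lambda>x. complex_of_real ((cmod (p x - ext_monomial u x))\<^sup>2)) (?S - ?T - cnj ?T + kernel u u)" .
  then have "?S - ?T - cnj ?T + kernel u u = (\<integral>x. complex_of_real ((cmod (p x - ext_monomial u x))\<^sup>2) \<partial>\<mu>)"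
    by (simp only: has_bochner_integral_iff)
  then have "Re (?S - ?T - cnj ?T + kernel u u) = (\<integral>x. (cmod (p x - ext_monomial u x))\<^sup>2 \<partial>\<mu>)"
    by (simp only: integral_complex_of_real Re_complex_of_real)
  moreover have "0 \<le> (\<integral>x. (cmod (p x - ext_monomial u x))\<^sup>2 \<partial>\<mu>)" by simp
  ultimately show ?thesis by simp
qed

text \<open>The induction carries the whole Gram matrix on \<open>stage p\<close> rather than the
  validity of the equations: only prescribed products make the next functional bounded.\<close>

definition partial_family :: "nat \<Rightarrow> (nat \<Rightarrow> 'a) \<Rightarrow> bool" where
  "partial_family p v \<longleftrightarrow> (\<forall>r\<in>{1..p}. v r \<in> level r \<and> cinner (v r) (e r) \<in> \<real>\<^sub>\<ge>\<^sub>0) \<and>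
    (\<forall>I\<in>stage p. \<forall>J\<in>stage p. gram v I J = kernel I J)"

lemma partial_family_0: "partial_family 0 v"
  by (auto simp: partial_family_def stage_def gram_def Omega0_def cinner_h kernel_Omega0)

lemma extend_partial_family:
  assumes v: "partial_family p v"
  obtains z where "partial_family (Suc p) (v(Suc p := z))"
proof -
  define u where "u = w (Suc p)"
  let ?f = "family_of h w v"
  \<comment> \<open>The functional that sends the vector of index I to \<open>kernel I u\<close>. As
    the vectors may be linearly dependent, it is given by its graph, with all finite combinations as
    representations.\<close>
  let ?Gr = "{(\<Sum>I\<in>B. c I *\<^sub>C ?f I, \<Sum>I\<in>B. c I * kernel I u) | B c. finite B \<and> B \<subseteq> stage p}"
  \<comment> \<open>Padding with zero coefficients brings two combinations to a common index set,
    where they can be added.\<close>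
  have extend_sum: "(\<Sum>I\<in>B. c I *\<^sub>C ?f I) = (\<Sum>I\<in>B'. (if I \<in> B then c I else 0) *\<^sub>C ?f I)"
    "(\<Sum>I\<in>B. c I * kernel I u) = (\<Sum>I\<in>B'. (if I \<in> B then c I else 0) * kernel I u)"
    if "finite B'" "B \<subseteq> B'" for B B' c
    using that by (auto intro!: sum.mono_neutral_cong_left)
  obtain y where y: "y \<in> closure (fst ` ?Gr)" "\<And>x a. (x, a) \<in> ?Gr \<Longrightarrow> cinner x y = a" "(norm y)\<^sup>2 \<le> Re (kernel u u)"
  proof (rule riesz_representation_graph[of ?Gr "Re (kernel u u)"])
    show "(0, 0) \<in> ?Gr" by (rule CollectI, intro exI[of _ "{}"]) simp
  next
    fix x a y b assume "(x, a) \<in> ?Gr" "(y, b) \<in> ?Gr"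
    then obtain B c B' c' where B: "finite B" "B \<subseteq> stage p" "x = (\<Sum>I\<in>B. c I *\<^sub>C ?f I)" "a = (\<Sum>I\<in>B. c I * kernel I u)"
      and B': "finite B'" "B' \<subseteq> stage p" "y = (\<Sum>I\<in>B'. c' I *\<^sub>C ?f I)" "b = (\<Sum>I\<in>B'. c' I * kernel I u)"
      by blast
    let ?c = "\<lambda>I. (if I \<in> B then c I else 0) + (if I \<in> B' then c' I else 0)"
    have fin: "finite (B \<union> B')" using B B' by simp
    have "x + y = (\<Sum>I\<in>B \<union> B'. ?c I *\<^sub>C ?f I)" "a + b = (\<Sum>I\<in>B \<union> B'. ?c I * kernel I u)"
      unfolding B(3,4) B'(3,4) extend_sum[OF fin Un_upper1] extend_sum[OF fin Un_upper2]
      by (simp_all only: scaleC_add_left distrib_right sum.distrib)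
    then show "(x + y, a + b) \<in> ?Gr"
      using B(2) B'(2) fin by (intro CollectI exI[of _ "B \<union> B'"] exI[of _ ?c] conjI) simp_all
  next
    fix c' x a assume "(x, a) \<in> ?Gr"
    then obtain B c where B: "finite B" "B \<subseteq> stage p" "x = (\<Sum>I\<in>B. c I *\<^sub>C ?f I)" "a = (\<Sum>I\<in>B. c I * kernel I u)"
      by blast
    have "c' *\<^sub>C x = (\<Sum>I\<in>B. (c' * c I) *\<^sub>C ?f I)" "c' * a = (\<Sum>I\<in>B. (c' * c I) * kernel I u)"
      unfolding B(3,4) by (simp_all add: complex_vector.scale_sum_right scaleC_scaleC sum_distrib_left mult.assoc)
    then show "(c' *\<^sub>C x, c' * a) \<in> ?Gr" using B(1,2) by (intro CollectI exI conjI) auto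
  next
    fix x a assume "(x, a) \<in> ?Gr"
    then obtain B c where B: "finite B" "B \<subseteq> stage p" "x = (\<Sum>I\<in>B. c I *\<^sub>C ?f I)" "a = (\<Sum>I\<in>B. c I * kernel I u)"
      by blast
    have "complex_of_real ((norm x)\<^sup>2) = (\<Sum>I\<in>B. \<Sum>J\<in>B. c I * cnj (c J) * gram v I J)"
      unfolding cinner_self[symmetric] B(3) cinner.sum_left cinner.sum_right
      by (subst sum.swap) (simp add: cinner_scaleC_left cinner_scaleC_right gram_def mult_ac)
    also have "\<dots> = (\<Sum>I\<in>B. \<Sum>J\<in>B. c I * cnj (c J) * kernel I J)"
    proof (intro sum.cong refl)
      fix I J assume "I \<in> B" "J \<in> B"
      then have "gram v I J = kernel I J" using v B(2) unfolding partial_family_def by blast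
      then show "c I * cnj (c J) * gram v I J = c I * cnj (c J) * kernel I J" by simp
    qed
    finally have "(norm x)\<^sup>2 = Re (\<Sum>I\<in>B. \<Sum>J\<in>B. c I * cnj (c J) * kernel I J)"
      by (metis Re_complex_of_real)
    then show "0 \<le> (norm x)\<^sup>2 - 2 * Re a + Re (kernel u u)"
      unfolding B(4) using kernel_distance_nonneg[OF B(1), of c u] by simp
  qed blast
  have f_level: "?f I \<in> level p" if "I \<in> stage p" for I
    using that v by (intro family_of_level) (auto simp: partial_family_def)
  have "y \<in> level p"
  proof -
    have "fst ` ?Gr \<subseteq> level p"
    proof clarsimp
      fix B and c :: "idx \<Rightarrow> complex" assume "B \<subseteq> stage p"
      then show "(\<Sum>I\<in>B. c I *\<^sub>C ?f I) \<in> level p" by (intro level_sum level_scale f_level) blast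
    qed
    then have "closure (fst ` ?Gr) \<subseteq> level p" by (intro closure_minimal closed_level)
    then show ?thesis using y(1) by blast
  qed
  have f_y: "cinner (?f I) y = kernel I u" if "I \<in> stage p" for I
  proof (rule y(2))
    show "(?f I, kernel I u) \<in> ?Gr"
      using that by (intro CollectI exI[of _ "{I}"] exI[of _ "\<lambda>_. 1"]) (simp add: scaleC_one)
  qed
  \<comment> \<open>The norm bound for \<open>y\<close> makes the radicand non-negative; adding this
    multiple of the new unit vector corrects the diagonal entry and leaves all other products
    unchanged.\<close>
  define c where "c = sqrt (Re (kernel u u) - (norm y)\<^sup>2)"
  have c: "0 \<le> c" "c\<^sup>2 = Re (kernel u u) - (norm y)\<^sup>2" using y(3) by (simp_all add: c_def)
  define z where "z = y + of_real c *\<^sub>C e (Suc p)"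
  let ?v = "v(Suc p := z)"
  have f_u: "family_of h w ?v u = z" by (simp add: u_def)
  have f_old: "family_of h w ?v I = ?f I" if "I \<in> stage p" for I
    using that by (rule family_of_cong) auto
  have gram_u: "gram ?v I u = kernel I u" if "I \<in> stage p" for I
    unfolding gram_def f_u f_old[OF that] unfolding z_def cinner_add_right cinner_scaleC_right
    using f_y[OF that] level_orthogonal[OF f_level[OF that], of "Suc p"] by simp
  have "partial_family (Suc p) ?v"
    unfolding partial_family_def
  proof (intro conjI ballI)
    fix r assume r: "r \<in> {1..Suc p}"
    have "z \<in> level (Suc p)"
      unfolding z_def using level_mono[OF _ \<open>y \<in> level p\<close>, of "Suc p"] by (intro level_add level_scale e_level) auto
    moreover have "cinner z (e (Suc p)) \<in> \<real>\<^sub>\<ge>\<^sub>0"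
      unfolding z_def cinner_Suc_decomposition[OF \<open>y \<in> level p\<close>] using c(1) by simp
    ultimately show "?v r \<in> level r" "cinner (?v r) (e r) \<in> \<real>\<^sub>\<ge>\<^sub>0"
      using r v by (auto simp: partial_family_def le_Suc_eq)
  next
    fix I J assume IJ: "I \<in> stage (Suc p)" "J \<in> stage (Suc p)"
    have "gram ?v u u = of_real ((norm y)\<^sup>2 + c\<^sup>2)"
      unfolding gram_def f_u cinner_self unfolding z_def norm_Suc_decomposition[OF \<open>y \<in> level p\<close>] ..
    then have uu: "gram ?v u u = kernel u u" using c(2) kernel_self[of u] by simp
    have uI: "gram ?v u I = kernel u I" if "I \<in> stage p" for I
      using gram_u[OF that] kernel_commute[of u I] cinner_commute[of "family_of h w ?v u" "family_of h w ?v I"]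
      by (simp add: gram_def)
    have old: "gram ?v I J = kernel I J" if "I \<in> stage p" "J \<in> stage p"
      using v that unfolding partial_family_def gram_def f_old[OF that(1)] f_old[OF that(2)] by blast
    have "I \<in> stage p \<or> I = u" "J \<in> stage p \<or> J = u"
      using IJ by (auto simp: stage_Suc u_def)
    then show "gram ?v I J = kernel I J"
      using uu uI[of J] gram_u[of I] old by metis
  qed
  then show thesis by (rule that)
qed

lemma bold_G_complete:
  "\<exists>v\<in>bold_G h e w g N M. represents (family_of h w v) ext_moment"
proof -
  have "\<exists>V. \<forall>n. partial_family n (V n) \<and> (\<exists>z. V (Suc n) = (V n)(Suc n := z))"
    by (rule dependent_nat_choice) (use partial_family_0 extend_partial_family in blast)+
  then obtain V where V: "\<And>n. partial_family n (V n)" and step: "\<And>n. \<exists>z. V (Suc n) = (V n)(Suc n := z)"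
    by blast
  \<comment> \<open>A diagonal choice: entry q is final from stage q on, since the later stages
    change only later entries. The restriction supplies the default value at 0.\<close>
  define v where "v = restrict (\<lambda>q. V q q) {1..}"
  have V_v: "V n r = v r" if "1 \<le> r" "r \<le> n" for n r
    using that(2)
  proof (induction rule: dec_induct)
    case base
    then show ?case using that by (simp add: v_def)
  next
    case (step n)
    then show ?case using \<open>\<And>n. \<exists>z. V (Suc n) = (V n)(Suc n := z)\<close>[of n] by auto
  qed
  have gram_v: "gram v I J = kernel I J" if "I \<in> stage n" "J \<in> stage n" for I J n
  proof -
    have "family_of h w v I = family_of h w (V n) I" if "I \<in> stage n" for I
      using that by (rule family_of_cong) (simp add: V_v)
    then show ?thesis using that V[of n] by (simp add: gram_def partial_family_def)
  qed
  have gram_all: "gram v I J = kernel I J" for I J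
  proof -
    obtain a b where "I \<in> stage a" "J \<in> stage b" using in_stage by blast
    then have "I \<in> stage (max a b)" "J \<in> stage (max a b)"
      using stage_mono[OF max.cobounded1, of a b] stage_mono[OF max.cobounded2, of b a] by blast+
    then show ?thesis by (rule gram_v)
  qed
  have "admissible v q" if q: "1 \<le> q" for q
    unfolding admissible_def
  proof (intro conjI ballI)
    show "v q \<in> level q" "cinner (v q) (e q) \<in> \<real>\<^sub>\<ge>\<^sub>0"
      using V[of q] q unfolding partial_family_def V_v[OF q order_refl, symmetric] by auto
    have "complex_of_real ((norm (v q))\<^sup>2) = kernel (w q) (w q)"
      using gram_all[of "w q" "w q"] q by (simp add: gram_def cinner_self)
    then have "(norm (v q))\<^sup>2 = Re (kernel (w q) (w q))" by (metis Re_complex_of_real)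
    then show "(norm (v q))\<^sup>2 \<le> M q" using kernel_w_le[OF q] by simp
    fix E assume "E \<in> L_eqs w q"
    then have "E \<in> equations" by (simp add: L_eqs_iff)
    moreover have "eqn_holds (gram v) E \<longleftrightarrow> eqn_holds kernel E" by (rule eqn_holds_cong) (rule gram_all)
    ultimately show "eqn_holds (gram v) E" using kernel_equations by blast
  qed
  then have "v \<in> bold_G h e w g N M" by (simp add: bold_G_iff v_def)
  moreover have "represents (family_of h w v) ext_moment"
    unfolding represents_iff using gram_all by (simp add: gram_def kernel_def)
  ultimately show ?thesis by blast
qed

end

theorem theorem3p3:
  fixes s :: "nat \<Rightarrow> nat \<Rightarrow> complex"
    and h :: "nat \<Rightarrow> nat \<Rightarrow> 'h::complex_hilbert"
    and e :: "nat \<Rightarrow> 'h"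
    and w :: "nat \<Rightarrow> idx"
    and arr :: "nat \<Rightarrow> nat \<times> nat"
    and g :: "nat \<Rightarrow> 'h"
    and N :: "nat set"
    and M :: "nat \<Rightarrow> real"
  assumes "positivity_condition s"
    and "model_space s h e"
    and "bij_betw w {1..} Omega'"
    and "bij arr"
    and "g = gram_schmidt_basis (\<lambda>i. case_prod h (arr i))"
    and "N = gram_schmidt_index (\<lambda>i. case_prod h (arr i))"
    and "bounding_constants s w M"
  shows
    "((\<exists>\<mu>. moment_solution s \<mu>) \<longleftrightarrow> step0_condition h w \<and> bold_G h e w g N M \<noteq> {}) \<and>
     (step0_condition h w \<and> bold_G h e w g N M \<noteq> {} \<longrightarrow>
       (\<forall>v\<in>bold_G h e w g N M.
          family_of h w v \<in> X_set h e w \<and>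
          (\<forall>\<phi>. represents (family_of h w v) \<phi> \<longrightarrow>
            (\<exists>!\<mu>. extended_moment_solution \<phi> \<mu>) \<and>
            (\<forall>\<mu>. extended_moment_solution \<phi> \<mu> \<longrightarrow> moment_solution s \<mu>))) \<and>
       (\<forall>\<mu>. moment_solution s \<mu> \<longrightarrow>
          (\<exists>v\<in>bold_G h e w g N M. \<exists>\<phi>.
             represents (family_of h w v) \<phi> \<and> extended_moment_solution \<phi> \<mu>)))"
proof -
  interpret moment_algorithm s h e w arr g N M
    by (rule moment_algorithm.intro) (fact assms)+
  have complete: "step0_condition h w \<and> (\<exists>v\<in>bold_G h e w g N M. \<exists>\<phi>.
      represents (family_of h w v) \<phi> \<and> extended_moment_solution \<phi> \<mu>)" if "moment_solution s \<mu>" for \<mu>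
  proof -
    interpret moment_algorithm_solution s h e w arr g N M \<mu>
      by unfold_locales (fact that)
    show ?thesis using step0 bold_G_complete ext_moment_solution by blast
  qed
  have is_solution: "moment_solution s \<mu>"
    if "step0_condition h w" "v \<in> bold_G h e w g N M" "represents (family_of h w v) \<phi>" "extended_moment_solution \<phi> \<mu>"
    for v \<phi> \<mu>
    by (rule extended_is_moment_solution[OF that(4) bold_G_sound(4)[OF that(1-3)]])
  have ex1: "\<exists>!\<mu>. extended_moment_solution \<phi> \<mu>"
    if "step0_condition h w" "v \<in> bold_G h e w g N M" "represents (family_of h w v) \<phi>" for v \<phi>
    using bold_G_sound(2)[OF that] extended_solution_unique by blast
  have "\<exists>\<mu>. moment_solution s \<mu>" if st: "step0_condition h w" and ne: "bold_G h e w g N M \<noteq> {}"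
  proof -
    obtain v where v: "v \<in> bold_G h e w g N M" using ne by blast
    obtain \<phi> where \<phi>: "represents (family_of h w v) \<phi>" using bold_G_sound(3)[OF st v] by blast
    obtain \<mu> where "extended_moment_solution \<phi> \<mu>" using bold_G_sound(2)[OF st v \<phi>] by blast
    then show ?thesis using is_solution[OF st v \<phi>] by blast
  qed
  then show ?thesis
    using complete is_solution ex1 bold_G_sound(1) by blast
qed

end
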